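(* Let $\mathcal{C}$ be a rigid, pseudo-abelian, $\mathbb{Q}$-linear ACU tensor category with unit object $\mathbb{I}$, let $V\in\mathcal{C}$, and suppose that $V$ has alternating rank $g\in\mathbb{N}_{\ge1}$. Then for every $0\le i\le g$ the morphisms $$D^{i,g}:\wedge^iV\to\wedge^{g-i}V^\vee\otimes\wedge^gV^{\vee\vee},\quad D_{g-i,g}:\wedge^{g-i}V^\vee\to\wedge^{i}V\otimes\wedge^gV^{\vee},$$ $$D^{g-i,g}:\wedge^{g-i}V\to\wedge^{i}V^\vee\otimes\wedge^gV^{\vee\vee},\quad D_{i,g}:\wedge^iV^\vee\to\wedge^{g-i}V\otimes\wedge^gV^\vee$$ are isomorphisms, and the multiplication maps $\varphi_{i,g-i}^V$, $\varphi_{g-i,i}^V$, $\varphi_{i,g-i}^{V^\vee}$, $\varphi_{g-i,i}^{V^\vee}$ of the alternating algebras of $V$ and $V^\vee$ are perfect pairings, i.e. the associated morphisms $\wedge^iV\to\hom(\wedge^{g-i}V,\wedge^gV)$, $\wedge^{g-i}V\to\hom(\wedge^{i}V,\wedge^gV)$, and the same with $V^\vee$ in place of $V$, are isomorphisms. Furthermore, if $V$ has strong alternating rank $g$, then $\binom{r-i}{g-i}=\binom{r+i-g}{i}=1$ for every $0\le i\le g$, where $r=\mathrm{rank}(V)$.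
   Context: ACU tensor category: additive symmetric monoidal category with biadditive $\otimes$ and symmetry $\tau_{X,Y}$, with internal homs $\hom(X,Y)$; $X^\vee=\hom(X,\mathbb{I})$, $\mathrm{ev}_X:X^\vee\otimes X\to\mathbb{I}$, $\mathrm{ev}_X^\tau=\mathrm{ev}_X\circ\tau_{X,X^\vee}$. Rigid: the canonical maps $\bigotimes\hom(X_i,Y_i)\to\hom(\bigotimes X_i,\bigotimes Y_i)$ and $X\to X^{\vee\vee}$ are isomorphisms. Pseudo-abelian: idempotents split. $C_X:\mathbb{I}\to X\otimes X^\vee$ is the coevaluation, and $\mathrm{rank}(V)=\mathrm{ev}_V^\tau\circ C_V\in\mathrm{End}(\mathbb{I})$. $\alpha_{X,Y}:Y\otimes X^\vee\to\hom(X,Y)$ is the canonical isomorphism corresponding to $1_Y\otimes\mathrm{ev}_X$. $\binom{T}{k}=\frac1{k!}T(T-1)\cdots(T-k+1)\in\mathbb{Q}[T]$ for $k\ge1$, $\binom T0=1$. With $r=\mathrm{rank}(V)$: $V$ has alternating rank $g\in\mathbb{N}_{\ge1}$ if $\wedge^gV$ is an invertible object and $\binom{r-i}{g-i}$ and $\binom{r+i-g}{i}$ are invertible in $\mathrm{End}(\mathbb{I})$ for every $0\le i\le g$. $V$ has strong alternating rank $g$ if $\wedge^gV$ is invertible and $r=g$ (this implies alternating rank $g$). $\wedge^iV$ is the direct factor of $\otimes^iV$ cut out by the antisymmetrizer $\frac1{i!}\sum_{\sigma\in S_i}\varepsilon(\sigma)\sigma$, with injection $i_V^i$ and projection $p_V^i$;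 the multiplication is $\varphi_{i,j}^V=p_V^{i+j}\circ(i_V^i\otimes i_V^j):\wedge^iV\otimes\wedge^jV\to\wedge^{i+j}V$. $\mathrm{ev}_V^i:(\otimes^iV^\vee)\otimes(\otimes^iV)\to\mathbb{I}$ pairs the $k$-th factor $V^\vee$ with the $k$-th factor $V$ (after reordering by $\tau$), $\mathrm{ev}_V^{i,\tau}$ is its precomposition with the symmetry, and $\mathrm{ev}_V^i\circ(i_{V^\vee}^i\otimes i_V^i)$ makes $\wedge^iV^\vee:=\wedge^i(V^\vee)$ the dual of $\wedge^iV$; likewise $\wedge^iV^{\vee\vee}:=\wedge^i(V^{\vee\vee})$ is the dual of $\wedge^iV^\vee$. For $g\ge i$ let $\iota_{i,g}:\wedge^iV\to\hom(\wedge^gV^\vee,\wedge^{g-i}V^\vee)$ and $\iota^*_{i,g}:\wedge^iV^\vee\to\hom(\wedge^gV,\wedge^{g-i}V)$ correspond by adjunction to $p_{V^\vee}^{g-i}\circ(\mathrm{ev}_V^{i,\tau}\otimes1_{\otimes^{g-i}V^\vee})\circ(i_V^i\otimes i_{V^\vee}^g)$ and $p_V^{g-i}\circ(\mathrm{ev}_V^i\otimes1_{\otimes^{g-i}V})\circ(i_{V^\vee}^i\otimes i_V^g)$. Then $D^{i,g}=\alpha^{-1}\circ\iota_{i,g}$ and $D_{i,g}=\alpha^{-1}\circ\iota^*_{i,g}$. *)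

theory Defs
  imports Complex_Main "HOL-Algebra.Module" "HOL-Combinatorics.Permutations"
begin

section \<open>Rational ACU tensor categories\<close>

text \<open>
  A small category is given by a type \<^typ>\<open>'o\<close> of objects and a type \<^typ>\<open>'m\<close> of arrows: every element
  of \<^typ>\<open>'m\<close> is an arrow with a domain and a codomain. The operations on arrows are only
  constrained where they are meaningful (composable, respectively parallel, arrows). The record also
  carries the chosen constraints, the internal homs and their evaluation arrows
  \<open>Ev X Y : hom(X,Y) \<otimes> X \<rightarrow> Y\<close>. The tensor product is not assumed to be strict.
\<close>

record ('o, 'm) tensor_cat =
  Dom :: "'m \<Rightarrow> 'o"
  Cod :: "'m \<Rightarrow> 'o"
  Idt :: "'o \<Rightarrow> 'm"
  Comp :: "'m \<Rightarrow> 'm \<Rightarrow> 'm"  (infixr "\<cdot>\<index>" 60)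
  ZeroArr :: "'o \<Rightarrow> 'o \<Rightarrow> 'm"
  AddArr :: "'m \<Rightarrow> 'm \<Rightarrow> 'm"  (infixl "\<boxplus>\<index>" 55)
  ScaleArr :: "rat \<Rightarrow> 'm \<Rightarrow> 'm"
  TensorObj :: "'o \<Rightarrow> 'o \<Rightarrow> 'o"  (infixr "\<boxdot>\<index>" 75)
  Tensor :: "'m \<Rightarrow> 'm \<Rightarrow> 'm"  (infixr "\<boxtimes>\<index>" 75)
  UnitObj :: "'o"  ("\<I>\<index>")
  Assoc :: "'o \<Rightarrow> 'o \<Rightarrow> 'o \<Rightarrow> 'm"
  LUnit :: "'o \<Rightarrow> 'm"
  RUnit :: "'o \<Rightarrow> 'm"
  Sym :: "'o \<Rightarrow> 'o \<Rightarrow> 'm"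
  IHom :: "'o \<Rightarrow> 'o \<Rightarrow> 'o"
  Ev :: "'o \<Rightarrow> 'o \<Rightarrow> 'm"

definition rat_ring :: "rat ring" where
  "rat_ring = \<lparr>carrier = UNIV, monoid.mult = (*), one = 1, zero = 0, add = (+)\<rparr>"

context
  fixes C :: "('o, 'm) tensor_cat" (structure)
begin

definition Hom :: "'o \<Rightarrow> 'o \<Rightarrow> 'm set" where
  "Hom X Y = {f. Dom C f = X \<and> Cod C f = Y}"

text \<open>
  The rational vector space of arrows from \<open>X\<close> to \<open>Y\<close>. The fields \<open>mult\<close> and \<open>one\<close> are
  meaningful only for \<open>X = Y\<close>, where they make this record the endomorphism algebra of \<open>X\<close>.
\<close>
definition Hom_mod :: "'o \<Rightarrow> 'o \<Rightarrow> (rat, 'm) module" where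
  "Hom_mod X Y = \<lparr>carrier = Hom X Y, monoid.mult = Comp C, one = Idt C X,
     zero = ZeroArr C X Y, add = AddArr C, smult = ScaleArr C\<rparr>"

definition arr_iso :: "'m \<Rightarrow> 'o \<Rightarrow> 'o \<Rightarrow> bool" where
  "arr_iso f X Y \<longleftrightarrow> f \<in> Hom X Y \<and> (\<exists>g\<in>Hom Y X. g \<cdot> f = Idt C X \<and> f \<cdot> g = Idt C Y)"

definition inv_arr :: "'m \<Rightarrow> 'm" where
  "inv_arr f = (THE g. g \<in> Hom (Cod C f) (Dom C f) \<and>
     g \<cdot> f = Idt C (Dom C f) \<and> f \<cdot> g = Idt C (Cod C f))"

definition isomorphic_obj :: "'o \<Rightarrow> 'o \<Rightarrow> bool" where
  "isomorphic_obj X Y \<longleftrightarrow> (\<exists>f. arr_iso f X Y)"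

definition invertible_obj :: "'o \<Rightarrow> bool" where
  "invertible_obj X \<longleftrightarrow> (\<exists>Y. isomorphic_obj (X \<boxdot> Y) \<I>)"

end

locale rational_additive_category =
  fixes C :: "('o, 'm) tensor_cat" (structure)
  assumes Idt_in_Hom: "Idt C X \<in> Hom C X X"
    and Comp_in_Hom: "\<lbrakk>f \<in> Hom C X Y; g \<in> Hom C Y Z\<rbrakk> \<Longrightarrow> g \<cdot> f \<in> Hom C X Z"
    and Comp_Idt_left: "f \<in> Hom C X Y \<Longrightarrow> Idt C Y \<cdot> f = f"
    and Comp_Idt_right: "f \<in> Hom C X Y \<Longrightarrow> f \<cdot> Idt C X = f"
    and Comp_assoc: "\<lbrakk>f \<in> Hom C W X; g \<in> Hom C X Y; h \<in> Hom C Y Z\<rbrakk>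
      \<Longrightarrow> (h \<cdot> g) \<cdot> f = h \<cdot> (g \<cdot> f)"
    and Hom_module: "module rat_ring (Hom_mod C X Y)"
    and Comp_add_left: "\<lbrakk>f \<in> Hom C X Y; g \<in> Hom C Y Z; g' \<in> Hom C Y Z\<rbrakk>
      \<Longrightarrow> (g \<boxplus> g') \<cdot> f = (g \<cdot> f) \<boxplus> (g' \<cdot> f)"
    and Comp_add_right: "\<lbrakk>f \<in> Hom C X Y; f' \<in> Hom C X Y; g \<in> Hom C Y Z\<rbrakk>
      \<Longrightarrow> g \<cdot> (f \<boxplus> f') = (g \<cdot> f) \<boxplus> (g \<cdot> f')"
    and Comp_scale_left: "\<lbrakk>f \<in> Hom C X Y; g \<in> Hom C Y Z\<rbrakk>
      \<Longrightarrow> ScaleArr C q g \<cdot> f = ScaleArr C q (g \<cdot> f)"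
    and Comp_scale_right: "\<lbrakk>f \<in> Hom C X Y; g \<in> Hom C Y Z\<rbrakk>
      \<Longrightarrow> g \<cdot> ScaleArr C q f = ScaleArr C q (g \<cdot> f)"
    and zero_object: "\<exists>Z. Idt C Z = ZeroArr C Z Z"
    and biproducts: "\<exists>P i1 i2 p1 p2.
      i1 \<in> Hom C X P \<and> i2 \<in> Hom C Y P \<and> p1 \<in> Hom C P X \<and> p2 \<in> Hom C P Y \<and>
      p1 \<cdot> i1 = Idt C X \<and> p2 \<cdot> i2 = Idt C Y \<and>
      p2 \<cdot> i1 = ZeroArr C X Y \<and> p1 \<cdot> i2 = ZeroArr C Y X \<and>
      (i1 \<cdot> p1) \<boxplus> (i2 \<cdot> p2) = Idt C P"

locale rational_ACU_tensor_category = rational_additive_category +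
  assumes Tensor_in_Hom: "\<lbrakk>f \<in> Hom C X Y; f' \<in> Hom C X' Y'\<rbrakk>
      \<Longrightarrow> f \<boxtimes> f' \<in> Hom C (X \<boxdot> X') (Y \<boxdot> Y')"
    and Tensor_Idt: "Idt C X \<boxtimes> Idt C Y = Idt C (X \<boxdot> Y)"
    and Tensor_Comp: "\<lbrakk>f \<in> Hom C X Y; g \<in> Hom C Y Z; f' \<in> Hom C X' Y'; g' \<in> Hom C Y' Z'\<rbrakk>
      \<Longrightarrow> (g \<cdot> f) \<boxtimes> (g' \<cdot> f') = (g \<boxtimes> g') \<cdot> (f \<boxtimes> f')"
    and Tensor_add_left: "\<lbrakk>f \<in> Hom C X Y; f' \<in> Hom C X Y; h \<in> Hom C X' Y'\<rbrakk>
      \<Longrightarrow> (f \<boxplus> f') \<boxtimes> h = (f \<boxtimes> h) \<boxplus> (f' \<boxtimes> h)"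
    and Tensor_add_right: "\<lbrakk>h \<in> Hom C X' Y'; f \<in> Hom C X Y; f' \<in> Hom C X Y\<rbrakk>
      \<Longrightarrow> h \<boxtimes> (f \<boxplus> f') = (h \<boxtimes> f) \<boxplus> (h \<boxtimes> f')"
    and Assoc_iso: "arr_iso C (Assoc C X Y Z) ((X \<boxdot> Y) \<boxdot> Z) (X \<boxdot> (Y \<boxdot> Z))"
    and Assoc_natural: "\<lbrakk>f \<in> Hom C X X'; g \<in> Hom C Y Y'; h \<in> Hom C Z Z'\<rbrakk>
      \<Longrightarrow> Assoc C X' Y' Z' \<cdot> ((f \<boxtimes> g) \<boxtimes> h) = (f \<boxtimes> (g \<boxtimes> h)) \<cdot> Assoc C X Y Z"
    and pentagon: "Assoc C W X (Y \<boxdot> Z) \<cdot> Assoc C (W \<boxdot> X) Y Z =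
      (Idt C W \<boxtimes> Assoc C X Y Z) \<cdot> Assoc C W (X \<boxdot> Y) Z \<cdot> (Assoc C W X Y \<boxtimes> Idt C Z)"
    and LUnit_iso: "arr_iso C (LUnit C X) (\<I> \<boxdot> X) X"
    and LUnit_natural: "f \<in> Hom C X Y \<Longrightarrow> LUnit C Y \<cdot> (Idt C \<I> \<boxtimes> f) = f \<cdot> LUnit C X"
    and RUnit_iso: "arr_iso C (RUnit C X) (X \<boxdot> \<I>) X"
    and RUnit_natural: "f \<in> Hom C X Y \<Longrightarrow> RUnit C Y \<cdot> (f \<boxtimes> Idt C \<I>) = f \<cdot> RUnit C X"
    and triangle: "(Idt C X \<boxtimes> LUnit C Y) \<cdot> Assoc C X \<I> Y = RUnit C X \<boxtimes> Idt C Y"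
    and Sym_in_Hom: "Sym C X Y \<in> Hom C (X \<boxdot> Y) (Y \<boxdot> X)"
    and Sym_natural: "\<lbrakk>f \<in> Hom C X X'; g \<in> Hom C Y Y'\<rbrakk>
      \<Longrightarrow> Sym C X' Y' \<cdot> (f \<boxtimes> g) = (g \<boxtimes> f) \<cdot> Sym C X Y"
    and Sym_Sym: "Sym C Y X \<cdot> Sym C X Y = Idt C (X \<boxdot> Y)"
    and hexagon: "Assoc C Y Z X \<cdot> Sym C X (Y \<boxdot> Z) \<cdot> Assoc C X Y Z =
      (Idt C Y \<boxtimes> Sym C X Z) \<cdot> Assoc C Y X Z \<cdot> (Sym C X Y \<boxtimes> Idt C Z)"
    and Ev_in_Hom: "Ev C X Y \<in> Hom C (IHom C X Y \<boxdot> X) Y"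
    and Ev_universal: "f \<in> Hom C (T \<boxdot> X) Y \<Longrightarrow>
      \<exists>!h. h \<in> Hom C T (IHom C X Y) \<and> Ev C X Y \<cdot> (h \<boxtimes> Idt C X) = f"

section \<open>Duals, rigidity and rank\<close>

context
  fixes C :: "('o, 'm) tensor_cat" (structure)
begin

text \<open>The arrow \<open>T \<rightarrow> hom(X,Y)\<close> corresponding by adjunction to \<open>f : T \<otimes> X \<rightarrow> Y\<close>.\<close>
definition adjunct :: "'o \<Rightarrow> 'o \<Rightarrow> 'o \<Rightarrow> 'm \<Rightarrow> 'm" where
  "adjunct T X Y f =
     (THE h. h \<in> Hom C T (IHom C X Y) \<and> Ev C X Y \<cdot> (h \<boxtimes> Idt C X) = f)"

definition dual :: "'o \<Rightarrow> 'o" where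
  "dual X = IHom C X \<I>"

definition ev :: "'o \<Rightarrow> 'm" where
  "ev X = Ev C X \<I>"

definition ev_tau :: "'o \<Rightarrow> 'm" where
  "ev_tau X = ev X \<cdot> Sym C X (dual X)"

text \<open>The canonical isomorphism from \<open>(W \<otimes> X) \<otimes> (Y \<otimes> Z)\<close> to \<open>(W \<otimes> Y) \<otimes> (X \<otimes> Z)\<close>.\<close>
definition middle_swap :: "'o \<Rightarrow> 'o \<Rightarrow> 'o \<Rightarrow> 'o \<Rightarrow> 'm" where
  "middle_swap W X Y Z =
     inv_arr C (Assoc C W Y (X \<boxdot> Z))
     \<cdot> (Idt C W \<boxtimes> (Assoc C Y X Z \<cdot> (Sym C X Y \<boxtimes> Idt C Z) \<cdot> inv_arr C (Assoc C X Y Z)))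
     \<cdot> Assoc C W X (Y \<boxdot> Z)"

text \<open>The canonical arrow from \<open>hom(X,Y) \<otimes> hom(X',Y')\<close> to \<open>hom(X \<otimes> X', Y \<otimes> Y')\<close>.\<close>
definition IHom_tensor :: "'o \<Rightarrow> 'o \<Rightarrow> 'o \<Rightarrow> 'o \<Rightarrow> 'm" where
  "IHom_tensor X Y X' Y' =
     adjunct (IHom C X Y \<boxdot> IHom C X' Y') (X \<boxdot> X') (Y \<boxdot> Y')
       ((Ev C X Y \<boxtimes> Ev C X' Y') \<cdot> middle_swap (IHom C X Y) (IHom C X' Y') X X')"

definition bidual :: "'o \<Rightarrow> 'm" where
  "bidual X = adjunct X (dual X) \<I> (ev_tau X)"

text \<open>
  It suffices to require the first condition for families of two objects: for the empty family and
  for a single object it is automatic, and larger families are treated by iteration.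
\<close>
definition rigid :: bool where
  "rigid \<longleftrightarrow>
     (\<forall>X Y X' Y'. arr_iso C (IHom_tensor X Y X' Y')
        (IHom C X Y \<boxdot> IHom C X' Y') (IHom C (X \<boxdot> X') (Y \<boxdot> Y'))) \<and>
     (\<forall>X. arr_iso C (bidual X) X (dual (dual X)))"

text \<open>\<open>W\<close> is the direct factor of the domain of \<open>e\<close> cut out by \<open>e\<close>.\<close>
definition splits :: "'m \<Rightarrow> 'o \<Rightarrow> 'm \<Rightarrow> 'm \<Rightarrow> bool" where
  "splits e W i p \<longleftrightarrow> i \<in> Hom C W (Dom C e) \<and> p \<in> Hom C (Dom C e) W \<and>
     p \<cdot> i = Idt C W \<and> i \<cdot> p = e"

definition pseudo_abelian :: bool where
  "pseudo_abelian \<longleftrightarrow> (\<forall>X. \<forall>e\<in>Hom C X X. e \<cdot> e = e \<longrightarrow> (\<exists>W i p. splits e W i p))"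

text \<open>
  The canonical arrow \<open>Y \<otimes> D \<rightarrow> hom(X,Y)\<close> for an object \<open>D\<close> which is made a dual of \<open>X\<close> by the
  pairing \<open>e : D \<otimes> X \<rightarrow> \<I>\<close>. The arrow \<open>alpha\<close> is the special case of the internal dual.
\<close>
definition alpha_via :: "'m \<Rightarrow> 'o \<Rightarrow> 'o \<Rightarrow> 'o \<Rightarrow> 'm" where
  "alpha_via e D X Y = adjunct (Y \<boxdot> D) X Y (RUnit C Y \<cdot> (Idt C Y \<boxtimes> e) \<cdot> Assoc C Y D X)"

definition alpha :: "'o \<Rightarrow> 'o \<Rightarrow> 'm" where
  "alpha X Y = alpha_via (ev X) (dual X) X Y"

definition coev :: "'o \<Rightarrow> 'm" where
  "coev X = inv_arr C (alpha X X) \<cdot> adjunct \<I> X X (LUnit C X)"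

definition rank :: "'o \<Rightarrow> 'm" where
  "rank X = ev_tau X \<cdot> coev X"

section \<open>Binomial coefficients in the endomorphism algebra of the unit object\<close>

text \<open>The endomorphism \<open>x + q\<close>, for \<open>q\<close> rational.\<close>
definition shift :: "'m \<Rightarrow> rat \<Rightarrow> 'm" where
  "shift x q = x \<boxplus> ScaleArr C q (Idt C \<I>)"

text \<open>\<open>falling x k = x (x - 1) \<dots> (x - k + 1)\<close>, the value at \<open>x\<close> of the numerator of \<open>binom(T, k)\<close>.\<close>
primrec falling :: "'m \<Rightarrow> nat \<Rightarrow> 'm" where
  "falling x 0 = Idt C \<I>"
| "falling x (Suc k) = falling x k \<cdot> shift x (- of_nat k)"

definition binom :: "'m \<Rightarrow> nat \<Rightarrow> 'm" where
  "binom x k = ScaleArr C (1 / fact k) (falling x k)"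

section \<open>Tensor powers\<close>

text \<open>
  Tensor powers are bracketed to the right and end with the unit object; the comparisons with other
  bracketings are the canonical ones.
\<close>
primrec tpow :: "'o \<Rightarrow> nat \<Rightarrow> 'o" where
  "tpow V 0 = \<I>"
| "tpow V (Suc n) = V \<boxdot> tpow V n"

text \<open>The canonical isomorphism from \<open>tpow V m \<otimes> tpow V n\<close> to \<open>tpow V (m + n)\<close>.\<close>
primrec tjoin :: "'o \<Rightarrow> nat \<Rightarrow> nat \<Rightarrow> 'm" where
  "tjoin V 0 n = LUnit C (tpow V n)"
| "tjoin V (Suc m) n = (Idt C V \<boxtimes> tjoin V m n) \<cdot> Assoc C V (tpow V m) (tpow V n)"

text \<open>The pairing of \<open>tpow (dual V) n\<close> with \<open>tpow V n\<close>, factor by factor.\<close>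
primrec ev_pow :: "'o \<Rightarrow> nat \<Rightarrow> 'm" where
  "ev_pow V 0 = LUnit C \<I>"
| "ev_pow V (Suc n) = LUnit C \<I> \<cdot> (ev V \<boxtimes> ev_pow V n)
     \<cdot> middle_swap (dual V) (tpow (dual V) n) V (tpow V n)"

definition ev_pow_tau :: "'o \<Rightarrow> nat \<Rightarrow> 'm" where
  "ev_pow_tau V n = ev_pow V n \<cdot> Sym C (tpow V n) (tpow (dual V) n)"

text \<open>The symmetry exchanging the factors \<open>k\<close> and \<open>k + 1\<close> of \<open>tpow V n\<close>, where \<open>k + 1 < n\<close>.\<close>
fun adj_swap :: "'o \<Rightarrow> nat \<Rightarrow> nat \<Rightarrow> 'm" where
  "adj_swap V (Suc (Suc n)) 0 =
     Assoc C V V (tpow V n) \<cdot> (Sym C V V \<boxtimes> Idt C (tpow V n)) \<cdot> inv_arr C (Assoc C V V (tpow V n))"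
| "adj_swap V (Suc n) (Suc k) = Idt C V \<boxtimes> adj_swap V n k"
| "adj_swap V n k = Idt C (tpow V n)"

definition word_perm :: "nat list \<Rightarrow> nat \<Rightarrow> nat" where
  "word_perm ks = foldr (\<lambda>k \<sigma>. transpose k (Suc k) \<circ> \<sigma>) ks id"

definition word_act :: "'o \<Rightarrow> nat \<Rightarrow> nat list \<Rightarrow> 'm" where
  "word_act V n ks = foldr (\<lambda>k f. adj_swap V n k \<cdot> f) ks (Idt C (tpow V n))"

text \<open>
  The left action of the permutations of \<open>{..<n}\<close> on \<open>tpow V n\<close>: the one in which the transposition
  of \<open>k\<close> and \<open>k + 1\<close> acts by \<open>adj_swap V n k\<close>. By coherence the arrow does not depend on how the
  permutation is written as a product of such transpositions.
\<close>
definition perm_act :: "'o \<Rightarrow> nat \<Rightarrow> (nat \<Rightarrow> nat) \<Rightarrow> 'm" where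
  "perm_act V n \<sigma> =
     word_act V n (SOME ks. (\<forall>k\<in>set ks. Suc k < n) \<and> word_perm ks = \<sigma>)"

section \<open>The alternating algebra\<close>

definition antisym :: "'o \<Rightarrow> nat \<Rightarrow> 'm" where
  "antisym V n = ScaleArr C (1 / fact n)
     (finsum (Hom_mod C (tpow V n) (tpow V n))
        (\<lambda>\<sigma>. ScaleArr C (of_int (sign \<sigma>)) (perm_act V n \<sigma>)) {\<sigma>. \<sigma> permutes {..<n}})"

text \<open>A choice of a splitting of the antisymmetrizer; splittings are unique up to isomorphism.\<close>
definition wedge_data :: "'o \<Rightarrow> nat \<Rightarrow> 'o \<times> 'm \<times> 'm" where
  "wedge_data V n = (SOME (W, i, p). splits (antisym V n) W i p)"

definition wedge :: "'o \<Rightarrow> nat \<Rightarrow> 'o" where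
  "wedge V n = fst (wedge_data V n)"

definition wedge_inj :: "'o \<Rightarrow> nat \<Rightarrow> 'm" where
  "wedge_inj V n = fst (snd (wedge_data V n))"

definition wedge_proj :: "'o \<Rightarrow> nat \<Rightarrow> 'm" where
  "wedge_proj V n = snd (snd (wedge_data V n))"

definition wedge_mult :: "'o \<Rightarrow> nat \<Rightarrow> nat \<Rightarrow> 'm" where
  "wedge_mult V i j = wedge_proj V (i + j) \<cdot> tjoin V i j \<cdot> (wedge_inj V i \<boxtimes> wedge_inj V j)"

text \<open>The arrow from \<open>wedge V i\<close> to \<open>hom(wedge V j, wedge V (i + j))\<close> induced by the multiplication.\<close>
definition wedge_mult_adjunct :: "'o \<Rightarrow> nat \<Rightarrow> nat \<Rightarrow> 'm" where
  "wedge_mult_adjunct V i j = adjunct (wedge V i) (wedge V j) (wedge V (i + j)) (wedge_mult V i j)"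

text \<open>The pairing which makes \<open>wedge (dual V) n\<close> the dual of \<open>wedge V n\<close>.\<close>
definition wedge_ev :: "'o \<Rightarrow> nat \<Rightarrow> 'm" where
  "wedge_ev V n = ev_pow V n \<cdot> (wedge_inj (dual V) n \<boxtimes> wedge_inj V n)"

definition alternating_rank :: "'o \<Rightarrow> nat \<Rightarrow> bool" where
  "alternating_rank V g \<longleftrightarrow> 1 \<le> g \<and> invertible_obj C (wedge V g) \<and>
     (\<forall>i\<le>g. binom (shift (rank V) (- of_nat i)) (g - i) \<in> Units (Hom_mod C \<I> \<I>) \<and>
            binom (shift (rank V) (of_nat i - of_nat g)) i \<in> Units (Hom_mod C \<I> \<I>))"

definition strong_alternating_rank :: "'o \<Rightarrow> nat \<Rightarrow> bool" where
  "strong_alternating_rank V g \<longleftrightarrow> 1 \<le> g \<and> invertible_obj C (wedge V g) \<and>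
     rank V = ScaleArr C (of_nat g) (Idt C \<I>)"

section \<open>The duality morphisms\<close>

text \<open>
  For a pairing \<open>e : A \<otimes> B \<rightarrow> \<I>\<close>, the arrow \<open>e \<otimes> 1 : A \<otimes> (B \<otimes> Z) \<rightarrow> Z\<close>.
\<close>
definition contract :: "'m \<Rightarrow> 'o \<Rightarrow> 'o \<Rightarrow> 'o \<Rightarrow> 'm" where
  "contract e A B Z = LUnit C Z \<cdot> (e \<boxtimes> Idt C Z) \<cdot> inv_arr C (Assoc C A B Z)"

definition iota_upper :: "'o \<Rightarrow> nat \<Rightarrow> nat \<Rightarrow> 'm" where
  "iota_upper V i g = adjunct (wedge V i) (wedge (dual V) g) (wedge (dual V) (g - i))
     (wedge_proj (dual V) (g - i)
      \<cdot> contract (ev_pow_tau V i) (tpow V i) (tpow (dual V) i) (tpow (dual V) (g - i))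
      \<cdot> (Idt C (tpow V i) \<boxtimes> inv_arr C (tjoin (dual V) i (g - i)))
      \<cdot> (wedge_inj V i \<boxtimes> wedge_inj (dual V) g))"

definition iota_lower :: "'o \<Rightarrow> nat \<Rightarrow> nat \<Rightarrow> 'm" where
  "iota_lower V i g = adjunct (wedge (dual V) i) (wedge V g) (wedge V (g - i))
     (wedge_proj V (g - i)
      \<cdot> contract (ev_pow V i) (tpow (dual V) i) (tpow V i) (tpow V (g - i))
      \<cdot> (Idt C (tpow (dual V) i) \<boxtimes> inv_arr C (tjoin V i (g - i)))
      \<cdot> (wedge_inj (dual V) i \<boxtimes> wedge_inj V g))"

definition D_upper :: "'o \<Rightarrow> nat \<Rightarrow> nat \<Rightarrow> 'm" where
  "D_upper V i g =
     inv_arr C (alpha_via (wedge_ev (dual V) g) (wedge (dual (dual V)) g)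
                  (wedge (dual V) g) (wedge (dual V) (g - i)))
     \<cdot> iota_upper V i g"

definition D_lower :: "'o \<Rightarrow> nat \<Rightarrow> nat \<Rightarrow> 'm" where
  "D_lower V i g =
     inv_arr C (alpha_via (wedge_ev V g) (wedge (dual V) g) (wedge V g) (wedge V (g - i)))
     \<cdot> iota_lower V i g"

end

end

theory Submission
  imports Defs
begin

text \<open>
  By the pentagon, triangle and hexagon axioms, lists of objects form an equivalent strict category, in
  which the tensor powers, their pairings and the symmetric group action take their naive form. There
  the antisymmetrizer \<open>A\<close> satisfies \<open>(n + 1) A\<^sub>n\<^sub>+\<^sub>1 = B - n B s B\<close> with \<open>B = 1 \<otimes> A\<^sub>n\<close> and \<open>s\<close> the first swap,
  so its partial trace over one factor is \<open>(r - n) / (n + 1)\<close> times \<open>A\<^sub>n\<close>. Let \<open>W\<^sub>i\<close> and \<open>W'\<^sub>i\<close> be the exterior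
  powers of \<open>V\<close> and of its dual \<open>V'\<close>. Iterating, the comultiplication \<open>W\<^sub>j \<rightarrow> W'\<^sub>i \<otimes> W\<^sub>g\<close> followed by the
  contraction \<open>W'\<^sub>i \<otimes> W\<^sub>g \<rightarrow> W\<^sub>j\<close>, where \<open>g = i + j\<close>, is a nonzero rational multiple of \<open>binom(r - j, i)\<close>, so the
  contraction is a split epimorphism. It is also the transpose of the multiplication of \<open>W'\<^sub>j\<close> and \<open>W'\<^sub>i\<close>;
  hence it is the comultiplication \<open>W'\<^sub>i \<rightarrow> W\<^sub>j \<otimes> W'\<^sub>g\<close> tensored with \<open>W\<^sub>g\<close> and followed by the pairing of \<open>W'\<^sub>g\<close>
  with \<open>W\<^sub>g\<close>. The latter is an isomorphism because \<open>W\<^sub>g\<close> is invertible, and the former is a split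
  monomorphism by the same trace computation for \<open>V'\<close>. So the contractions are isomorphisms, and the
  multiplication maps are perfect as transposes of contractions.
\<close>

text \<open>Each of the two scalars supplies one half of an isomorphism. With
  \<open>i + j = g\<close> the composite on the side of \<open>V\<close> is
  \<open>binom(r - j, i) / binom(g, i)\<close>; on the side of the dual, which has the same rank, it
  is \<open>binom(r - i, j) / binom(g, i)\<close>.

  The factor \<open>n\<close> in the recursion counts permutations: for the subgroup
  \<open>S_n\<close> fixing the first point, \<open>S_(n+1)\<close> consists of the double cosets
  \<open>S_n\<close> and \<open>S_n s S_n\<close>, with \<open>n!\<close> and \<open>n * n!\<close>
  elements.

  Three choices keep the diagrams manageable. Powers of a pairing are nested, hence planar; the
  factorwise pairing of the statement differs by a permutation, that is, by a sign on exterior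
  powers. The antisymmetrizer is handled through absorption only: it is antisymmetric, and whatever
  is antisymmetric absorbs it. This carries it across pairings and identifies it with the average
  over permutations. Finally, "the adjunct is an isomorphism" becomes a universal property of a
  pairing, which makes no reference to chosen internal homs and so passes between the given category
  and lists.\<close>

text \<open>Domains and codomains are total and are respected even by ill-typed compositions, which are
  not arrows. With this convention most laws hold without typing conditions.\<close>
locale strict_tensor_category =
  fixes arr :: "'a \<Rightarrow> bool"
    and dm cd :: "'a \<Rightarrow> 'o list"
    and idn :: "'o list \<Rightarrow> 'a"  ("\<iota>")
    and cmp :: "'a \<Rightarrow> 'a \<Rightarrow> 'a"  (infixr "\<bullet>" 70)
    and tens :: "'a \<Rightarrow> 'a \<Rightarrow> 'a"  (infixr "\<star>" 80)
    and swp :: "'o list \<Rightarrow> 'o list \<Rightarrow> 'a"  ("\<tau>")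
    and plus_arr :: "'a \<Rightarrow> 'a \<Rightarrow> 'a"  (infixl "\<uplus>" 65)
    and scl :: "rat \<Rightarrow> 'a \<Rightarrow> 'a"  (infixr "\<rhd>" 75)
  assumes idn [simp]: "arr (\<iota> X)" "dm (\<iota> X) = X" "cd (\<iota> X) = X"
    and cmp [simp]: "dm (g \<bullet> f) = dm f" "cd (g \<bullet> f) = cd g"
      "arr (g \<bullet> f) \<longleftrightarrow> arr f \<and> arr g \<and> cd f = dm g"
    and cmp_assoc [simp]: "(h \<bullet> g) \<bullet> f = h \<bullet> g \<bullet> f"
    and cmp_idn_left: "arr f \<Longrightarrow> \<iota> (cd f) \<bullet> f = f"
    and cmp_idn_right: "arr f \<Longrightarrow> f \<bullet> \<iota> (dm f) = f"
    and tens [simp]: "dm (f \<star> g) = dm f @ dm g" "cd (f \<star> g) = cd f @ cd g"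
      "arr (f \<star> g) \<longleftrightarrow> arr f \<and> arr g"
    and tens_assoc [simp]: "(f \<star> g) \<star> h = f \<star> g \<star> h"
    and idn_tens_idn: "\<iota> X \<star> \<iota> Y = \<iota> (X @ Y)"
    and tens_unit [simp]: "arr f \<Longrightarrow> \<iota> [] \<star> f = f" "arr f \<Longrightarrow> f \<star> \<iota> [] = f"
    and interchange: "\<lbrakk>cd f = dm g; cd f' = dm g'\<rbrakk> \<Longrightarrow> (g \<star> g') \<bullet> (f \<star> f') = (g \<bullet> f) \<star> (g' \<bullet> f')"
    and swp [simp]: "arr (\<tau> X Y)" "dm (\<tau> X Y) = X @ Y" "cd (\<tau> X Y) = Y @ X"
    and swp_natural: "\<tau> (cd f) (cd g) \<bullet> (f \<star> g) = (g \<star> f) \<bullet> \<tau> (dm f) (dm g)"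
    and swp_swp [simp]: "\<tau> Y X \<bullet> \<tau> X Y = \<iota> (X @ Y)"
    and swp_append_right: "\<tau> X (Y @ Z) = (\<iota> Y \<star> \<tau> X Z) \<bullet> (\<tau> X Y \<star> \<iota> Z)"
    and plus_arr [simp]: "dm (f \<uplus> g) = dm f" "cd (f \<uplus> g) = cd f"
      "arr (f \<uplus> g) \<longleftrightarrow> arr f \<and> arr g \<and> dm f = dm g \<and> cd f = cd g"
    and plus_arr_commute: "\<lbrakk>dm f = dm g; cd f = cd g\<rbrakk> \<Longrightarrow> f \<uplus> g = g \<uplus> f"
    and plus_arr_assoc: "(f \<uplus> g) \<uplus> h = f \<uplus> (g \<uplus> h)"
    and scl [simp]: "dm (q \<rhd> f) = dm f" "cd (q \<rhd> f) = cd f" "arr (q \<rhd> f) \<longleftrightarrow> arr f"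
    and scl_plus_arr: "q \<rhd> (f \<uplus> g) = q \<rhd> f \<uplus> q \<rhd> g"
    and scl_add: "(p + q) \<rhd> f = p \<rhd> f \<uplus> q \<rhd> f"
    and scl_scl [simp]: "p \<rhd> q \<rhd> f = (p * q) \<rhd> f"
    and scl_one: "arr f \<Longrightarrow> 1 \<rhd> f = f"
    and plus_scl_zero: "\<lbrakk>arr f; arr g; dm f = dm g; cd f = cd g\<rbrakk> \<Longrightarrow> f \<uplus> 0 \<rhd> g = f"
    and plus_cmp: "(f \<uplus> g) \<bullet> h = f \<bullet> h \<uplus> g \<bullet> h"
    and cmp_plus: "h \<bullet> (f \<uplus> g) = h \<bullet> f \<uplus> h \<bullet> g"
    and scl_cmp [simp]: "(q \<rhd> f) \<bullet> h = q \<rhd> (f \<bullet> h)"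
    and cmp_scl [simp]: "h \<bullet> (q \<rhd> f) = q \<rhd> (h \<bullet> f)"
    and plus_tens: "(f \<uplus> g) \<star> h = (f \<star> h) \<uplus> (g \<star> h)"
    and tens_plus: "h \<star> (f \<uplus> g) = (h \<star> f) \<uplus> (h \<star> g)"
    and scl_tens [simp]: "(q \<rhd> f) \<star> h = q \<rhd> (f \<star> h)"
    and tens_scl [simp]: "h \<star> (q \<rhd> f) = q \<rhd> (h \<star> f)"
begin

section \<open>Calculus in a strict symmetric tensor category\<close>

lemma cmp_idn [simp]:
  "\<lbrakk>arr f; cd f = X\<rbrakk> \<Longrightarrow> \<iota> X \<bullet> f = f"
  "\<lbrakk>arr f; dm f = X\<rbrakk> \<Longrightarrow> f \<bullet> \<iota> X = f"
  using cmp_idn_left cmp_idn_right by auto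

lemma idn_tens_idn_tens [simp]: "\<iota> X \<star> \<iota> Y \<star> f = \<iota> (X @ Y) \<star> f"
  by (metis idn_tens_idn tens_assoc)

lemma cancel_left:
  assumes "k \<bullet> g = \<iota> (dm g)" "g \<bullet> f = g \<bullet> f'" "arr f" "arr f'" "cd f = dm g" "cd f' = dm g"
  shows "f = f'"
  by (metis assms cmp_assoc cmp_idn(1))

lemma cancel_right:
  assumes "g \<bullet> k = \<iota> (cd g)" "f \<bullet> g = f' \<bullet> g" "arr f" "arr f'" "dm f = cd g" "dm f' = cd g"
  shows "f = f'"
  by (metis assms cmp_assoc cmp_idn(2))

lemma tens_eq_cmp:
  assumes "arr f" "arr g"
  shows "(f \<star> \<iota> (cd g)) \<bullet> (\<iota> (dm f) \<star> g) = f \<star> g" "(\<iota> (cd f) \<star> g) \<bullet> (f \<star> \<iota> (dm g)) = f \<star> g"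
  using assms by (simp_all add: interchange)

lemma swp_natural':
  "\<lbrakk>cd f = X; cd g = Y\<rbrakk> \<Longrightarrow> \<tau> X Y \<bullet> (f \<star> g) = (g \<star> f) \<bullet> \<tau> (dm f) (dm g)"
  using swp_natural by blast

text \<open>\<open>swp_append_right\<close> for two empty lists makes the swap idempotent, and an
  invertible idempotent is an identity.\<close>

lemma swp_nil [simp]: "\<tau> X [] = \<iota> X" "\<tau> [] X = \<iota> X"
proof -
  have "\<tau> X [] \<bullet> \<tau> X [] = \<tau> X []"
    using swp_append_right[of X "[]" "[]"] by simp
  then have "\<tau> [] X \<bullet> \<tau> X [] \<bullet> \<tau> X [] = \<iota> X"
    by simp
  then show *: "\<tau> X [] = \<iota> X"
    by (metis append.right_neutral append_Nil cmp_assoc cmp_idn(1) swp(1,3) swp_swp)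
  show "\<tau> [] X = \<iota> X"
    using swp_swp[of X "[]"] by (simp add: *)
qed

text \<open>The second hexagon: both sides are inverse to \<open>\<tau> Z (X @ Y)\<close>, which the
  first hexagon decomposes.\<close>

lemma swp_append_left: "\<tau> (X @ Y) Z = (\<tau> X Z \<star> \<iota> Y) \<bullet> (\<iota> X \<star> \<tau> Y Z)"
proof (rule cancel_left[where g = "\<tau> Z (X @ Y)" and k = "\<tau> (X @ Y) Z"])
  have "\<tau> Z (X @ Y) \<bullet> (\<tau> X Z \<star> \<iota> Y) \<bullet> (\<iota> X \<star> \<tau> Y Z)
     = (\<iota> X \<star> \<tau> Z Y) \<bullet> ((\<tau> Z X \<star> \<iota> Y) \<bullet> (\<tau> X Z \<star> \<iota> Y)) \<bullet> (\<iota> X \<star> \<tau> Y Z)"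
    by (simp add: swp_append_right)
  also have "\<dots> = \<iota> (X @ Y @ Z)"
    by (simp add: interchange idn_tens_idn)
  finally show "\<tau> Z (X @ Y) \<bullet> \<tau> (X @ Y) Z = \<tau> Z (X @ Y) \<bullet> (\<tau> X Z \<star> \<iota> Y) \<bullet> (\<iota> X \<star> \<tau> Y Z)"
    by simp
qed simp_all

lemma scalar_tens_commute:
  assumes "arr z" "dm z = []" "cd z = []" "arr f"
  shows "f \<star> z = z \<star> f"
  using swp_natural[of f z] assms by simp

text \<open>A strand crossing one leg of a cap may cross the other leg instead. This is naturality
  of the swap against \<open>e\<close>, with one of the two crossings moved to the other side by its
  inverse.\<close>

lemma slide:
  assumes "arr e" "dm e = X @ Y" "cd e = []"
  shows "(e \<star> \<iota> Z) \<bullet> (\<iota> X \<star> \<tau> Z Y) = (\<iota> Z \<star> e) \<bullet> (\<tau> X Z \<star> \<iota> Y)"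
proof -
  have "(\<iota> Z \<star> e) \<bullet> (\<tau> X Z \<star> \<iota> Y) \<bullet> (\<iota> X \<star> \<tau> Y Z) = e \<star> \<iota> Z"
    using swp_natural[of e "\<iota> Z"] assms by (simp add: swp_append_left)
  then have "(e \<star> \<iota> Z) \<bullet> (\<iota> X \<star> \<tau> Z Y)
    = (\<iota> Z \<star> e) \<bullet> (\<tau> X Z \<star> \<iota> Y) \<bullet> (\<iota> X \<star> \<tau> Y Z) \<bullet> (\<iota> X \<star> \<tau> Z Y)"
    by (metis cmp_assoc)
  then show ?thesis
    by (simp add: interchange idn_tens_idn assms)
qed

lemma whisker:
  "cd f = dm g \<Longrightarrow> \<iota> X \<star> (g \<bullet> f) = (\<iota> X \<star> g) \<bullet> (\<iota> X \<star> f)"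
  "cd f = dm g \<Longrightarrow> (g \<bullet> f) \<star> \<iota> X = (g \<star> \<iota> X) \<bullet> (f \<star> \<iota> X)"
  by (simp_all add: interchange)

text \<open>Simplification brackets compositions to the right; in this form an equation for
  \<open>g \<bullet> f\<close> also rewrites in front of a tail \<open>k\<close>.\<close>

lemma reassoc: "g \<bullet> f = h \<Longrightarrow> g \<bullet> f \<bullet> k = h \<bullet> k"
  by (simp flip: cmp_assoc)

text \<open>Arrows acting on disjoint blocks of strands commute. With \<open>slide\<close> this
  replaces the deformation of string diagrams.\<close>

lemma exchange:
  assumes "arr f" "arr g"
  shows "(\<iota> X \<star> f \<star> \<iota> (Y @ cd g @ Z)) \<bullet> (\<iota> (X @ dm f @ Y) \<star> g \<star> \<iota> Z)
    = (\<iota> (X @ cd f @ Y) \<star> g \<star> \<iota> Z) \<bullet> (\<iota> X \<star> f \<star> \<iota> (Y @ dm g @ Z))"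
proof -
  have "(f \<star> \<iota> (Y @ cd g)) \<bullet> (\<iota> (dm f @ Y) \<star> g) = (\<iota> (cd f @ Y) \<star> g) \<bullet> (f \<star> \<iota> (Y @ dm g))"
    using tens_eq_cmp[of f "\<iota> Y \<star> g"] assms by (simp add: idn_tens_idn)
  then have "\<iota> X \<star> ((f \<star> \<iota> (Y @ cd g)) \<bullet> (\<iota> (dm f @ Y) \<star> g)) \<star> \<iota> Z
    = \<iota> X \<star> ((\<iota> (cd f @ Y) \<star> g) \<bullet> (f \<star> \<iota> (Y @ dm g))) \<star> \<iota> Z"
    by simp
  then show ?thesis
    by (simp add: whisker idn_tens_idn)
qed

subsection \<open>Dual pairs\<close>

definition dual_pair :: "'o list \<Rightarrow> 'o list \<Rightarrow> 'a \<Rightarrow> 'a \<Rightarrow> bool" where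
  "dual_pair X X' e c \<longleftrightarrow> arr e \<and> dm e = X' @ X \<and> cd e = [] \<and> arr c \<and> dm c = [] \<and> cd c = X @ X' \<and>
     (\<iota> X \<star> e) \<bullet> (c \<star> \<iota> X) = \<iota> X \<and> (e \<star> \<iota> X') \<bullet> (\<iota> X' \<star> c) = \<iota> X'"

lemma dual_pairD:
  assumes "dual_pair X X' e c"
  shows "arr e" "dm e = X' @ X" "cd e = []" "arr c" "dm c = []" "cd c = X @ X'"
    "(\<iota> X \<star> e) \<bullet> (c \<star> \<iota> X) = \<iota> X" "(e \<star> \<iota> X') \<bullet> (\<iota> X' \<star> c) = \<iota> X'"
  using assms by (simp_all add: dual_pair_def)

lemma dual_pair_nil: "dual_pair [] [] (\<iota> []) (\<iota> [])"
  by (simp add: dual_pair_def idn_tens_idn)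

text \<open>By \<open>slide\<close>, each zigzag of the swapped pair turns into the opposite zigzag
  of the given pair.\<close>

lemma dual_pair_swap:
  assumes "dual_pair X X' e c"
  shows "dual_pair X' X (e \<bullet> \<tau> X X') (\<tau> X X' \<bullet> c)"
proof -
  note d [simp] = dual_pairD(1-6)[OF assms]
  have "(\<iota> X' \<star> e) \<bullet> (\<iota> X' \<star> \<tau> X X') \<bullet> (\<tau> X X' \<star> \<iota> X')
      = (e \<star> \<iota> X') \<bullet> (\<tau> X X' \<star> \<iota> X') \<bullet> (\<iota> X \<star> \<tau> X' X')"
    using slide[of "e \<bullet> \<tau> X X'" X X' X'] by (simp add: whisker)
  also have "\<dots> = (e \<star> \<iota> X') \<bullet> \<tau> (X @ X') X'"
    by (simp add: swp_append_left)
  finally have s1: "(\<iota> X' \<star> e) \<bullet> (\<iota> X' \<star> \<tau> X X') \<bullet> (\<tau> X X' \<star> \<iota> X') = (e \<star> \<iota> X') \<bullet> \<tau> (X @ X') X'" .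
  have 1: "(\<iota> X' \<star> (e \<bullet> \<tau> X X')) \<bullet> ((\<tau> X X' \<bullet> c) \<star> \<iota> X')
      = ((\<iota> X' \<star> e) \<bullet> (\<iota> X' \<star> \<tau> X X') \<bullet> (\<tau> X X' \<star> \<iota> X')) \<bullet> (c \<star> \<iota> X')"
    by (simp add: whisker)
  also have "\<dots> = (e \<star> \<iota> X') \<bullet> (\<iota> X' \<star> c)"
    using swp_natural'[of c "X @ X'" "\<iota> X'" X'] by (simp add: s1)
  finally have 1: "(\<iota> X' \<star> (e \<bullet> \<tau> X X')) \<bullet> ((\<tau> X X' \<bullet> c) \<star> \<iota> X') = \<iota> X'"
    using dual_pairD(8)[OF assms] by simp
  have "(e \<star> \<iota> X) \<bullet> (\<tau> X X' \<star> \<iota> X) \<bullet> (\<iota> X \<star> \<tau> X X')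
      = (\<iota> X \<star> e) \<bullet> (\<iota> X \<star> \<tau> X X') \<bullet> (\<tau> X X \<star> \<iota> X')"
    using slide[of "e \<bullet> \<tau> X X'" X X' X] by (simp add: whisker)
  also have "\<dots> = (\<iota> X \<star> e) \<bullet> \<tau> X (X @ X')"
    by (simp add: swp_append_right)
  finally have s2: "(e \<star> \<iota> X) \<bullet> (\<tau> X X' \<star> \<iota> X) \<bullet> (\<iota> X \<star> \<tau> X X') = (\<iota> X \<star> e) \<bullet> \<tau> X (X @ X')" .
  have "((e \<bullet> \<tau> X X') \<star> \<iota> X) \<bullet> (\<iota> X \<star> (\<tau> X X' \<bullet> c))
      = ((e \<star> \<iota> X) \<bullet> (\<tau> X X' \<star> \<iota> X) \<bullet> (\<iota> X \<star> \<tau> X X')) \<bullet> (\<iota> X \<star> c)"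
    by (simp add: whisker)
  also have "\<dots> = (\<iota> X \<star> e) \<bullet> (c \<star> \<iota> X)"
    using swp_natural'[of "\<iota> X" X c "X @ X'"] by (simp add: s2)
  finally have 2: "((e \<bullet> \<tau> X X') \<star> \<iota> X) \<bullet> (\<iota> X \<star> (\<tau> X X' \<bullet> c)) = \<iota> X"
    using dual_pairD(7)[OF assms] by simp
  show ?thesis
    unfolding dual_pair_def using 1 2 by simp
qed

lemma dual_pair_scl: "\<lbrakk>dual_pair X X' e c; q \<noteq> 0\<rbrakk> \<Longrightarrow> dual_pair X X' (q \<rhd> e) ((1 / q) \<rhd> c)"
  by (simp add: dual_pair_def scl_one)

text \<open>The dual of \<open>X @ Y\<close> is taken in reversed order, so that one pairing is
  nested inside the other and no swap occurs.\<close>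

lemma dual_pair_append:
  assumes "dual_pair X X' e c" "dual_pair Y Y' f d"
  shows "dual_pair (X @ Y) (Y' @ X') (f \<bullet> (\<iota> Y' \<star> e \<star> \<iota> Y)) ((\<iota> X \<star> d \<star> \<iota> X') \<bullet> c)"
proof -
  note x [simp] = dual_pairD(1-6)[OF assms(1)] and y [simp] = dual_pairD(1-6)[OF assms(2)]
  have e1: "(\<iota> (X @ Y @ Y') \<star> e \<star> \<iota> Y) \<bullet> (\<iota> X \<star> d \<star> \<iota> (X' @ X @ Y))
    = (\<iota> X \<star> d \<star> \<iota> Y) \<bullet> (\<iota> X \<star> e \<star> \<iota> Y)"
    using exchange[of d e X "[]" Y] by simp
  have "(\<iota> (X @ Y) \<star> (f \<bullet> (\<iota> Y' \<star> e \<star> \<iota> Y))) \<bullet> (((\<iota> X \<star> d \<star> \<iota> X') \<bullet> c) \<star> \<iota> (X @ Y))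
    = (\<iota> (X @ Y) \<star> f) \<bullet> (\<iota> X \<star> d \<star> \<iota> Y) \<bullet> (\<iota> X \<star> e \<star> \<iota> Y) \<bullet> (c \<star> \<iota> (X @ Y))"
    by (simp add: whisker idn_tens_idn reassoc[OF e1])
  also have "\<dots> = (\<iota> X \<star> ((\<iota> Y \<star> f) \<bullet> (d \<star> \<iota> Y))) \<bullet> (((\<iota> X \<star> e) \<bullet> (c \<star> \<iota> X)) \<star> \<iota> Y)"
    by (simp add: whisker idn_tens_idn)
  finally have 1: "(\<iota> (X @ Y) \<star> (f \<bullet> (\<iota> Y' \<star> e \<star> \<iota> Y))) \<bullet> (((\<iota> X \<star> d \<star> \<iota> X') \<bullet> c) \<star> \<iota> (X @ Y)) = \<iota> (X @ Y)"
    using dual_pairD(7)[OF assms(1)] dual_pairD(7)[OF assms(2)] by (simp add: idn_tens_idn)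
  have e2: "(\<iota> Y' \<star> e \<star> \<iota> (Y @ Y' @ X')) \<bullet> (\<iota> (Y' @ X' @ X) \<star> d \<star> \<iota> X')
    = (\<iota> Y' \<star> d \<star> \<iota> X') \<bullet> (\<iota> Y' \<star> e \<star> \<iota> X')"
    using exchange[of e d Y' "[]" X'] by simp
  have "((f \<bullet> (\<iota> Y' \<star> e \<star> \<iota> Y)) \<star> \<iota> (Y' @ X')) \<bullet> (\<iota> (Y' @ X') \<star> ((\<iota> X \<star> d \<star> \<iota> X') \<bullet> c))
    = (f \<star> \<iota> (Y' @ X')) \<bullet> (\<iota> Y' \<star> d \<star> \<iota> X') \<bullet> (\<iota> Y' \<star> e \<star> \<iota> X') \<bullet> (\<iota> (Y' @ X') \<star> c)"
    by (simp add: whisker idn_tens_idn reassoc[OF e2])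
  also have "\<dots> = (((f \<star> \<iota> Y') \<bullet> (\<iota> Y' \<star> d)) \<star> \<iota> X') \<bullet> (\<iota> Y' \<star> ((e \<star> \<iota> X') \<bullet> (\<iota> X' \<star> c)))"
    by (simp add: whisker idn_tens_idn)
  finally have 2: "((f \<bullet> (\<iota> Y' \<star> e \<star> \<iota> Y)) \<star> \<iota> (Y' @ X')) \<bullet> (\<iota> (Y' @ X') \<star> ((\<iota> X \<star> d \<star> \<iota> X') \<bullet> c))
     = \<iota> (Y' @ X')"
    using dual_pairD(8)[OF assms(1)] dual_pairD(8)[OF assms(2)] by (simp add: idn_tens_idn)
  show ?thesis
    unfolding dual_pair_def using 1 2 by simp
qed

subsection \<open>The antisymmetrizers\<close>

definition adj :: "'o \<Rightarrow> nat \<Rightarrow> nat \<Rightarrow> 'a" where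
  "adj v n k = \<iota> (replicate k v) \<star> \<tau> [v] [v] \<star> \<iota> (replicate (n - 2 - k) v)"

lemma replicate_split: "Suc k < n \<Longrightarrow> replicate k v @ v # v # replicate (n - 2 - k) v = replicate n v"
proof -
  assume "Suc k < n"
  define m where "m = n - 2 - k"
  then have "n = k + Suc (Suc m)"
    using \<open>Suc k < n\<close> by simp
  then show ?thesis
    by (simp add: replicate_app_Cons_same flip: replicate_add)
qed

lemma adj [simp]:
  assumes "Suc k < n"
  shows "arr (adj v n k)" "dm (adj v n k) = replicate n v" "cd (adj v n k) = replicate n v"
  using replicate_split[OF assms] by (simp_all add: adj_def)

lemma adj_Suc: "adj v (Suc n) (Suc k) = \<iota> [v] \<star> adj v n k"
  by (simp add: adj_def)

lemma adj_tens_idn: "Suc k < n \<Longrightarrow> adj v n k \<star> \<iota> (replicate m v) = adj v (n + m) k"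
  by (simp add: adj_def idn_tens_idn flip: replicate_add)

lemma idn_tens_adj: "\<iota> (replicate m v) \<star> adj v n k = adj v (m + n) (m + k)"
  by (simp add: adj_def flip: replicate_add)

lemma adj_adj: "Suc k < n \<Longrightarrow> adj v n k \<bullet> adj v n k = \<iota> (replicate n v)"
  using replicate_split[of k n v] by (simp add: adj_def interchange idn_tens_idn)

lemma adj_commute:
  assumes "Suc k < l" "Suc l < n"
  shows "adj v n k \<bullet> adj v n l = adj v n l \<bullet> adj v n k"
proof -
  define m where "m = l - 2 - k"
  have l: "l = k + 2 + m" and n: "n - 2 - k = m + 2 + (n - 2 - l)"
    using assms by (simp_all add: m_def)
  have "replicate (n - 2 - k) v = replicate m v @ [v, v] @ replicate (n - 2 - l) v"
    unfolding n replicate_add by (simp add: numeral_2_eq_2)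
  moreover have "replicate l v = replicate k v @ [v, v] @ replicate m v"
    unfolding l replicate_add by (simp add: numeral_2_eq_2)
  ultimately show ?thesis
    unfolding adj_def
    using exchange[of "\<tau> [v] [v]" "\<tau> [v] [v]" "replicate k v" "replicate m v" "replicate (n - 2 - l) v"]
    by simp
qed

text \<open>Naturality of \<open>\<tau> [v] [v, v]\<close> against the swap of its last two
  strands.\<close>

lemma swp_braid:
  "(\<iota> [v] \<star> \<tau> [v] [v]) \<bullet> (\<tau> [v] [v] \<star> \<iota> [v]) \<bullet> (\<iota> [v] \<star> \<tau> [v] [v])
  = (\<tau> [v] [v] \<star> \<iota> [v]) \<bullet> (\<iota> [v] \<star> \<tau> [v] [v]) \<bullet> (\<tau> [v] [v] \<star> \<iota> [v])"
  using swp_natural[of "\<iota> [v]" "\<tau> [v] [v]"] swp_append_right[of "[v]" "[v]" "[v]"] by simp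

lemma adj_braid:
  assumes "Suc (Suc k) < n"
  shows "adj v n (Suc k) \<bullet> adj v n k \<bullet> adj v n (Suc k) = adj v n k \<bullet> adj v n (Suc k) \<bullet> adj v n k"
proof -
  define m where "m = n - 3 - k"
  have n: "n = k + 3 + m"
    using assms by (simp add: m_def)
  have 1: "adj v n k = \<iota> (replicate k v) \<star> (\<tau> [v] [v] \<star> \<iota> [v]) \<star> \<iota> (replicate m v)"
    "adj v n (Suc k) = \<iota> (replicate k v) \<star> (\<iota> [v] \<star> \<tau> [v] [v]) \<star> \<iota> (replicate m v)"
    unfolding adj_def n by (simp_all add: idn_tens_idn replicate_app_Cons_same flip: replicate_Suc)
  show ?thesis
    unfolding 1 using swp_braid[of v]
    by (simp add: interchange del: tens_assoc)
qed

text \<open>The Jones--Wenzl form of the antisymmetrizer.\<close>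
fun alt :: "'o \<Rightarrow> nat \<Rightarrow> 'a" where
  "alt v 0 = \<iota> []"
| "alt v (Suc 0) = \<iota> [v]"
| "alt v (Suc (Suc n)) = (1 / of_nat (Suc (Suc n))) \<rhd> ((\<iota> [v] \<star> alt v (Suc n)) \<uplus>
     (- of_nat (Suc n)) \<rhd> ((\<iota> [v] \<star> alt v (Suc n)) \<bullet> adj v (Suc (Suc n)) 0 \<bullet> (\<iota> [v] \<star> alt v (Suc n))))"

lemma alt [simp]: "arr (alt v n)" "dm (alt v n) = replicate n v" "cd (alt v n) = replicate n v"
  by (induction v n rule: alt.induct) simp_all

text \<open>By induction the two terms of the recursion act on \<open>X\<close> as 1 and, because of
  the swap in the middle, as -1. With their coefficients this gives (1 + (n + 1)) / (n + 2) = 1. The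
  lists \<open>Y\<close> and \<open>Z\<close> allow \<open>alt\<close> to act on a block of strands;
  \<open>Y\<close> gains a strand in each step.\<close>

lemma alt_absorb_right:
  assumes "arr X" "dm X = Y @ replicate n v @ Z"
    and "\<And>k. Suc k < n \<Longrightarrow> X \<bullet> (\<iota> Y \<star> adj v n k \<star> \<iota> Z) = (-1) \<rhd> X"
  shows "X \<bullet> (\<iota> Y \<star> alt v n \<star> \<iota> Z) = X"
  using assms
proof (induction v n arbitrary: Y rule: alt.induct)
  case (3 v n)
  let ?T = "\<iota> (Y @ [v]) \<star> alt v (Suc n) \<star> \<iota> Z" and ?S = "\<iota> Y \<star> adj v (Suc (Suc n)) 0 \<star> \<iota> Z"
  have T: "X \<bullet> ?T = X"
    using "3.prems"(1,2) "3.prems"(3)[of "Suc _"] by (intro "3.IH") (simp_all add: adj_Suc)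
  have S: "X \<bullet> ?S = (-1) \<rhd> X"
    using "3.prems"(3)[of 0] by simp
  have X: "X \<bullet> ?T \<bullet> ?S \<bullet> ?T = (-1) \<rhd> X"
    using T S by (metis cmp_assoc scl_cmp)
  have "\<iota> Y \<star> alt v (Suc (Suc n)) \<star> \<iota> Z
    = (1 / of_nat (Suc (Suc n))) \<rhd> (?T \<uplus> (- of_nat (Suc n)) \<rhd> (?T \<bullet> ?S \<bullet> ?T))"
    by (simp add: plus_tens tens_plus whisker)
  then have "X \<bullet> (\<iota> Y \<star> alt v (Suc (Suc n)) \<star> \<iota> Z)
    = (1 / of_nat (Suc (Suc n))) \<rhd> (X \<uplus> of_nat (Suc n) \<rhd> X)"
    by (simp add: cmp_plus T X del: of_nat_Suc alt.simps)
  also have "\<dots> = (1 / of_nat (Suc (Suc n))) \<rhd> (1 + of_nat (Suc n)) \<rhd> X"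
    using "3.prems"(1) by (simp only: scl_add scl_one)
  also have "\<dots> = X"
    using "3.prems"(1) by (simp add: scl_one)
  finally show ?case .
qed (simp_all add: idn_tens_idn)

lemma alt_absorb_left:
  assumes "arr X" "cd X = Y @ replicate n v @ Z"
    and "\<And>k. Suc k < n \<Longrightarrow> (\<iota> Y \<star> adj v n k \<star> \<iota> Z) \<bullet> X = (-1) \<rhd> X"
  shows "(\<iota> Y \<star> alt v n \<star> \<iota> Z) \<bullet> X = X"
  using assms
proof (induction v n arbitrary: Y rule: alt.induct)
  case (3 v n)
  let ?T = "\<iota> (Y @ [v]) \<star> alt v (Suc n) \<star> \<iota> Z" and ?S = "\<iota> Y \<star> adj v (Suc (Suc n)) 0 \<star> \<iota> Z"
  have T: "?T \<bullet> X = X"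
    using "3.prems"(1,2) "3.prems"(3)[of "Suc _"] by (intro "3.IH") (simp_all add: adj_Suc)
  have S: "?S \<bullet> X = (-1) \<rhd> X"
    using "3.prems"(3)[of 0] by simp
  have "\<iota> Y \<star> alt v (Suc (Suc n)) \<star> \<iota> Z
    = (1 / of_nat (Suc (Suc n))) \<rhd> (?T \<uplus> (- of_nat (Suc n)) \<rhd> (?T \<bullet> ?S \<bullet> ?T))"
    by (simp add: plus_tens tens_plus whisker)
  then have "(\<iota> Y \<star> alt v (Suc (Suc n)) \<star> \<iota> Z) \<bullet> X
    = (1 / of_nat (Suc (Suc n))) \<rhd> (X \<uplus> of_nat (Suc n) \<rhd> X)"
    by (simp add: plus_cmp T S del: of_nat_Suc alt.simps)
  also have "\<dots> = (1 / of_nat (Suc (Suc n))) \<rhd> (1 + of_nat (Suc n)) \<rhd> X"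
    using "3.prems"(1) by (simp only: scl_add scl_one)
  also have "\<dots> = X"
    using "3.prems"(1) by (simp add: scl_one)
  finally show ?case .
qed (simp_all add: idn_tens_idn)

text \<open>To be used with \<open>a\<close> the antisymmetrizer on all strands but the first,
  \<open>b\<close> the one on all but the first two, and \<open>s\<close>, \<open>t\<close> the
  first two swaps. Expanding only the left factor of \<open>a \<bullet> s \<bullet> a\<close> turns
  the bracket into \<open>a - s a + (N - 1) b t s a\<close>. Here \<open>s\<close> negates
  \<open>a - s a\<close> because it is an involution, and it negates \<open>b t s a\<close> by the
  braid relation and \<open>t a = - a\<close>.\<close>

lemma jones_wenzl_left:
  assumes "arr a" "arr b" "arr s" "arr t" "dm a = X" "cd a = X" "dm b = X" "cd b = X"
    "dm s = X" "cd s = X" "dm t = X" "cd t = X"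
    and ss: "s \<bullet> s = \<iota> X" and braid: "s \<bullet> t \<bullet> s = t \<bullet> s \<bullet> t" and sb: "s \<bullet> b = b \<bullet> s"
    and ba: "b \<bullet> a = a" and ta: "t \<bullet> a = (-1) \<rhd> a"
    and a: "N \<rhd> a = b \<uplus> (1 - N) \<rhd> (b \<bullet> t \<bullet> b)"
  shows "s \<bullet> (a \<uplus> (- N) \<rhd> (a \<bullet> s \<bullet> a)) = (-1) \<rhd> (a \<uplus> (- N) \<rhd> (a \<bullet> s \<bullet> a))"
proof -
  have bsa: "b \<bullet> s \<bullet> a = s \<bullet> a"
    using sb ba by (metis cmp_assoc)
  have "N \<rhd> (a \<bullet> s \<bullet> a) = (N \<rhd> a) \<bullet> s \<bullet> a"
    by simp
  also have "\<dots> = (s \<bullet> a) \<uplus> (1 - N) \<rhd> (b \<bullet> t \<bullet> s \<bullet> a)"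
    unfolding a by (simp add: plus_cmp bsa)
  finally have 1: "N \<rhd> (a \<bullet> s \<bullet> a) = (s \<bullet> a) \<uplus> (1 - N) \<rhd> (b \<bullet> t \<bullet> s \<bullet> a)" .
  have "s \<bullet> b \<bullet> t \<bullet> s \<bullet> a = b \<bullet> (s \<bullet> t \<bullet> s) \<bullet> a"
    using sb by (metis cmp_assoc)
  also have "\<dots> = (-1) \<rhd> (b \<bullet> t \<bullet> s \<bullet> a)"
    by (simp add: braid ta)
  finally have 2: "s \<bullet> b \<bullet> t \<bullet> s \<bullet> a = (-1) \<rhd> (b \<bullet> t \<bullet> s \<bullet> a)" .
  have E: "a \<uplus> (- N) \<rhd> (a \<bullet> s \<bullet> a) = a \<uplus> ((-1) \<rhd> (s \<bullet> a) \<uplus> (N - 1) \<rhd> (b \<bullet> t \<bullet> s \<bullet> a))"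
    using arg_cong[OF 1, of "\<lambda>x. (-1) \<rhd> x"] by (simp add: scl_plus_arr)
  have "s \<bullet> (a \<uplus> (- N) \<rhd> (a \<bullet> s \<bullet> a))
      = (s \<bullet> a) \<uplus> ((-1) \<rhd> (s \<bullet> s \<bullet> a) \<uplus> (N - 1) \<rhd> (s \<bullet> b \<bullet> t \<bullet> s \<bullet> a))"
    unfolding E by (simp add: cmp_plus)
  also have "\<dots> = (s \<bullet> a) \<uplus> ((-1) \<rhd> a \<uplus> (1 - N) \<rhd> (b \<bullet> t \<bullet> s \<bullet> a))"
    using assms(1,5,6) by (simp add: 2 reassoc[OF ss])
  also have "\<dots> = (-1) \<rhd> (a \<uplus> ((-1) \<rhd> (s \<bullet> a) \<uplus> (N - 1) \<rhd> (b \<bullet> t \<bullet> s \<bullet> a)))"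
    using assms by (simp add: scl_plus_arr scl_one plus_arr_commute[of "s \<bullet> a"] flip: plus_arr_assoc)
  finally show ?thesis
    unfolding E .
qed

lemma jones_wenzl_right:
  assumes "arr a" "arr b" "arr s" "arr t" "dm a = X" "cd a = X" "dm b = X" "cd b = X"
    "dm s = X" "cd s = X" "dm t = X" "cd t = X"
    and ss: "s \<bullet> s = \<iota> X" and braid: "s \<bullet> t \<bullet> s = t \<bullet> s \<bullet> t" and sb: "s \<bullet> b = b \<bullet> s"
    and ab: "a \<bullet> b = a" and at: "a \<bullet> t = (-1) \<rhd> a"
    and a: "N \<rhd> a = b \<uplus> (1 - N) \<rhd> (b \<bullet> t \<bullet> b)"
  shows "(a \<uplus> (- N) \<rhd> (a \<bullet> s \<bullet> a)) \<bullet> s = (-1) \<rhd> (a \<uplus> (- N) \<rhd> (a \<bullet> s \<bullet> a))"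
proof -
  have asb: "a \<bullet> s \<bullet> b = a \<bullet> s"
    using sb ab by (metis cmp_assoc)
  have "N \<rhd> (a \<bullet> s \<bullet> a) = a \<bullet> s \<bullet> (N \<rhd> a)"
    by simp
  also have "\<dots> = (a \<bullet> s) \<uplus> (1 - N) \<rhd> (a \<bullet> s \<bullet> t \<bullet> b)"
    unfolding a using asb by (simp add: cmp_plus) (metis cmp_assoc)
  finally have 1: "N \<rhd> (a \<bullet> s \<bullet> a) = (a \<bullet> s) \<uplus> (1 - N) \<rhd> (a \<bullet> s \<bullet> t \<bullet> b)" .
  have "a \<bullet> s \<bullet> t \<bullet> b \<bullet> s = a \<bullet> (s \<bullet> t \<bullet> s) \<bullet> b"
    using sb by simp
  also have "\<dots> = (a \<bullet> t) \<bullet> s \<bullet> t \<bullet> b"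
    by (simp add: braid)
  finally have 2: "a \<bullet> s \<bullet> t \<bullet> b \<bullet> s = (-1) \<rhd> (a \<bullet> s \<bullet> t \<bullet> b)"
    by (simp add: at)
  have E: "a \<uplus> (- N) \<rhd> (a \<bullet> s \<bullet> a) = a \<uplus> ((-1) \<rhd> (a \<bullet> s) \<uplus> (N - 1) \<rhd> (a \<bullet> s \<bullet> t \<bullet> b))"
    using arg_cong[OF 1, of "\<lambda>x. (-1) \<rhd> x"] by (simp add: scl_plus_arr)
  have "(a \<uplus> (- N) \<rhd> (a \<bullet> s \<bullet> a)) \<bullet> s
      = (a \<bullet> s) \<uplus> ((-1) \<rhd> (a \<bullet> s \<bullet> s) \<uplus> (N - 1) \<rhd> (a \<bullet> s \<bullet> t \<bullet> b \<bullet> s))"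
    unfolding E by (simp add: plus_cmp)
  also have "\<dots> = (a \<bullet> s) \<uplus> ((-1) \<rhd> a \<uplus> (1 - N) \<rhd> (a \<bullet> s \<bullet> t \<bullet> b))"
    using assms(1,5,6) by (simp add: 2 ss)
  also have "\<dots> = (-1) \<rhd> (a \<uplus> ((-1) \<rhd> (a \<bullet> s) \<uplus> (N - 1) \<rhd> (a \<bullet> s \<bullet> t \<bullet> b)))"
    using assms by (simp add: scl_plus_arr scl_one plus_arr_commute[of "a \<bullet> s"] flip: plus_arr_assoc)
  finally show ?thesis
    unfolding E .
qed

text \<open>A swap not involving the first strand is absorbed by the outer factors of the recursion.
  For the first swap this is the computation of \<open>jones_wenzl_left\<close> and
  \<open>jones_wenzl_right\<close>, whose relations between \<open>a\<close> and \<open>b\<close>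
  come from the induction hypothesis by absorption.\<close>

lemma adj_alt_both:
  "Suc k < n \<Longrightarrow> adj v n k \<bullet> alt v n = (-1) \<rhd> alt v n \<and> alt v n \<bullet> adj v n k = (-1) \<rhd> alt v n"
proof (induction v n arbitrary: k rule: alt.induct)
  case (3 v n)
  let ?a = "\<iota> [v] \<star> alt v (Suc n)" and ?s = "adj v (Suc (Suc n)) 0" and ?N = "of_nat (Suc n) :: rat"
  let ?E = "?a \<uplus> (- ?N) \<rhd> (?a \<bullet> ?s \<bullet> ?a)"
  have E: "alt v (Suc (Suc n)) = (1 / of_nat (Suc (Suc n))) \<rhd> ?E"
    by simp
  have "adj v (Suc (Suc n)) k \<bullet> ?E = (-1) \<rhd> ?E \<and> ?E \<bullet> adj v (Suc (Suc n)) k = (-1) \<rhd> ?E"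
  proof (cases k)
    case (Suc k')
    then have k': "Suc k' < Suc n"
      using "3.prems" by simp
    have 1: "adj v (Suc (Suc n)) k \<bullet> ?a = (-1) \<rhd> ?a" "?a \<bullet> adj v (Suc (Suc n)) k = (-1) \<rhd> ?a"
      using "3.IH"[OF k'] k' by (simp_all add: Suc adj_Suc interchange)
    then show ?thesis
      by (simp add: cmp_plus plus_cmp scl_plus_arr reassoc[OF 1(1)])
  next
    case 0
    show ?thesis
    proof (cases n)
      \<comment> \<open>On two strands \<open>?a\<close> is an identity and not an instance of the
        recursion; the antisymmetry of \<open>1 - s\<close> is checked directly.\<close>
      case n: 0
      have "?s \<bullet> ?s = \<iota> [v, v]"
        using adj_adj[of 0 "Suc (Suc 0)" v] n by simp
      then show ?thesis
        using n 0 by (simp add: idn_tens_idn cmp_plus plus_cmp scl_plus_arr scl_one plus_arr_commute[of "adj v (Suc (Suc 0)) 0" "(- 1) \<rhd> \<iota> [v, v]"])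
    next
      case (Suc m)
      let ?b = "\<iota> [v, v] \<star> alt v (Suc m)" and ?t = "\<iota> [v] \<star> adj v (Suc (Suc m)) 0"
      let ?X = "replicate (Suc (Suc n)) v"
      have ss: "?s \<bullet> ?s = \<iota> ?X"
        using adj_adj[of 0 "Suc (Suc n)" v] by simp
      have t: "?t = adj v (Suc (Suc n)) (Suc 0)"
        by (simp add: Suc adj_Suc)
      have braid: "?s \<bullet> ?t \<bullet> ?s = ?t \<bullet> ?s \<bullet> ?t"
        unfolding t using adj_braid[of 0 "Suc (Suc n)" v] by (simp add: Suc)
      have sb: "?s \<bullet> ?b = ?b \<bullet> ?s"
        using exchange[of "\<tau> [v] [v]" "alt v (Suc m)" "[]" "[]" "[]"] by (simp add: adj_def Suc)
      have IH: "\<And>k. Suc k < Suc n \<Longrightarrow> adj v (Suc n) k \<bullet> alt v (Suc n) = (-1) \<rhd> alt v (Suc n)"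
        "\<And>k. Suc k < Suc n \<Longrightarrow> alt v (Suc n) \<bullet> adj v (Suc n) k = (-1) \<rhd> alt v (Suc n)"
        using "3.IH" by auto
      have ba': "(\<iota> [v] \<star> alt v (Suc m)) \<bullet> alt v (Suc n) = alt v (Suc n)"
        using alt_absorb_left[of "alt v (Suc n)" "[v]" "Suc m" v "[]"] IH(1)[of "Suc _"]
        by (simp add: Suc adj_Suc)
      have ab': "alt v (Suc n) \<bullet> (\<iota> [v] \<star> alt v (Suc m)) = alt v (Suc n)"
        using alt_absorb_right[of "alt v (Suc n)" "[v]" "Suc m" v "[]"] IH(2)[of "Suc _"]
        by (simp add: Suc adj_Suc)
      have ba: "?b \<bullet> ?a = ?a" and ab: "?a \<bullet> ?b = ?a"
        using arg_cong[OF ba', of "\<lambda>x. \<iota> [v] \<star> x"] arg_cong[OF ab', of "\<lambda>x. \<iota> [v] \<star> x"]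
        by (simp_all add: whisker Suc del: alt.simps)
      have ta: "?t \<bullet> ?a = (-1) \<rhd> ?a" and at: "?a \<bullet> ?t = (-1) \<rhd> ?a"
        using IH[of 0] by (simp_all add: interchange Suc del: alt.simps)
      \<comment> \<open>The recursion one level down, cleared of its denominator;
        \<open>1 - ?N\<close> is its coefficient \<open>- of_nat n\<close>.\<close>
      have "?N \<rhd> alt v (Suc n) = (\<iota> [v] \<star> alt v (Suc m)) \<uplus>
        (1 - ?N) \<rhd> ((\<iota> [v] \<star> alt v (Suc m)) \<bullet> adj v (Suc (Suc m)) 0 \<bullet> (\<iota> [v] \<star> alt v (Suc m)))"
        by (simp add: Suc scl_one)
      then have "\<iota> [v] \<star> (?N \<rhd> alt v (Suc n)) = \<iota> [v] \<star> ((\<iota> [v] \<star> alt v (Suc m)) \<uplus>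
        (1 - ?N) \<rhd> ((\<iota> [v] \<star> alt v (Suc m)) \<bullet> adj v (Suc (Suc m)) 0 \<bullet> (\<iota> [v] \<star> alt v (Suc m))))"
        by (rule arg_cong)
      then have a: "?N \<rhd> ?a = ?b \<uplus> (1 - ?N) \<rhd> (?b \<bullet> ?t \<bullet> ?b)"
        by (simp add: tens_plus whisker del: alt.simps)
      have ty: "arr ?a" "arr ?b" "arr ?s" "arr ?t" "dm ?a = ?X" "cd ?a = ?X" "dm ?b = ?X" "cd ?b = ?X"
        "dm ?s = ?X" "cd ?s = ?X" "dm ?t = ?X" "cd ?t = ?X"
        by (simp_all add: Suc del: alt.simps)
      show ?thesis
        using jones_wenzl_left[OF ty ss braid sb ba ta a] jones_wenzl_right[OF ty ss braid sb ab at a]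
        unfolding 0 by blast
    qed
  qed
  then show ?case
    unfolding E by simp
qed simp_all

lemmas adj_alt = adj_alt_both[THEN conjunct1] and alt_adj = adj_alt_both[THEN conjunct2]

lemma alt_idem: "alt v n \<bullet> alt v n = alt v n"
  using alt_absorb_right[of "alt v n" "[]" n v "[]"] alt_adj by simp

lemma alt_cmp_tens_alt:
  "alt v (k + n) \<bullet> (\<iota> (replicate k v) \<star> alt v n) = alt v (k + n)"
  "alt v (n + k) \<bullet> (alt v n \<star> \<iota> (replicate k v)) = alt v (n + k)"
  using alt_absorb_right[of "alt v (k + n)" "replicate k v" n v "[]"]
    alt_absorb_right[of "alt v (n + k)" "[]" n v "replicate k v"] alt_adj
  by (simp_all add: replicate_add idn_tens_adj adj_tens_idn)

lemma tens_alt_cmp_alt: "(alt v n \<star> \<iota> (replicate k v)) \<bullet> alt v (n + k) = alt v (n + k)"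
  using alt_absorb_left[of "alt v (n + k)" "[]" n v "replicate k v"] adj_alt
  by (simp add: replicate_add adj_tens_idn)

text \<open>Permutation arrows without their permutations. In comparing two powers of a pairing it
  only matters that some composite of adjacent swaps relates them.\<close>

inductive_set words :: "'o \<Rightarrow> nat \<Rightarrow> 'a set" for v n where
  idn: "\<iota> (replicate n v) \<in> words v n"
| adj: "\<lbrakk>w \<in> words v n; Suc k < n\<rbrakk> \<Longrightarrow> adj v n k \<bullet> w \<in> words v n"

lemma words_arr:
  assumes "w \<in> words v n" shows "arr w" "dm w = replicate n v" "cd w = replicate n v"
  using assms by (induction) auto

lemma words_cmp: "\<lbrakk>u \<in> words v n; w \<in> words v n\<rbrakk> \<Longrightarrow> u \<bullet> w \<in> words v n"
  by (induction rule: words.induct) (auto intro: words.intros simp: words_arr)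

lemma adj_in_words: "Suc k < n \<Longrightarrow> adj v n k \<in> words v n"
  using words.adj[OF words.idn, of k n v] by simp

lemma words_tens_idn: "w \<in> words v n \<Longrightarrow> w \<star> \<iota> (replicate m v) \<in> words v (n + m)"
proof (induction rule: words.induct)
  case idn
  then show ?case
    using words.idn by (simp add: idn_tens_idn flip: replicate_add)
next
  case (adj w k)
  then show ?case
    using words.adj[OF adj.IH, of k] by (simp add: whisker words_arr adj_tens_idn)
qed

lemma idn_tens_words: "w \<in> words v n \<Longrightarrow> \<iota> (replicate m v) \<star> w \<in> words v (m + n)"
proof (induction rule: words.induct)
  case idn
  then show ?case
    using words.idn by (simp add: idn_tens_idn flip: replicate_add)
next
  case (adj w k)
  then show ?case
    using words.adj[OF adj.IH, of "m + k"] by (simp add: whisker words_arr idn_tens_adj)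
qed

lemma swp_in_words: "\<tau> [v] (replicate n v) \<in> words v (Suc n)"
proof (induction n)
  case 0
  then show ?case
    using words.idn[of "Suc 0" v] by simp
next
  case (Suc n)
  have "\<tau> [v] (replicate (Suc n) v) = (\<iota> [v] \<star> \<tau> [v] (replicate n v)) \<bullet> adj v (Suc (Suc n)) 0"
    using swp_append_right[of "[v]" "[v]" "replicate n v"] by (simp add: adj_def)
  then show ?case
    using words_cmp[OF idn_tens_words[OF Suc, of 1, simplified] adj_in_words[of 0 "Suc (Suc n)" v]] by simp
qed

text \<open>Which sign occurs is left open: rescaling by a nonzero rational preserves dual pairs and
  universality.\<close>

lemma words_sign:
  assumes "w \<in> words v n" "arr X" "cd X = replicate n v"
    "\<And>k. Suc k < n \<Longrightarrow> adj v n k \<bullet> X = (-1) \<rhd> X"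
  shows "\<exists>\<epsilon>\<in>{1, -1}. w \<bullet> X = \<epsilon> \<rhd> X"
  using assms(1)
proof (induction rule: words.induct)
  case idn
  then show ?case
    using assms by (intro bexI[of _ 1]) (simp_all add: scl_one)
next
  case (adj w k)
  then obtain \<epsilon> where "\<epsilon> \<in> {1, -1}" "w \<bullet> X = \<epsilon> \<rhd> X"
    by blast
  then show ?case
    using assms(4)[OF adj.hyps(2)] by (intro bexI[of _ "- \<epsilon>"]) auto
qed

subsection \<open>Powers of a pairing\<close>

text \<open>In the powers of a pairing the factors are matched from the inside to the outside. With this
  convention no braiding is needed.\<close>
primrec pairing_pow :: "'o \<Rightarrow> 'o \<Rightarrow> 'a \<Rightarrow> nat \<Rightarrow> 'a" where
  "pairing_pow v v' e 0 = \<iota> []"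
| "pairing_pow v v' e (Suc n) = pairing_pow v v' e n \<bullet> (\<iota> (replicate n v') \<star> e \<star> \<iota> (replicate n v))"

primrec copairing_pow :: "'o \<Rightarrow> 'o \<Rightarrow> 'a \<Rightarrow> nat \<Rightarrow> 'a" where
  "copairing_pow v v' c 0 = \<iota> []"
| "copairing_pow v v' c (Suc n) = (\<iota> [v] \<star> copairing_pow v v' c n \<star> \<iota> [v']) \<bullet> c"

text \<open>The strict form of \<^const>\<open>ev_pow\<close>. It agrees with \<open>pairing_pow\<close> up to a permutation of the factors,
  which acts on exterior powers by a sign.\<close>
primrec parallel_pow :: "'o \<Rightarrow> 'o \<Rightarrow> 'a \<Rightarrow> nat \<Rightarrow> 'a" where
  "parallel_pow v v' e 0 = \<iota> []"
| "parallel_pow v v' e (Suc n) =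
     (e \<star> parallel_pow v v' e n) \<bullet> (\<iota> [v'] \<star> \<tau> (replicate n v') [v] \<star> \<iota> (replicate n v))"

text \<open>The product of (r - k) / (k + 1) over \<open>j \<le> k < i + j\<close>, that is,
  \<open>binom(r - j, i) / binom(i + j, i)\<close>. Each factor comes from closing one
  strand.\<close>

primrec trace_coeff :: "'a \<Rightarrow> nat \<Rightarrow> nat \<Rightarrow> 'a" where
  "trace_coeff r 0 j = \<iota> []"
| "trace_coeff r (Suc i) j =
     (1 / of_nat (Suc (i + j))) \<rhd> (trace_coeff r i j \<bullet> (r \<uplus> (- of_nat (i + j)) \<rhd> \<iota> []))"

text \<open>Exchanging the two sides turns a nested pairing inside out: \<open>e\<close> was the
  inner pairing and becomes the outer one. In \<open>E_swap\<close> this is compensated by reading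
  the recursion of the power from the outside.\<close>

lemma swap_nested_pairing:
  assumes "arr e" "dm e = X' @ X" "cd e = []" "arr f" "dm f = Y' @ Y" "cd f = []"
  shows "f \<bullet> (\<iota> Y' \<star> e \<star> \<iota> Y) \<bullet> \<tau> (X @ Y) (Y' @ X')
    = (e \<bullet> \<tau> X X') \<bullet> (\<iota> X \<star> (f \<bullet> \<tau> Y Y') \<star> \<iota> X')"
proof -
  note [simp] = assms
  let ?e = "e \<bullet> \<tau> X X'"
  \<comment> \<open>The block crossing is factored so that \<open>\<tau> X X'\<close> comes last,
    directly below \<open>e\<close>, and \<open>\<tau> Y Y'\<close> comes first. Of the two
    remaining crossings, one is removed by sliding \<open>e\<close> and the other by naturality
    against \<open>f\<close>.\<close>
  have t: "\<tau> (X @ Y) (Y' @ X') = (\<iota> Y' \<star> \<tau> X X' \<star> \<iota> Y) \<bullet> (\<tau> X Y' \<star> \<iota> (X' @ Y))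
      \<bullet> (\<iota> (X @ Y') \<star> \<tau> Y X') \<bullet> (\<iota> X \<star> \<tau> Y Y' \<star> \<iota> X')"
    unfolding swp_append_left swp_append_right[of X Y'] swp_append_right[of Y Y']
    by (simp add: whisker idn_tens_idn)
  have s: "(\<iota> Y' \<star> ?e) \<bullet> (\<tau> X Y' \<star> \<iota> X') = (?e \<star> \<iota> Y') \<bullet> (\<iota> X \<star> \<tau> Y' X')"
    by (rule slide[symmetric]) simp_all
  have s': "((\<iota> Y' \<star> ?e) \<bullet> (\<tau> X Y' \<star> \<iota> X')) \<star> \<iota> Y = ((?e \<star> \<iota> Y') \<bullet> (\<iota> X \<star> \<tau> Y' X')) \<star> \<iota> Y"
    by (simp only: s)
  have "f \<bullet> (\<iota> Y' \<star> e \<star> \<iota> Y) \<bullet> \<tau> (X @ Y) (Y' @ X')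
    = f \<bullet> (((\<iota> Y' \<star> ?e) \<bullet> (\<tau> X Y' \<star> \<iota> X')) \<star> \<iota> Y) \<bullet> (\<iota> (X @ Y') \<star> \<tau> Y X') \<bullet> (\<iota> X \<star> \<tau> Y Y' \<star> \<iota> X')"
    unfolding t by (simp add: whisker idn_tens_idn)
  also have "\<dots> = f \<bullet> (?e \<star> \<iota> (Y' @ Y)) \<bullet> (\<iota> X \<star> ((\<tau> Y' X' \<star> \<iota> Y) \<bullet> (\<iota> Y' \<star> \<tau> Y X'))) \<bullet> (\<iota> X \<star> \<tau> Y Y' \<star> \<iota> X')"
    unfolding s' by (simp add: whisker idn_tens_idn)
  also have "\<dots> = (?e \<bullet> (\<iota> (X @ X') \<star> f)) \<bullet> (\<iota> X \<star> \<tau> (Y' @ Y) X') \<bullet> (\<iota> X \<star> \<tau> Y Y' \<star> \<iota> X')"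
    using exchange[of ?e f "[]" "[]" "[]"] by (simp add: swp_append_left)
  also have "\<dots> = ?e \<bullet> (\<iota> X \<star> ((\<iota> X' \<star> f) \<bullet> \<tau> (Y' @ Y) X')) \<bullet> (\<iota> X \<star> \<tau> Y Y' \<star> \<iota> X')"
    by (simp add: whisker)
  also have "(\<iota> X' \<star> f) \<bullet> \<tau> (Y' @ Y) X' = f \<star> \<iota> X'"
    using swp_natural'[of f "[]" "\<iota> X'" X'] by simp
  finally show ?thesis
    by (simp add: whisker)
qed

end

section \<open>Tensor powers of a dual pair\<close>

locale dual_objects = strict_tensor_category +
  fixes v v' :: 'b and e c :: 'a
  assumes dual: "dual_pair [v] [v'] e c"
begin

abbreviation "E \<equiv> pairing_pow v v' e"
abbreviation "K \<equiv> copairing_pow v v' c"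

lemmas e [simp] = dual_pairD(1-3)[OF dual, simplified]
lemmas c [simp] = dual_pairD(4-6)[OF dual, simplified]

text \<open>Everything proved for \<open>v\<close> transfers to \<open>v'\<close> through this
  interpretation.\<close>

lemma swapped: "dual_objects arr dm cd \<iota> (\<bullet>) (\<star>) \<tau> (\<uplus>) (\<rhd>) v' v (e \<bullet> \<tau> [v] [v']) (\<tau> [v] [v'] \<bullet> c)"
  using dual_pair_swap[OF dual] by unfold_locales

lemma dual_pow: "dual_pair (replicate n v) (replicate n v') (E n) (K n)"
proof (induction n)
  case (Suc n)
  show ?case
    using dual_pair_append[OF dual Suc] by (simp add: replicate_append_same)
qed (simp add: dual_pair_nil)

lemmas E [simp] = dual_pairD(1-3)[OF dual_pow]
lemmas K [simp] = dual_pairD(4-6)[OF dual_pow]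

text \<open>\<open>E\<close> is defined by adding the new pair at the innermost place and
  \<open>K\<close> by adding it at the outermost. To close strands one at a time both must expose
  the innermost pair.\<close>

lemma K_Suc_inner: "K (Suc n) = (\<iota> (replicate n v) \<star> c \<star> \<iota> (replicate n v')) \<bullet> K n"
proof (induction n)
  case (Suc n)
  have "K (Suc (Suc n)) = (\<iota> [v] \<star> ((\<iota> (replicate n v) \<star> c \<star> \<iota> (replicate n v')) \<bullet> K n) \<star> \<iota> [v']) \<bullet> c"
    unfolding Suc[symmetric] by simp
  then show ?case
    by (simp add: whisker idn_tens_idn replicate_append_same del: copairing_pow.simps)
       (simp add: replicate_append_same)
qed (simp add: idn_tens_idn)

lemma E_add: "E (i + j) = E j \<bullet> (\<iota> (replicate j v') \<star> E i \<star> \<iota> (replicate j v))"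
proof (induction i)
  case (Suc i)
  then show ?case
    by (simp add: whisker idn_tens_idn add.commute flip: replicate_add)
qed (simp add: idn_tens_idn)

lemma E_Suc_outer: "E (Suc n) = e \<bullet> (\<iota> [v'] \<star> E n \<star> \<iota> [v])"
  using E_add[of n "Suc 0"] by (simp add: idn_tens_idn)

lemma E_swap: "E n \<bullet> \<tau> (replicate n v) (replicate n v') = pairing_pow v' v (e \<bullet> \<tau> [v] [v']) n"
proof (induction n)
  case (Suc n)
  interpret swapped: dual_objects arr dm cd \<iota> "(\<bullet>)" "(\<star>)" \<tau> "(\<uplus>)" "(\<rhd>)" v' v "e \<bullet> \<tau> [v] [v']" "\<tau> [v] [v'] \<bullet> c"
    by (rule swapped)
  show ?case
    using swap_nested_pairing[of e "[v']" "[v]" "E n" "replicate n v'" "replicate n v"]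
    by (simp add: swapped.E_Suc_outer Suc[symmetric] replicate_append_same del: pairing_pow.simps(2))
      (simp add: replicate_append_same)
qed simp

lemma e_slide: "(e \<star> \<iota> Z) \<bullet> (\<iota> [v'] \<star> \<tau> Z [v]) = (\<iota> Z \<star> e) \<bullet> (\<tau> [v'] Z \<star> \<iota> [v])"
  by (rule slide) simp_all

text \<open>Sliding \<open>e\<close> over the remaining dual factors brings the first dual factor
  next to the factors \<open>v\<close>. The crossings of \<open>v\<close> with dual factors become
  crossings of \<open>v'\<close> with dual factors, so the accumulated permutation acts on the
  powers of \<open>v'\<close> alone.\<close>

lemma parallel_pow: "\<exists>w\<in>words v' n. parallel_pow v v' e n = E n \<bullet> (w \<star> \<iota> (replicate n v))"
proof (induction n)
  case 0
  then show ?case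
    using words.idn[of 0 v'] by (intro bexI[of _ "\<iota> []"]) simp_all
next
  case (Suc n)
  then obtain w where w: "w \<in> words v' n" and n: "parallel_pow v v' e n = E n \<bullet> (w \<star> \<iota> (replicate n v))"
    by blast
  note [simp] = words_arr[OF w]
  let ?V = "replicate n v" and ?V' = "replicate n v'"
  let ?w = "(w \<star> \<iota> [v']) \<bullet> \<tau> [v'] ?V'"
  have "parallel_pow v v' e (Suc n)
    = (parallel_pow v v' e n \<bullet> (e \<star> \<iota> (?V' @ ?V))) \<bullet> (\<iota> [v'] \<star> \<tau> ?V' [v] \<star> \<iota> ?V)"
    using tens_eq_cmp(2)[of e "E n"] interchange[of e "\<iota> []" "\<iota> (?V' @ ?V)" "parallel_pow v v' e n"] n by simp
  also have "\<dots> = E n \<bullet> (w \<star> \<iota> ?V) \<bullet> (((e \<star> \<iota> ?V') \<bullet> (\<iota> [v'] \<star> \<tau> ?V' [v])) \<star> \<iota> ?V)"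
    by (simp add: n whisker idn_tens_idn)
  also have "\<dots> = E n \<bullet> ((w \<star> \<iota> ?V) \<bullet> (\<iota> ?V' \<star> e \<star> \<iota> ?V)) \<bullet> (\<tau> [v'] ?V' \<star> \<iota> (v # ?V))"
    unfolding e_slide by (simp add: whisker idn_tens_idn)
  also have "(w \<star> \<iota> ?V) \<bullet> (\<iota> ?V' \<star> e \<star> \<iota> ?V) = (\<iota> ?V' \<star> e \<star> \<iota> ?V) \<bullet> (w \<star> \<iota> (v' # v # ?V))"
    using exchange[of w e "[]" "[]" ?V] by simp
  finally have "parallel_pow v v' e (Suc n) = E (Suc n) \<bullet> (?w \<star> \<iota> (replicate (Suc n) v))"
    by (simp add: whisker idn_tens_idn replicate_append_same)
  moreover have "?w \<in> words v' (Suc n)"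
    using words_cmp[OF words_tens_idn[OF w, of 1, simplified] swp_in_words] by simp
  ultimately show ?case
    by blast
qed

text \<open>After \<open>slide\<close>, each side is two disjoint copies of \<open>e\<close> above
  the same crossing, and they may be evaluated in either order.\<close>

lemma E2_swp: "E 2 \<bullet> (\<iota> [v', v'] \<star> \<tau> [v] [v]) = E 2 \<bullet> (\<tau> [v'] [v'] \<star> \<iota> [v, v])"
proof -
  have E2: "E 2 = e \<bullet> (\<iota> [v'] \<star> e \<star> \<iota> [v])"
    by (simp add: numeral_2_eq_2 idn_tens_idn)
  have 1: "(\<iota> [v'] \<star> e \<star> \<iota> [v]) \<bullet> (\<iota> [v', v'] \<star> \<tau> [v] [v]) = (\<iota> [v', v] \<star> e) \<bullet> (\<iota> [v'] \<star> \<tau> [v'] [v] \<star> \<iota> [v])"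
    using arg_cong[OF e_slide[of "[v]"], of "\<lambda>x. \<iota> [v'] \<star> x"] by (simp add: whisker)
  have 2: "(\<iota> [v'] \<star> e \<star> \<iota> [v]) \<bullet> (\<tau> [v'] [v'] \<star> \<iota> [v, v]) = (e \<star> \<iota> [v', v]) \<bullet> (\<iota> [v'] \<star> \<tau> [v'] [v] \<star> \<iota> [v])"
    using arg_cong[OF e_slide[of "[v']", symmetric], of "\<lambda>x. x \<star> \<iota> [v]"] by (simp add: whisker idn_tens_idn)
  have 3: "e \<bullet> (\<iota> [v', v] \<star> e) = e \<bullet> (e \<star> \<iota> [v', v])"
    using exchange[of e e "[]" "[]" "[]"] by simp
  show ?thesis
    unfolding E2 using reassoc[OF 3] by (simp add: 1 2)
qed

text \<open>Nesting pairs position \<open>k\<close> of \<open>v\<close> with position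
  \<open>n - 1 - k\<close> of \<open>v'\<close>. The positions \<open>k\<close> and
  \<open>k + 1\<close> therefore correspond to the two starting at \<open>n - 2 - k\<close>.\<close>

lemma E_adj:
  assumes "Suc k < n"
  shows "E n \<bullet> (\<iota> (replicate n v') \<star> adj v n k) = E n \<bullet> (adj v' n (n - 2 - k) \<star> \<iota> (replicate n v))"
proof -
  define l where "l = n - 2 - k"
  have n: "n = k + (2 + l)"
    using assms by (simp add: l_def)
  let ?V = "\<lambda>n. replicate n v" and ?V' = "\<lambda>n. replicate n v'"
  have r: "?V n = ?V k @ v # v # ?V l" "?V' n = ?V' l @ v' # v' # ?V' k"
    unfolding n by (simp_all add: numeral_2_eq_2 replicate_app_Cons_same add.commute flip: replicate_add)
  \<comment> \<open>From the inside out: \<open>k\<close> untouched pairs, the two pairs that are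
    swapped, and \<open>l\<close> further untouched pairs.\<close>
  have En: "E n = E l \<bullet> (\<iota> (?V' l) \<star> E 2 \<star> \<iota> (?V l)) \<bullet> (\<iota> (?V' l @ [v', v']) \<star> E k \<star> \<iota> (v # v # ?V l))"
    unfolding n E_add[of k] E_add[of 2]
    by (simp add: numeral_2_eq_2 replicate_app_Cons_same del: pairing_pow.simps)
  have a: "adj v n k = \<iota> (?V k) \<star> \<tau> [v] [v] \<star> \<iota> (?V l)" "adj v' n (n - 2 - k) = \<iota> (?V' l) \<star> \<tau> [v'] [v'] \<star> \<iota> (?V' k)"
    using n by (simp_all add: adj_def)
  let ?F = "E l \<bullet> (\<iota> (?V' l) \<star> E 2 \<star> \<iota> (?V l))"
  have 2: "dm (E 2) = [v', v', v, v]"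
    by (simp add: numeral_2_eq_2)
  have "E n \<bullet> (\<iota> (?V' n) \<star> adj v n k)
    = ?F \<bullet> (\<iota> (?V' l @ [v', v']) \<star> E k \<star> \<iota> (v # v # ?V l)) \<bullet> (\<iota> (?V' l @ [v', v'] @ ?V' k @ ?V k) \<star> \<tau> [v] [v] \<star> \<iota> (?V l))"
    unfolding En a r by simp
  also have "\<dots> = ?F \<bullet> (\<iota> (?V' l @ [v', v']) \<star> \<tau> [v] [v] \<star> \<iota> (?V l)) \<bullet> (\<iota> (?V' l @ [v', v']) \<star> E k \<star> \<iota> (v # v # ?V l))"
    using exchange[of "E k" "\<tau> [v] [v]" "?V' l @ [v', v']" "[]" "?V l"] by simp
  also have "\<dots> = E l \<bullet> (\<iota> (?V' l) \<star> (E 2 \<bullet> (\<iota> [v', v'] \<star> \<tau> [v] [v])) \<star> \<iota> (?V l)) \<bullet> (\<iota> (?V' l @ [v', v']) \<star> E k \<star> \<iota> (v # v # ?V l))"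
    using 2 by (simp add: whisker)
  also have "\<dots> = ?F \<bullet> (\<iota> (?V' l) \<star> \<tau> [v'] [v'] \<star> \<iota> ([v, v] @ ?V l)) \<bullet> (\<iota> (?V' l @ [v', v']) \<star> E k \<star> \<iota> (v # v # ?V l))"
    unfolding E2_swp using 2 by (simp add: whisker idn_tens_idn)
  also have "\<dots> = ?F \<bullet> (\<iota> (?V' l @ [v', v']) \<star> E k \<star> \<iota> (v # v # ?V l)) \<bullet> (\<iota> (?V' l) \<star> \<tau> [v'] [v'] \<star> \<iota> (?V' k @ ?V k @ [v, v] @ ?V l))"
    using exchange[of "\<tau> [v'] [v']" "E k" "?V' l" "[]" "v # v # ?V l"] by simp
  also have "\<dots> = E n \<bullet> (adj v' n (n - 2 - k) \<star> \<iota> (?V n))"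
    unfolding En a r by (simp add: idn_tens_idn)
  finally show ?thesis .
qed

text \<open>By \<open>E_adj\<close>, antisymmetry in one variable of \<open>E n\<close> is
  antisymmetry in the other. Hence each side absorbs the antisymmetrizer of the other variable, and
  both equal \<open>E n\<close> antisymmetrized in both variables.\<close>

lemma E_alt: "E n \<bullet> (\<iota> (replicate n v') \<star> alt v n) = E n \<bullet> (alt v' n \<star> \<iota> (replicate n v))"
proof -
  let ?V = "replicate n v" and ?V' = "replicate n v'"
  have ex: "(alt v' n \<star> \<iota> ?V) \<bullet> (\<iota> ?V' \<star> f) = (\<iota> ?V' \<star> f) \<bullet> (alt v' n \<star> \<iota> ?V)"
    if "arr f" "dm f = ?V" "cd f = ?V" for f
    using exchange[of "alt v' n" f "[]" "[]" "[]"] that by simp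
  have ex': "(\<iota> ?V' \<star> alt v n) \<bullet> (f \<star> \<iota> ?V) = (f \<star> \<iota> ?V) \<bullet> (\<iota> ?V' \<star> alt v n)"
    if "arr f" "dm f = ?V'" "cd f = ?V'" for f
    using exchange[of f "alt v n" "[]" "[]" "[]"] that by simp
  have "(E n \<bullet> (alt v' n \<star> \<iota> ?V)) \<bullet> (\<iota> ?V' \<star> alt v n \<star> \<iota> []) = E n \<bullet> (alt v' n \<star> \<iota> ?V)"
  proof (rule alt_absorb_right)
    fix k assume k: "Suc k < n"
    have "(E n \<bullet> (alt v' n \<star> \<iota> ?V)) \<bullet> (\<iota> ?V' \<star> adj v n k) = (E n \<bullet> (\<iota> ?V' \<star> adj v n k)) \<bullet> (alt v' n \<star> \<iota> ?V)"
      using k by (simp add: ex)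
    also have "\<dots> = (-1) \<rhd> (E n \<bullet> (alt v' n \<star> \<iota> ?V))"
      using k by (simp add: E_adj interchange adj_alt)
    finally show "(E n \<bullet> (alt v' n \<star> \<iota> ?V)) \<bullet> (\<iota> ?V' \<star> adj v n k \<star> \<iota> []) = (-1) \<rhd> (E n \<bullet> (alt v' n \<star> \<iota> ?V))"
      using k by simp
  qed simp_all
  moreover have "(E n \<bullet> (\<iota> ?V' \<star> alt v n)) \<bullet> (\<iota> [] \<star> alt v' n \<star> \<iota> ?V) = E n \<bullet> (\<iota> ?V' \<star> alt v n)"
  proof (rule alt_absorb_right)
    fix k assume k: "Suc k < n"
    then have k': "Suc (n - 2 - k) < n" "n - 2 - (n - 2 - k) = k"
      by simp_all
    have "(E n \<bullet> (\<iota> ?V' \<star> alt v n)) \<bullet> (adj v' n k \<star> \<iota> ?V) = (E n \<bullet> (adj v' n k \<star> \<iota> ?V)) \<bullet> (\<iota> ?V' \<star> alt v n)"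
      using k by (simp add: ex')
    also have "E n \<bullet> (adj v' n k \<star> \<iota> ?V) = E n \<bullet> (\<iota> ?V' \<star> adj v n (n - 2 - k))"
      using E_adj[OF k'(1)] k'(2) by simp
    also have "(E n \<bullet> (\<iota> ?V' \<star> adj v n (n - 2 - k))) \<bullet> (\<iota> ?V' \<star> alt v n) = (-1) \<rhd> (E n \<bullet> (\<iota> ?V' \<star> alt v n))"
      using k' by (simp add: interchange adj_alt)
    finally show "(E n \<bullet> (\<iota> ?V' \<star> alt v n)) \<bullet> (\<iota> [] \<star> adj v' n k \<star> \<iota> ?V) = (-1) \<rhd> (E n \<bullet> (\<iota> ?V' \<star> alt v n))"
      using k by simp
  qed simp_all
  ultimately show ?thesis
    by (simp add: ex)
qed

subsection \<open>Partial traces of the antisymmetrizers\<close>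

abbreviation "r \<equiv> e \<bullet> \<tau> [v] [v'] \<bullet> c"

text \<open>The partial trace of a crossing: sliding \<open>e\<close> across it leaves two swaps
  that cancel, and then a zigzag.\<close>

lemma trace_swp: "(e \<star> \<iota> [v]) \<bullet> (\<iota> [v'] \<star> \<tau> [v] [v]) \<bullet> ((\<tau> [v] [v'] \<bullet> c) \<star> \<iota> [v]) = \<iota> [v]"
proof -
  have "(e \<star> \<iota> [v]) \<bullet> (\<iota> [v'] \<star> \<tau> [v] [v]) \<bullet> ((\<tau> [v] [v'] \<bullet> c) \<star> \<iota> [v])
    = (\<iota> [v] \<star> e) \<bullet> ((\<tau> [v'] [v] \<bullet> \<tau> [v] [v'] \<bullet> c) \<star> \<iota> [v])"
    using reassoc[OF e_slide[of "[v]"]] by (simp add: whisker)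
  also have "\<tau> [v'] [v] \<bullet> \<tau> [v] [v'] \<bullet> c = c"
    by (simp add: reassoc[OF swp_swp])
  finally show ?thesis
    using dual_pairD(7)[OF dual] by simp
qed

text \<open>In the recursion for \<open>alt v (Suc n)\<close> the first term avoids the traced
  strand, which becomes a closed loop \<open>r\<close>. In the second term the outer factors avoid
  it too and move out of the trace; \<open>trace_swp\<close> removes the swap between them, and
  idempotence leaves \<open>alt v n\<close>.\<close>

lemma trace_alt:
  "(e \<star> \<iota> (replicate n v)) \<bullet> (\<iota> [v'] \<star> alt v (Suc n)) \<bullet> ((\<tau> [v] [v'] \<bullet> c) \<star> \<iota> (replicate n v))
  = ((1 / of_nat (Suc n)) \<rhd> (r \<uplus> (- of_nat n) \<rhd> \<iota> [])) \<star> alt v n"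
proof (cases n)
  case 0
  then show ?thesis
    by (simp add: scl_one plus_scl_zero idn_tens_idn)
next
  case (Suc m)
  let ?V = "\<iota> (replicate n v)" and ?c = "\<tau> [v] [v'] \<bullet> c"
  let ?A = "\<iota> [v', v] \<star> alt v n" and ?s = "\<iota> [v'] \<star> adj v (Suc n) 0"
  have c: "?A \<bullet> (?c \<star> ?V) = (?c \<star> ?V) \<bullet> alt v n"
    using exchange[of ?c "alt v n" "[]" "[]" "[]"] by simp
  have e: "(e \<star> ?V) \<bullet> ?A = alt v n \<bullet> (e \<star> ?V)"
    using exchange[of e "alt v n" "[]" "[]" "[]"] by simp
  have 1: "(e \<star> ?V) \<bullet> ?A \<bullet> (?c \<star> ?V) = r \<star> alt v n"
    unfolding c using reassoc[OF interchange[of ?c e ?V ?V]] interchange[of "\<iota> []" r "alt v n" ?V] by simp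
  have s: "?s = \<iota> [v'] \<star> \<tau> [v] [v] \<star> \<iota> (replicate m v)"
    by (simp add: adj_def Suc)
  have "(e \<star> ?V) \<bullet> ?s \<bullet> (?c \<star> ?V)
    = ((e \<star> \<iota> [v]) \<bullet> (\<iota> [v'] \<star> \<tau> [v] [v]) \<bullet> (?c \<star> \<iota> [v])) \<star> \<iota> (replicate m v)"
    unfolding s by (simp add: Suc whisker idn_tens_idn)
  then have 2: "(e \<star> ?V) \<bullet> ?s \<bullet> (?c \<star> ?V) = ?V"
    unfolding trace_swp by (simp add: Suc idn_tens_idn)
  have "(e \<star> ?V) \<bullet> (?A \<bullet> ?s \<bullet> ?A) \<bullet> (?c \<star> ?V) = (e \<star> ?V) \<bullet> ?A \<bullet> ?s \<bullet> (?c \<star> ?V) \<bullet> alt v n"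
    using c by simp
  also have "\<dots> = alt v n \<bullet> ((e \<star> ?V) \<bullet> ?s \<bullet> (?c \<star> ?V)) \<bullet> alt v n"
    by (simp add: reassoc[OF e])
  also have "\<dots> = alt v n"
    unfolding 2 by (simp add: alt_idem)
  finally have 3: "(e \<star> ?V) \<bullet> (?A \<bullet> ?s \<bullet> ?A) \<bullet> (?c \<star> ?V) = alt v n" .
  have "\<iota> [v'] \<star> alt v (Suc n) = (1 / of_nat (Suc n)) \<rhd> (?A \<uplus> (- of_nat n) \<rhd> (?A \<bullet> ?s \<bullet> ?A))"
    unfolding Suc alt.simps(3) by (simp add: tens_plus whisker del: alt.simps(3))
  then have "(e \<star> ?V) \<bullet> (\<iota> [v'] \<star> alt v (Suc n)) \<bullet> (?c \<star> ?V)
    = (1 / of_nat (Suc n)) \<rhd> (((e \<star> ?V) \<bullet> ?A \<bullet> (?c \<star> ?V))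
       \<uplus> (- of_nat n) \<rhd> ((e \<star> ?V) \<bullet> (?A \<bullet> ?s \<bullet> ?A) \<bullet> (?c \<star> ?V)))"
    by (simp add: plus_cmp cmp_plus del: of_nat_Suc alt.simps)
  then show ?thesis
    unfolding 1 3 by (simp add: plus_tens del: of_nat_Suc alt.simps)
qed

lemma trace_coeff [simp]:
  "arr (trace_coeff r i j)" "dm (trace_coeff r i j) = []" "cd (trace_coeff r i j) = []"
  by (induction i) simp_all

text \<open>The innermost loop is closed first. It contributes a scalar, which moves out of the
  diagram, and leaves an antisymmetrizer on one strand less.\<close>

lemma trace_pow_alt:
  "(E i \<star> \<iota> (replicate j v)) \<bullet> (\<iota> (replicate i v') \<star> alt v (i + j))
     \<bullet> (copairing_pow v' v (\<tau> [v] [v'] \<bullet> c) i \<star> \<iota> (replicate j v))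
  = trace_coeff r i j \<star> alt v j"
proof (induction i)
  case 0
  then show ?case
    by (simp add: idn_tens_idn)
next
  case (Suc i)
  interpret swapped: dual_objects arr dm cd \<iota> "(\<bullet>)" "(\<star>)" \<tau> "(\<uplus>)" "(\<rhd>)" v' v "e \<bullet> \<tau> [v] [v']" "\<tau> [v] [v'] \<bullet> c"
    by (rule swapped)
  let ?V = "\<lambda>n. replicate n v" and ?V' = "\<lambda>n. replicate n v'" and ?c = "\<tau> [v] [v'] \<bullet> c"
  define z where "z = (1 / of_nat (Suc (i + j))) \<rhd> (r \<uplus> (- of_nat (i + j)) \<rhd> \<iota> [])"
  have [simp]: "arr z" "dm z = []" "cd z = []"
    by (simp_all add: z_def)
  have z: "trace_coeff r (Suc i) j = trace_coeff r i j \<bullet> z"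
    by (simp add: z_def)
  have "(E (Suc i) \<star> \<iota> (?V j)) \<bullet> (\<iota> (?V' (Suc i)) \<star> alt v (Suc i + j)) \<bullet> (swapped.K (Suc i) \<star> \<iota> (?V j))
    = (E i \<star> \<iota> (?V j)) \<bullet> (\<iota> (?V' i) \<star> ((e \<star> \<iota> (?V (i + j))) \<bullet> (\<iota> [v'] \<star> alt v (Suc (i + j))) \<bullet> (?c \<star> \<iota> (?V (i + j)))))
        \<bullet> (swapped.K i \<star> \<iota> (?V j))"
    unfolding swapped.K_Suc_inner
    by (simp add: whisker idn_tens_idn replicate_add replicate_append_same del: alt.simps copairing_pow.simps)
  also have "\<dots> = (E i \<star> \<iota> (?V j)) \<bullet> (\<iota> (?V' i) \<star> z \<star> alt v (i + j)) \<bullet> (swapped.K i \<star> \<iota> (?V j))"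
    unfolding trace_alt z_def ..
  also have "\<iota> (?V' i) \<star> z \<star> alt v (i + j) = z \<star> (\<iota> (?V' i) \<star> alt v (i + j))"
    using scalar_tens_commute[of z "\<iota> (?V' i)"] by (simp flip: tens_assoc)
  also have "(E i \<star> \<iota> (?V j)) \<bullet> (z \<star> (\<iota> (?V' i) \<star> alt v (i + j))) \<bullet> (swapped.K i \<star> \<iota> (?V j))
    = z \<star> ((E i \<star> \<iota> (?V j)) \<bullet> (\<iota> (?V' i) \<star> alt v (i + j)) \<bullet> (swapped.K i \<star> \<iota> (?V j)))"
    using interchange[of "z" "\<iota> []" "(\<iota> (?V' i) \<star> alt v (i + j)) \<bullet> (swapped.K i \<star> \<iota> (?V j))" "E i \<star> \<iota> (?V j)"]
      interchange[of "\<iota> []" "z" "swapped.K i \<star> \<iota> (?V j)" "\<iota> (?V' i) \<star> alt v (i + j)"]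
    by (simp add: replicate_add)
  also have "\<dots> = trace_coeff r (Suc i) j \<star> alt v j"
    unfolding Suc z using interchange[of "trace_coeff r i j" "z" "\<iota> []" "\<iota> []"] interchange[of "trace_coeff r i j" "z" "alt v j" "\<iota> (?V j)"]
      tens_eq_cmp(2)[of z "trace_coeff r i j"]
    by (simp del: trace_coeff.simps)
  finally show ?case .
qed

end

context strict_tensor_category
begin

subsection \<open>Isomorphisms, invertible objects and universal pairings\<close>

definition inverse_arrs :: "'a \<Rightarrow> 'a \<Rightarrow> bool" where
  "inverse_arrs f g \<longleftrightarrow> arr f \<and> arr g \<and> dm g = cd f \<and> cd g = dm f \<and> g \<bullet> f = \<iota> (dm f) \<and> f \<bullet> g = \<iota> (cd f)"

lemma inverse_arrs_sym: "inverse_arrs f g \<Longrightarrow> inverse_arrs g f"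
  by (auto simp: inverse_arrs_def)

definition invertible :: "'o list \<Rightarrow> bool" where
  "invertible X \<longleftrightarrow> (\<exists>Y t q. inverse_arrs t q \<and> dm t = X @ Y \<and> cd t = [])"

lemma invertible_commute:
  assumes "inverse_arrs t q" "dm t = X @ Y" "cd t = []"
  shows "inverse_arrs (t \<bullet> \<tau> Y X) (\<tau> X Y \<bullet> q)"
proof -
  have t: "arr t" "arr q" "q \<bullet> t = \<iota> (X @ Y)" "t \<bullet> q = \<iota> []" "dm q = []" "cd q = X @ Y"
    using assms by (simp_all add: inverse_arrs_def)
  then show ?thesis
    using assms(2,3) reassoc[OF t(3)] reassoc[OF swp_swp] by (simp add: inverse_arrs_def)
qed

text \<open>Tensoring further with the inverse object \<open>Y\<close> and conjugating with
  \<open>t\<close> and \<open>q\<close> recovers an arrow from its product with the identity of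
  \<open>X\<close>.\<close>

lemma invertible_faithful:
  assumes "inverse_arrs t q" "dm t = X @ Y" "cd t = []"
    and "arr u" "arr w" "dm u = dm w" "cd u = cd w" "u \<star> \<iota> X = w \<star> \<iota> X"
  shows "u = w"
proof -
  have t: "arr t" "arr q" "t \<bullet> q = \<iota> []" "dm q = []" "cd q = X @ Y"
    using assms by (simp_all add: inverse_arrs_def)
  have *: "x = (\<iota> (cd x) \<star> t) \<bullet> ((x \<star> \<iota> X) \<star> \<iota> Y) \<bullet> (\<iota> (dm x) \<star> q)" if "arr x" for x
  proof -
    have "(x \<star> \<iota> (X @ Y)) \<bullet> (\<iota> (dm x) \<star> q) = (\<iota> (cd x) \<star> q) \<bullet> x"
      using tens_eq_cmp[of x q] that t by simp
    then show ?thesis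
      using t that assms(2,3) interchange[of "\<iota> (cd x)" "\<iota> (cd x)" q t]
      by (simp add: idn_tens_idn reassoc)
  qed
  show ?thesis
    using *[OF assms(4)] *[OF assms(5)] assms(6-8) by simp
qed

text \<open>The same conjugation applied to \<open>b\<close> defines the arrow sought. Comparison
  with \<open>q\<close> by interchange shows that it is correct after a further product with
  \<open>Y\<close>, and \<open>Y\<close>, being invertible too, can be cancelled by
  faithfulness.\<close>

lemma invertible_full:
  assumes "inverse_arrs t q" "dm t = X @ Y" "cd t = []"
    and "arr b" "dm b = S @ X" "cd b = T @ X"
  shows "\<exists>u. arr u \<and> dm u = S \<and> cd u = T \<and> u \<star> \<iota> X = b"
proof (intro exI conjI)
  have t [simp]: "arr t" "arr q" "dm q = []" "cd q = X @ Y" "dm t = X @ Y" "cd t = []" and tq: "t \<bullet> q = \<iota> []" "q \<bullet> t = \<iota> (X @ Y)"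
    using assms by (simp_all add: inverse_arrs_def)
  let ?u = "(\<iota> T \<star> t) \<bullet> (b \<star> \<iota> Y) \<bullet> (\<iota> S \<star> q)"
  note [simp] = assms(4-6)
  show u [simp]: "arr ?u" "dm ?u = S" "cd ?u = T"
    by simp_all
  have "(\<iota> T \<star> q) \<bullet> ?u = (?u \<star> \<iota> (X @ Y)) \<bullet> (\<iota> S \<star> q)"
    using tens_eq_cmp[of ?u q] by simp
  moreover have "(\<iota> T \<star> q) \<bullet> ?u = (b \<star> \<iota> Y) \<bullet> (\<iota> S \<star> q)"
    using reassoc[OF interchange[of "\<iota> T" "\<iota> T" t q]] tq by (simp add: idn_tens_idn)
  ultimately have "(?u \<star> \<iota> (X @ Y)) \<bullet> (\<iota> S \<star> q) = (b \<star> \<iota> Y) \<bullet> (\<iota> S \<star> q)"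
    by simp
  then have "?u \<star> \<iota> (X @ Y) = b \<star> \<iota> Y"
    by (rule cancel_right[where k = "\<iota> S \<star> t", rotated])
      (simp_all add: interchange tq idn_tens_idn del: cmp_assoc)
  then have "(?u \<star> \<iota> X) \<star> \<iota> Y = b \<star> \<iota> Y"
    by (simp add: idn_tens_idn)
  then show "?u \<star> \<iota> X = b"
    by (intro invertible_faithful[OF invertible_commute[OF assms(1-3)], where u = "?u \<star> \<iota> X"]) simp_all
qed

text \<open>By fullness \<open>\<iota> X \<star> e\<close> has the form
  \<open>x \<star> \<iota> X\<close>. The first zigzag and faithfulness make \<open>x\<close> a left
  inverse of \<open>c\<close>; the second zigzag makes it a right inverse.\<close>

lemma invertible_unit:
  assumes "invertible X" "dual_pair X X' e c"
  shows "\<exists>x. inverse_arrs c x \<and> x \<star> \<iota> X = \<iota> X \<star> e"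
proof -
  note [simp] = dual_pairD(1-6)[OF assms(2)] and zz = dual_pairD(7,8)[OF assms(2)]
  obtain Y t q where t: "inverse_arrs t q" "dm t = X @ Y" "cd t = []"
    using assms(1) by (auto simp: invertible_def)
  obtain x where x [simp]: "arr x" "dm x = X @ X'" "cd x = []" and xX: "x \<star> \<iota> X = \<iota> X \<star> e"
    using invertible_full[OF t, of "\<iota> X \<star> e" "X @ X'" "[]"] by auto
  have "x \<bullet> c = \<iota> []"
    by (rule invertible_faithful[OF t]) (simp_all add: whisker xX zz)
  moreover have "c \<bullet> x = (x \<star> \<iota> (X @ X')) \<bullet> (\<iota> (X @ X') \<star> c)"
    using tens_eq_cmp[of x c] by simp
  then have "c \<bullet> x = ((x \<star> \<iota> X) \<star> \<iota> X') \<bullet> (\<iota> X \<star> \<iota> X' \<star> c)"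
    by (simp add: idn_tens_idn)
  then have "c \<bullet> x = \<iota> X \<star> ((e \<star> \<iota> X') \<bullet> (\<iota> X' \<star> c))"
    unfolding xX by (simp add: whisker)
  ultimately show ?thesis
    using xX by (intro exI[of _ x]) (simp add: inverse_arrs_def zz idn_tens_idn)
qed

lemma invertible_counit:
  assumes "invertible X" "dual_pair X X' e c"
  shows "\<exists>d. inverse_arrs e d"
proof -
  note [simp] = dual_pairD(1-6)[OF assms(2)] and zz = dual_pairD(7,8)[OF assms(2)]
  obtain x where x: "inverse_arrs c x" and xX: "x \<star> \<iota> X = \<iota> X \<star> e"
    using invertible_unit[OF assms] by blast
  then have x' [simp]: "arr x" "dm x = X @ X'" "cd x = []" and cx: "c \<bullet> x = \<iota> (X @ X')"
    by (simp_all add: inverse_arrs_def)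
  obtain t q where "inverse_arrs t q" "dm t = X' @ X" "cd t = []"
    by (rule that[OF invertible_commute[OF inverse_arrs_sym[OF x] x'(2,3)]]) simp_all
  then have tq: "t \<bullet> q = \<iota> []" "q \<bullet> t = \<iota> (X' @ X)" and t [simp]: "arr t" "arr q" "dm t = X' @ X"
    "cd t = []" "dm q = []" "cd q = X' @ X"
    by (simp_all add: inverse_arrs_def)
  \<comment> \<open>By 1 and 2 below, \<open>\<iota> (X' @ X) \<star> e\<close> and
    \<open>\<iota> X' \<star> c \<star> \<iota> X\<close> are inverse to each other;
    \<open>t\<close> and \<open>q\<close> remove the spare factor \<open>X' @ X\<close>.\<close>
  let ?d = "(t \<star> \<iota> (X' @ X)) \<bullet> (\<iota> X' \<star> c \<star> \<iota> X) \<bullet> q"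
  have "(\<iota> (X' @ X) \<star> e) \<bullet> (\<iota> X' \<star> c \<star> \<iota> X) = \<iota> X' \<star> ((\<iota> X \<star> e) \<bullet> (c \<star> \<iota> X))"
    by (simp add: whisker)
  then have 1: "(\<iota> (X' @ X) \<star> e) \<bullet> (\<iota> X' \<star> c \<star> \<iota> X) = \<iota> (X' @ X)"
    by (simp add: zz idn_tens_idn)
  have "e \<bullet> (t \<star> \<iota> (X' @ X)) = t \<bullet> (\<iota> (X' @ X) \<star> e)"
    using exchange[of t e "[]" "[]" "[]"] by simp
  from reassoc[OF this] reassoc[OF 1] have e: "e \<bullet> ?d = \<iota> []"
    by (simp add: tq)
  have "(\<iota> X' \<star> c \<star> \<iota> X) \<bullet> (\<iota> (X' @ X) \<star> e) = \<iota> X' \<star> ((c \<bullet> x) \<star> \<iota> X)"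
    using xX by (simp add: whisker)
  then have 2: "(\<iota> X' \<star> c \<star> \<iota> X) \<bullet> (\<iota> (X' @ X) \<star> e) = \<iota> (X' @ X @ X' @ X)"
    by (simp add: cx idn_tens_idn)
  have "q \<bullet> e = (\<iota> (X' @ X) \<star> e) \<bullet> (q \<star> \<iota> (X' @ X))"
    using exchange[of q e "[]" "[]" "[]"] by simp
  then have "?d \<bullet> e = (t \<star> \<iota> (X' @ X)) \<bullet> (q \<star> \<iota> (X' @ X))"
    using reassoc[OF 2] by simp
  also have "\<dots> = \<iota> (X' @ X)"
    by (simp add: interchange tq)
  finally show ?thesis
    using e by (intro exI[of _ ?d]) (simp add: inverse_arrs_def)
qed

text \<open>\<open>F\<close> exhibits \<open>T\<close> as an internal hom from \<open>X\<close> to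
  \<open>Y\<close>. Stated through unique factorization, since the strict category carries no chosen
  internal homs.\<close>

definition universal :: "'a \<Rightarrow> 'o list \<Rightarrow> 'o list \<Rightarrow> 'o list \<Rightarrow> bool" where
  "universal F T X Y \<longleftrightarrow> arr F \<and> dm F = T @ X \<and> cd F = Y \<and>
     (\<forall>S A. arr A \<and> dm A = S @ X \<and> cd A = Y \<longrightarrow>
        (\<exists>!u. arr u \<and> dm u = S \<and> cd u = T \<and> F \<bullet> (u \<star> \<iota> X) = A))"

lemma universalD:
  assumes "universal F T X Y"
  shows "arr F" "dm F = T @ X" "cd F = Y"
    "\<lbrakk>arr A; dm A = S @ X; cd A = Y\<rbrakk> \<Longrightarrow> \<exists>u. arr u \<and> dm u = S \<and> cd u = T \<and> F \<bullet> (u \<star> \<iota> X) = A"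
    "\<lbrakk>arr u; arr w; dm u = dm w; cd u = T; cd w = T; F \<bullet> (u \<star> \<iota> X) = F \<bullet> (w \<star> \<iota> X)\<rbrakk> \<Longrightarrow> u = w"
proof -
  show F: "arr F" "dm F = T @ X" "cd F = Y"
    using assms by (simp_all add: universal_def)
  have ex1: "\<exists>!u. arr u \<and> dm u = S \<and> cd u = T \<and> F \<bullet> (u \<star> \<iota> X) = A"
    if "arr A" "dm A = S @ X" "cd A = Y" for A S
    using assms that unfolding universal_def by blast
  show "\<lbrakk>arr A; dm A = S @ X; cd A = Y\<rbrakk> \<Longrightarrow> \<exists>u. arr u \<and> dm u = S \<and> cd u = T \<and> F \<bullet> (u \<star> \<iota> X) = A"
    using ex1 by blast
  show "u = w" if "arr u" "arr w" "dm u = dm w" "cd u = T" "cd w = T" "F \<bullet> (u \<star> \<iota> X) = F \<bullet> (w \<star> \<iota> X)"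
    using ex1[of "F \<bullet> (u \<star> \<iota> X)" "dm u"] F that by auto
qed

lemma universal_precomp:
  assumes F: "universal F T X Y" and h: "inverse_arrs h k" "cd h = T" "dm h = T'"
  shows "universal (F \<bullet> (h \<star> \<iota> X)) T' X Y"
  unfolding universal_def
proof (intro conjI allI impI)
  note [simp] = universalD(1-3)[OF F]
  have k [simp]: "arr h" "arr k" "dm k = T" "cd k = T'" "cd h = T" "dm h = T'" and kh: "k \<bullet> h = \<iota> T'" "h \<bullet> k = \<iota> T"
    using h by (simp_all add: inverse_arrs_def)
  fix S A assume A: "arr A \<and> dm A = S @ X \<and> cd A = Y"
  then obtain u where u: "arr u" "dm u = S" "cd u = T" "F \<bullet> (u \<star> \<iota> X) = A"
    using universalD(4)[OF F, of A S] by auto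
  show "\<exists>!u. arr u \<and> dm u = S \<and> cd u = T' \<and> (F \<bullet> (h \<star> \<iota> X)) \<bullet> (u \<star> \<iota> X) = A"
  proof (rule ex1I[of _ "k \<bullet> u"])
    show "arr (k \<bullet> u) \<and> dm (k \<bullet> u) = S \<and> cd (k \<bullet> u) = T' \<and> (F \<bullet> (h \<star> \<iota> X)) \<bullet> ((k \<bullet> u) \<star> \<iota> X) = A"
      using u by (simp add: interchange reassoc[OF kh(2)])
    fix w assume w: "arr w \<and> dm w = S \<and> cd w = T' \<and> (F \<bullet> (h \<star> \<iota> X)) \<bullet> (w \<star> \<iota> X) = A"
    then have "F \<bullet> ((h \<bullet> w) \<star> \<iota> X) = F \<bullet> (u \<star> \<iota> X)"
      using u by (simp add: whisker)
    then have "h \<bullet> w = u"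
      by (rule universalD(5)[OF F, rotated 5]) (use u w in simp_all)
    then show "w = k \<bullet> u"
      using w reassoc[OF kh(1), of w] by auto
  qed
qed (use h universalD[OF F] in \<open>simp_all add: inverse_arrs_def\<close>)

lemma universal_scl:
  assumes F: "universal F T X Y" and q: "q \<noteq> 0"
  shows "universal (q \<rhd> F) T X Y"
  unfolding universal_def
proof (intro conjI allI impI)
  fix S A assume A: "arr A \<and> dm A = S @ X \<and> cd A = Y"
  have "(q \<rhd> F) \<bullet> (u \<star> \<iota> X) = A \<longleftrightarrow> F \<bullet> (u \<star> \<iota> X) = (1 / q) \<rhd> A" if "arr u" "cd u = T" for u
  proof
    assume "(q \<rhd> F) \<bullet> (u \<star> \<iota> X) = A"
    from arg_cong[OF this, of "\<lambda>x. (1 / q) \<rhd> x"] show "F \<bullet> (u \<star> \<iota> X) = (1 / q) \<rhd> A"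
      using that q universalD(1-3)[OF F] by (simp add: scl_one)
  next
    assume "F \<bullet> (u \<star> \<iota> X) = (1 / q) \<rhd> A"
    then show "(q \<rhd> F) \<bullet> (u \<star> \<iota> X) = A"
      using A q by (simp add: scl_one)
  qed
  moreover have "\<exists>!u. arr u \<and> dm u = S \<and> cd u = T \<and> F \<bullet> (u \<star> \<iota> X) = (1 / q) \<rhd> A"
    using F A unfolding universal_def by simp
  ultimately show "\<exists>!u. arr u \<and> dm u = S \<and> cd u = T \<and> (q \<rhd> F) \<bullet> (u \<star> \<iota> X) = A"
    by metis
qed (use universalD[OF F] in simp_all)

text \<open>Tensoring with an invertible \<open>X\<close> is fully faithful, so the only arrow
  \<open>u\<close> for \<open>A\<close> is the one whose product with \<open>X\<close> is
  \<open>k \<bullet> A\<close>.\<close>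

lemma universal_inverse:
  assumes "invertible X" "inverse_arrs F k" "dm F = T @ X" "cd F = Y"
  shows "universal F T X Y"
proof -
  have F: "arr F" "arr k" "dm k = Y" "cd k = T @ X" "k \<bullet> F = \<iota> (T @ X)" "F \<bullet> k = \<iota> Y"
    using assms by (simp_all add: inverse_arrs_def)
  obtain Z t q where t: "inverse_arrs t q" "dm t = X @ Z" "cd t = []"
    using assms(1) by (auto simp: invertible_def)
  show ?thesis
    unfolding universal_def
  proof (intro conjI allI impI)
    fix S A assume A: "arr A \<and> dm A = S @ X \<and> cd A = Y"
    then obtain u where u: "arr u" "dm u = S" "cd u = T" "u \<star> \<iota> X = k \<bullet> A"
      using invertible_full[OF t, of "k \<bullet> A" S T] F by auto
    have "F \<bullet> (u \<star> \<iota> X) = A"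
      using A F(6) u(4) by (simp add: reassoc)
    moreover have "w = u" if "arr w" "dm w = S" "cd w = T" "F \<bullet> (w \<star> \<iota> X) = A" for w
    proof -
      have "w \<star> \<iota> X = k \<bullet> A"
        using reassoc[OF F(5), of "w \<star> \<iota> X"] that by simp
      then show ?thesis
        using invertible_faithful[OF t, where u = w and w = u] that u by simp
    qed
    ultimately show "\<exists>!u. arr u \<and> dm u = S \<and> cd u = T \<and> F \<bullet> (u \<star> \<iota> X) = A"
      using u by blast
  qed (use assms F in simp_all)
qed

lemma universal_dual_pair:
  assumes "dual_pair X X' e c"
  shows "universal (\<iota> Y \<star> e) (Y @ X') X Y"
  unfolding universal_def
proof (intro conjI allI impI)
  note [simp] = dual_pairD(1-6)[OF assms] and zz = dual_pairD(7,8)[OF assms]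
  fix S A assume A: "arr A \<and> dm A = S @ X \<and> cd A = Y"
  \<comment> \<open>The mate of \<open>A\<close>; the first zigzag makes it a solution and the
    second makes it the only one.\<close>
  let ?u = "(A \<star> \<iota> X') \<bullet> (\<iota> S \<star> c)"
  have 1: "(\<iota> Y \<star> e) \<bullet> (A \<star> \<iota> (X' @ X)) = A \<bullet> (\<iota> (S @ X) \<star> e)"
    using exchange[of A e "[]" "[]" "[]"] A by simp
  have 2: "(\<iota> (S @ X) \<star> e) \<bullet> (\<iota> S \<star> c \<star> \<iota> X) = \<iota> (S @ X)"
    using arg_cong[OF zz(1), of "\<lambda>x. \<iota> S \<star> x"] by (simp add: whisker idn_tens_idn)
  have "(\<iota> Y \<star> e) \<bullet> (?u \<star> \<iota> X) = A"
    using A reassoc[OF 1] 2 by (simp add: whisker idn_tens_idn)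
  moreover have "w = ?u" if "arr w" "dm w = S" "cd w = Y @ X'" "(\<iota> Y \<star> e) \<bullet> (w \<star> \<iota> X) = A" for w
  proof -
    have 3: "(w \<star> \<iota> (X @ X')) \<bullet> (\<iota> S \<star> c) = (\<iota> (Y @ X') \<star> c) \<bullet> w"
      using exchange[of w c "[]" "[]" "[]"] that by simp
    have 4: "(\<iota> Y \<star> e \<star> \<iota> X') \<bullet> (\<iota> (Y @ X') \<star> c) = \<iota> (Y @ X')"
      using arg_cong[OF zz(2), of "\<lambda>x. \<iota> Y \<star> x"] by (simp add: whisker idn_tens_idn)
    show ?thesis
      using that reassoc[OF 4] by (simp add: whisker idn_tens_idn 3 flip: that(4))
  qed
  ultimately show "\<exists>!u. arr u \<and> dm u = S \<and> cd u = Y @ X' \<and> (\<iota> Y \<star> e) \<bullet> (u \<star> \<iota> X) = A"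
    using A by (intro ex1I[of _ ?u]) auto
qed (use dual_pairD[OF assms] in simp_all)

text \<open>Universality of \<open>\<iota> X \<star> e\<close>, applied to the identity of
  \<open>X\<close>, produces the copairing together with the first zigzag. The second zigzag is an
  equality of arrows into \<open>X'\<close>, which universality of \<open>e\<close> detects.\<close>

lemma dual_pair_universal:
  assumes e: "universal e X' X []" and ex: "universal (\<iota> X \<star> e) (X @ X') X X"
  shows "\<exists>c. dual_pair X X' e c"
proof -
  have [simp]: "arr e" "dm e = X' @ X" "cd e = []"
    using e by (simp_all add: universal_def)
  obtain c where c [simp]: "arr c" "dm c = []" "cd c = X @ X'" and zz: "(\<iota> X \<star> e) \<bullet> (c \<star> \<iota> X) = \<iota> X"
    using universalD(4)[OF ex, of "\<iota> X" "[]"] by auto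
  let ?u = "(e \<star> \<iota> X') \<bullet> (\<iota> X' \<star> c)"
  have 1: "e \<bullet> (e \<star> \<iota> (X' @ X)) = e \<bullet> (\<iota> (X' @ X) \<star> e)"
    using exchange[of e e "[]" "[]" "[]"] by simp
  have 2: "(\<iota> (X' @ X) \<star> e) \<bullet> (\<iota> X' \<star> c \<star> \<iota> X) = \<iota> (X' @ X)"
    using arg_cong[OF zz, of "\<lambda>x. \<iota> X' \<star> x"] by (simp add: whisker idn_tens_idn)
  have "e \<bullet> (?u \<star> \<iota> X) = e"
    using reassoc[OF 1] 2 by (simp add: whisker idn_tens_idn)
  moreover have "e \<bullet> (\<iota> X' \<star> \<iota> X) = e"
    by (simp add: idn_tens_idn)
  ultimately have "e \<bullet> (?u \<star> \<iota> X) = e \<bullet> (\<iota> X' \<star> \<iota> X)"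
    by simp
  then have "?u = \<iota> X'"
    by (rule universalD(5)[OF e, rotated 5]) simp_all
  then show ?thesis
    using zz by (intro exI[of _ c]) (simp add: dual_pair_def)
qed

text \<open>Since \<open>f\<close> and \<open>K\<close> are isomorphisms and tensoring with
  \<open>Y'\<close> is faithful, the equation that \<open>u\<close> has to satisfy for
  \<open>F\<close> is equivalent to one for \<open>e\<close>, whose solution is unique by
  hypothesis.\<close>

lemma universal_transpose:
  assumes F: "arr F" "dm F = T @ X" "cd F = Y"
    and e: "universal e T T' []"
    and K: "inverse_arrs K k" "dm K = X @ Y'" "cd K = T'"
    and f: "inverse_arrs f d" "dm f = Y @ Y'" "cd f = []"
    and Y': "invertible Y'"
    and eq: "e \<bullet> (\<iota> T \<star> K) = f \<bullet> (F \<star> \<iota> Y')"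
  shows "universal F T X Y"
  unfolding universal_def
proof (intro conjI allI impI)
  have e' [simp]: "arr e" "dm e = T @ T'" "cd e = []"
    using e by (simp_all add: universal_def)
  have [simp]: "arr K" "arr k" "dm k = T'" "cd k = X @ Y'" "arr f" "arr d" "dm d = []" "cd d = Y @ Y'"
    and inv: "k \<bullet> K = \<iota> (X @ Y')" "K \<bullet> k = \<iota> T'" "d \<bullet> f = \<iota> (Y @ Y')"
    using K f by (simp_all add: inverse_arrs_def)
  note [simp] = F K(2,3) f(2,3)
  obtain Z t q where t: "inverse_arrs t q" "dm t = Y' @ Z" "cd t = []"
    using Y' by (auto simp: invertible_def)
  fix S A assume A: "arr A \<and> dm A = S @ X \<and> cd A = Y"
  then have [simp]: "arr A" "dm A = S @ X" "cd A = Y"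
    by simp_all
  let ?b = "f \<bullet> (A \<star> \<iota> Y') \<bullet> (\<iota> S \<star> k)"
  have iff: "F \<bullet> (u \<star> \<iota> X) = A \<longleftrightarrow> e \<bullet> (u \<star> \<iota> T') = ?b"
    if u: "arr u" "dm u = S" "cd u = T" for u
  proof -
    have uK: "(\<iota> T \<star> K) \<bullet> (u \<star> \<iota> (X @ Y')) = (u \<star> \<iota> T') \<bullet> (\<iota> S \<star> K)"
      using exchange[of u K "[]" "[]" "[]"] u by simp
    have "F \<bullet> (u \<star> \<iota> X) = A \<longleftrightarrow> (F \<bullet> (u \<star> \<iota> X)) \<star> \<iota> Y' = A \<star> \<iota> Y'"
      using invertible_faithful[OF t, where u = "F \<bullet> (u \<star> \<iota> X)" and w = A] u by auto
    also have "\<dots> \<longleftrightarrow> f \<bullet> ((F \<bullet> (u \<star> \<iota> X)) \<star> \<iota> Y') = f \<bullet> (A \<star> \<iota> Y')"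
      using cancel_left[where g = f and k = d and f = "(F \<bullet> (u \<star> \<iota> X)) \<star> \<iota> Y'" and f' = "A \<star> \<iota> Y'"] inv u by auto
    also have "f \<bullet> ((F \<bullet> (u \<star> \<iota> X)) \<star> \<iota> Y') = e \<bullet> (\<iota> T \<star> K) \<bullet> (u \<star> \<iota> (X @ Y'))"
      using u reassoc[OF eq] by (simp add: whisker idn_tens_idn)
    also have "\<dots> = e \<bullet> (u \<star> \<iota> T') \<bullet> (\<iota> S \<star> K)"
      by (simp add: uK)
    also have "e \<bullet> (u \<star> \<iota> T') \<bullet> (\<iota> S \<star> K) = f \<bullet> (A \<star> \<iota> Y') \<longleftrightarrow> e \<bullet> (u \<star> \<iota> T') = ?b"
    proof
      assume "e \<bullet> (u \<star> \<iota> T') \<bullet> (\<iota> S \<star> K) = f \<bullet> (A \<star> \<iota> Y')"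
      then have "e \<bullet> (u \<star> \<iota> T') \<bullet> (\<iota> S \<star> K) \<bullet> (\<iota> S \<star> k) = ?b"
        by (metis cmp_assoc)
      then show "e \<bullet> (u \<star> \<iota> T') = ?b"
        using u by (simp add: interchange inv idn_tens_idn)
    next
      assume "e \<bullet> (u \<star> \<iota> T') = ?b"
      then have "(e \<bullet> (u \<star> \<iota> T')) \<bullet> (\<iota> S \<star> K) = f \<bullet> (A \<star> \<iota> Y') \<bullet> (\<iota> S \<star> k) \<bullet> (\<iota> S \<star> K)"
        by simp
      then show "e \<bullet> (u \<star> \<iota> T') \<bullet> (\<iota> S \<star> K) = f \<bullet> (A \<star> \<iota> Y')"
        by (simp add: interchange inv idn_tens_idn)
    qed
    finally show ?thesis .
  qed
  have "\<exists>!u. arr u \<and> dm u = S \<and> cd u = T \<and> e \<bullet> (u \<star> \<iota> T') = ?b"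
    using e[unfolded universal_def] by simp
  then show "\<exists>!u. arr u \<and> dm u = S \<and> cd u = T \<and> F \<bullet> (u \<star> \<iota> X) = A"
    using iff by metis
qed (use F in simp_all)

end

subsection \<open>Exterior powers\<close>

locale exterior_powers = dual_objects +
  fixes W W' :: "nat \<Rightarrow> 'b" and inj prj inj' prj' :: "nat \<Rightarrow> 'a"
  assumes inj [simp]: "arr (inj n)" "dm (inj n) = [W n]" "cd (inj n) = replicate n v"
    and prj [simp]: "arr (prj n)" "dm (prj n) = replicate n v" "cd (prj n) = [W n]"
    and prj_inj: "prj n \<bullet> inj n = \<iota> [W n]" and inj_prj: "inj n \<bullet> prj n = alt v n"
    and inj' [simp]: "arr (inj' n)" "dm (inj' n) = [W' n]" "cd (inj' n) = replicate n v'"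
    and prj' [simp]: "arr (prj' n)" "dm (prj' n) = replicate n v'" "cd (prj' n) = [W' n]"
    and prj_inj': "prj' n \<bullet> inj' n = \<iota> [W' n]" and inj_prj': "inj' n \<bullet> prj' n = alt v' n"
begin

lemma swapped_powers:
  "exterior_powers arr dm cd \<iota> (\<bullet>) (\<star>) \<tau> (\<uplus>) (\<rhd>) v' v (e \<bullet> \<tau> [v] [v']) (\<tau> [v] [v'] \<bullet> c) W' W inj' prj' inj prj"
  by (intro exterior_powers.intro swapped exterior_powers_axioms.intro)
    (simp_all add: prj_inj inj_prj prj_inj' inj_prj')

lemma alt_inj: "alt v n \<bullet> inj n = inj n" "alt v' n \<bullet> inj' n = inj' n"
  by (simp_all add: prj_inj prj_inj' flip: inj_prj inj_prj')

lemma adj_inj: "Suc k < n \<Longrightarrow> adj v n k \<bullet> inj n = (-1) \<rhd> inj n"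
  by (metis adj_alt alt_inj(1) cmp_assoc scl_cmp)

definition "pairing n = E n \<bullet> (inj' n \<star> inj n)"
definition "copairing n = (prj n \<star> prj' n) \<bullet> K n"

definition mult :: "nat \<Rightarrow> nat \<Rightarrow> 'a" where
  "mult i j = prj (i + j) \<bullet> (inj i \<star> inj j)"

definition mult' :: "nat \<Rightarrow> nat \<Rightarrow> 'a" where
  "mult' i j = prj' (i + j) \<bullet> (inj' i \<star> inj' j)"

definition contraction :: "nat \<Rightarrow> nat \<Rightarrow> 'a" where
  "contraction i j = prj j \<bullet> (E i \<star> \<iota> (replicate j v)) \<bullet> (inj' i \<star> inj (i + j))"

text \<open>The coevaluation of the \<open>i\<close>-th exterior power, with the dual factor placed
  first, followed by multiplication onto \<open>W j\<close>: an arrow from \<open>W j\<close> to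
  \<open>W' i\<close> tensored with \<open>W (i + j)\<close>.\<close>

definition comult :: "nat \<Rightarrow> nat \<Rightarrow> 'a" where
  "comult i j = (\<iota> [W' i] \<star> mult i j) \<bullet> (((prj' i \<star> prj i) \<bullet> copairing_pow v' v (\<tau> [v] [v'] \<bullet> c) i) \<star> \<iota> [W j])"

lemma E_alt_inj: "E n \<bullet> (alt v' n \<star> inj n) = E n \<bullet> (\<iota> (replicate n v') \<star> inj n)"
proof -
  have "E n \<bullet> (alt v' n \<star> inj n) = (E n \<bullet> (alt v' n \<star> \<iota> (replicate n v))) \<bullet> (\<iota> (replicate n v') \<star> inj n)"
    by (simp add: interchange)
  then show ?thesis
    by (simp add: interchange alt_inj flip: E_alt)
qed

lemma E_inj_alt: "E n \<bullet> (inj' n \<star> alt v n) = E n \<bullet> (inj' n \<star> \<iota> (replicate n v))"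
proof -
  have "E n \<bullet> (inj' n \<star> alt v n) = (E n \<bullet> (\<iota> (replicate n v') \<star> alt v n)) \<bullet> (inj' n \<star> \<iota> (replicate n v))"
    by (simp add: interchange)
  then show ?thesis
    by (simp add: interchange alt_inj E_alt)
qed

lemma pairing_arr [simp]: "arr (pairing n)" "dm (pairing n) = [W' n, W n]" "cd (pairing n) = []"
  and copairing_arr [simp]: "arr (copairing n)" "dm (copairing n) = []" "cd (copairing n) = [W n, W' n]"
  and mult_arr [simp]: "arr (mult i j)" "dm (mult i j) = [W i, W j]" "cd (mult i j) = [W (i + j)]"
  and mult'_arr [simp]: "arr (mult' i j)" "dm (mult' i j) = [W' i, W' j]" "cd (mult' i j) = [W' (i + j)]"
  and contraction_arr [simp]: "arr (contraction i j)" "dm (contraction i j) = [W' i, W (i + j)]" "cd (contraction i j) = [W j]"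
  by (simp_all add: pairing_def copairing_def mult_def mult'_def contraction_def replicate_add)

text \<open>These are the zigzags of the tensor powers with an antisymmetrizer in the middle, which
  the inclusion on the other side of the pairing absorbs.\<close>

lemma dual_pair_powers: "dual_pair [W n] [W' n] (pairing n) (copairing n)"
proof -
  let ?V = "\<iota> (replicate n v)" and ?V' = "\<iota> (replicate n v')"
  have "(\<iota> [W n] \<star> pairing n) \<bullet> (copairing n \<star> \<iota> [W n])
    = (\<iota> [W n] \<star> E n) \<bullet> ((\<iota> [W n] \<star> inj' n \<star> inj n) \<bullet> (prj n \<star> prj' n \<star> \<iota> [W n])) \<bullet> (K n \<star> \<iota> [W n])"
    by (simp add: pairing_def copairing_def whisker)
  also have "(\<iota> [W n] \<star> inj' n \<star> inj n) \<bullet> (prj n \<star> prj' n \<star> \<iota> [W n]) = prj n \<star> alt v' n \<star> inj n"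
    by (simp add: interchange inj_prj')
  also have "(\<iota> [W n] \<star> E n) \<bullet> (prj n \<star> alt v' n \<star> inj n) \<bullet> (K n \<star> \<iota> [W n])
    = (prj n \<star> (E n \<bullet> (alt v' n \<star> inj n))) \<bullet> (K n \<star> \<iota> [W n])"
    using reassoc[OF interchange[of "prj n" "\<iota> [W n]" "alt v' n \<star> inj n" "E n"]] by simp
  also have "\<dots> = prj n \<bullet> (?V \<star> E n) \<bullet> (?V \<star> ?V' \<star> inj n) \<bullet> (K n \<star> \<iota> [W n])"
    unfolding E_alt_inj
    using reassoc[OF interchange[of "?V" "prj n" "E n \<bullet> (?V' \<star> inj n)" "\<iota> []"], of "K n \<star> \<iota> [W n]"]
    by (simp add: whisker)
  also have "(?V \<star> ?V' \<star> inj n) \<bullet> (K n \<star> \<iota> [W n]) = (K n \<star> ?V) \<bullet> inj n"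
    using exchange[of "K n" "inj n" "[]" "[]" "[]"] by (simp add: idn_tens_idn)
  also have "prj n \<bullet> (?V \<star> E n) \<bullet> (K n \<star> ?V) \<bullet> inj n = \<iota> [W n]"
    using reassoc[OF dual_pairD(7)[OF dual_pow]] by (simp add: prj_inj)
  finally have 1: "(\<iota> [W n] \<star> pairing n) \<bullet> (copairing n \<star> \<iota> [W n]) = \<iota> [W n]" .
  have "(pairing n \<star> \<iota> [W' n]) \<bullet> (\<iota> [W' n] \<star> copairing n)
    = (E n \<star> \<iota> [W' n]) \<bullet> ((inj' n \<star> inj n \<star> \<iota> [W' n]) \<bullet> (\<iota> [W' n] \<star> prj n \<star> prj' n)) \<bullet> (\<iota> [W' n] \<star> K n)"
    by (simp add: pairing_def copairing_def whisker)
  also have "(inj' n \<star> inj n \<star> \<iota> [W' n]) \<bullet> (\<iota> [W' n] \<star> prj n \<star> prj' n) = inj' n \<star> alt v n \<star> prj' n"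
    by (simp add: interchange inj_prj)
  also have "(E n \<star> \<iota> [W' n]) \<bullet> (inj' n \<star> alt v n \<star> prj' n) \<bullet> (\<iota> [W' n] \<star> K n)
    = ((E n \<bullet> (inj' n \<star> alt v n)) \<star> prj' n) \<bullet> (\<iota> [W' n] \<star> K n)"
    using reassoc[OF interchange[of "inj' n \<star> alt v n" "E n" "prj' n" "\<iota> [W' n]"]] by simp
  also have "\<dots> = prj' n \<bullet> (E n \<star> ?V') \<bullet> (inj' n \<star> ?V \<star> ?V') \<bullet> (\<iota> [W' n] \<star> K n)"
    unfolding E_inj_alt
    using reassoc[OF interchange[of "E n \<bullet> (inj' n \<star> ?V)" "\<iota> []" "?V'" "prj' n"], of "\<iota> [W' n] \<star> K n"]
    by (simp add: whisker)
  also have "(inj' n \<star> ?V \<star> ?V') \<bullet> (\<iota> [W' n] \<star> K n) = (?V' \<star> K n) \<bullet> inj' n"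
    using exchange[of "inj' n" "K n" "[]" "[]" "[]"] by (simp add: idn_tens_idn)
  also have "prj' n \<bullet> (E n \<star> ?V') \<bullet> (?V' \<star> K n) \<bullet> inj' n = \<iota> [W' n]"
    using reassoc[OF dual_pairD(8)[OF dual_pow]] by (simp add: prj_inj')
  finally show ?thesis
    unfolding dual_pair_def using 1 by simp
qed

text \<open>\<open>E (i + j)\<close> nests \<open>E i\<close> inside \<open>E j\<close>, so the
  contracted dual factors are the last \<open>i\<close> ones; hence the order in
  \<open>mult' j i\<close>. The antisymmetrizers arising from inclusion after projection disappear
  against the antisymmetric factor across the pairing.\<close>

lemma pairing_contraction:
  "pairing j \<bullet> (\<iota> [W' j] \<star> contraction i j) = pairing (i + j) \<bullet> (mult' j i \<star> \<iota> [W (i + j)])"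
proof -
  let ?X = "(E i \<star> \<iota> (replicate j v)) \<bullet> (inj' i \<star> inj (i + j))"
  have X: "arr ?X" "cd ?X = replicate j v"
    by (simp_all add: replicate_add)
  have "pairing j \<bullet> (\<iota> [W' j] \<star> contraction i j) = E j \<bullet> (inj' j \<star> inj j) \<bullet> (\<iota> [W' j] \<star> (prj j \<bullet> ?X))"
    by (simp add: pairing_def contraction_def)
  also have "\<dots> = E j \<bullet> (inj' j \<star> ((inj j \<bullet> prj j) \<bullet> ?X))"
    by (subst interchange) (simp_all add: replicate_add)
  also have "\<dots> = (E j \<bullet> (inj' j \<star> alt v j)) \<bullet> (\<iota> [W' j] \<star> ?X)"
    unfolding inj_prj using X interchange[of "\<iota> [W' j]" "inj' j" ?X "alt v j"] by simp
  also have "\<dots> = E j \<bullet> (inj' j \<star> ?X)"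
    unfolding E_inj_alt using X interchange[of "\<iota> [W' j]" "inj' j" ?X "\<iota> (replicate j v)"] by simp
  finally have 1: "pairing j \<bullet> (\<iota> [W' j] \<star> contraction i j) = E j \<bullet> (inj' j \<star> ?X)" .
  let ?Y = "inj' j \<star> inj' i" and ?L = "\<iota> [W (i + j)]"
  have r: "replicate (i + j) v' = replicate j v' @ replicate i v'"
    by (simp add: add.commute flip: replicate_add)
  have "pairing (i + j) \<bullet> (mult' j i \<star> ?L) = E (i + j) \<bullet> (inj' (i + j) \<star> inj (i + j)) \<bullet> ((prj' (i + j) \<bullet> ?Y) \<star> ?L)"
    by (simp add: pairing_def mult'_def add.commute)
  also have "\<dots> = E (i + j) \<bullet> (((inj' (i + j) \<bullet> prj' (i + j)) \<bullet> ?Y) \<star> inj (i + j))"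
    by (subst interchange) (simp_all add: r)
  also have "\<dots> = (E (i + j) \<bullet> (alt v' (i + j) \<star> inj (i + j))) \<bullet> (?Y \<star> ?L)"
    unfolding inj_prj' using interchange[of ?Y "alt v' (i + j)" ?L "inj (i + j)"] r by simp
  also have "\<dots> = E (i + j) \<bullet> (?Y \<star> inj (i + j))"
    unfolding E_alt_inj using interchange[of ?Y "\<iota> (replicate (i + j) v')" ?L "inj (i + j)"] r by simp
  also have "\<dots> = E j \<bullet> (\<iota> (replicate j v') \<star> (E i \<star> \<iota> (replicate j v))) \<bullet> (inj' j \<star> (inj' i \<star> inj (i + j)))"
    by (simp add: E_add)
  also have "\<dots> = E j \<bullet> (inj' j \<star> ?X)"
    by (subst interchange) (simp_all add: replicate_add)
  finally show ?thesis
    using 1 by simp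
qed

text \<open>The antisymmetrizers on \<open>i\<close> strands are absorbed by
  \<open>alt v (i + j)\<close>, the dual one after \<open>E_alt\<close> has carried it across
  \<open>E i\<close>. What remains is the partial trace of \<open>trace_pow_alt\<close>, seen on the
  direct factor \<open>W j\<close>.\<close>

lemma contraction_comult: "contraction i j \<bullet> comult i j = trace_coeff r i j \<star> \<iota> [W j]"
proof -
  let ?K = "copairing_pow v' v (\<tau> [v] [v'] \<bullet> c) i" and ?g = "i + j"
  let ?Vi = "\<iota> (replicate i v)" and ?Vj = "\<iota> (replicate j v)" and ?Vi' = "\<iota> (replicate i v')"
  interpret swapped: dual_objects arr dm cd \<iota> "(\<bullet>)" "(\<star>)" \<tau> "(\<uplus>)" "(\<rhd>)" v' v "e \<bullet> \<tau> [v] [v']" "\<tau> [v] [v'] \<bullet> c"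
    by (rule swapped)
  note [simp] = replicate_add
  have a1: "alt v ?g \<bullet> (alt v i \<star> inj j) = alt v ?g \<bullet> (?Vi \<star> inj j)"
    using reassoc[OF alt_cmp_tens_alt(2)[of v i j], of "?Vi \<star> inj j"] by (simp add: interchange)
  have "contraction i j \<bullet> comult i j = prj j \<bullet> (E i \<star> ?Vj) \<bullet> ((inj' i \<star> inj ?g) \<bullet> (\<iota> [W' i] \<star> (prj ?g \<bullet> (inj i \<star> inj j))))
      \<bullet> (prj' i \<star> (prj i \<star> \<iota> [W j])) \<bullet> (?K \<star> \<iota> [W j])"
    by (simp add: contraction_def comult_def mult_def whisker)
  also have "(inj' i \<star> inj ?g) \<bullet> (\<iota> [W' i] \<star> (prj ?g \<bullet> (inj i \<star> inj j))) = inj' i \<star> ((inj ?g \<bullet> prj ?g) \<bullet> (inj i \<star> inj j))"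
    by (subst interchange) simp_all
  also have "(inj' i \<star> ((inj ?g \<bullet> prj ?g) \<bullet> (inj i \<star> inj j))) \<bullet> (prj' i \<star> (prj i \<star> \<iota> [W j])) \<bullet> (?K \<star> \<iota> [W j])
    = ((inj' i \<bullet> prj' i) \<star> (alt v ?g \<bullet> ((inj i \<bullet> prj i) \<star> inj j))) \<bullet> (?K \<star> \<iota> [W j])"
    unfolding inj_prj[of ?g]
    using reassoc[OF interchange[of "prj' i" "inj' i" "prj i \<star> \<iota> [W j]" "alt v ?g \<bullet> (inj i \<star> inj j)"]]
    by (simp add: interchange)
  also have "\<dots> = (alt v' i \<star> (alt v ?g \<bullet> (?Vi \<star> inj j))) \<bullet> (?K \<star> \<iota> [W j])"
    unfolding inj_prj inj_prj' a1 ..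
  also have "(E i \<star> ?Vj) \<bullet> (alt v' i \<star> (alt v ?g \<bullet> (?Vi \<star> inj j))) \<bullet> (?K \<star> \<iota> [W j])
    = ((E i \<bullet> (alt v' i \<star> ?Vi)) \<star> ?Vj) \<bullet> (?Vi' \<star> (alt v ?g \<bullet> (?Vi \<star> inj j))) \<bullet> (?K \<star> \<iota> [W j])"
    using reassoc[OF interchange[of "?Vi'" "alt v' i" "alt v ?g \<bullet> (?Vi \<star> inj j)" "\<iota> (replicate ?g v)"]]
    by (simp add: whisker idn_tens_idn)
  also have "\<dots> = (E i \<star> ?Vj) \<bullet> (?Vi' \<star> ((alt v i \<star> ?Vj) \<bullet> alt v ?g)) \<bullet> (?Vi' \<star> ?Vi \<star> inj j) \<bullet> (?K \<star> \<iota> [W j])"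
    unfolding E_alt[symmetric] by (simp add: whisker)
  also have "(?Vi' \<star> ?Vi \<star> inj j) \<bullet> (?K \<star> \<iota> [W j]) = (?K \<star> ?Vj) \<bullet> inj j"
    using exchange[of "?K" "inj j" "[]" "[]" "[]"] by simp
  also have "(alt v i \<star> ?Vj) \<bullet> alt v ?g = alt v ?g"
    by (rule tens_alt_cmp_alt)
  also have "prj j \<bullet> (E i \<star> ?Vj) \<bullet> (?Vi' \<star> alt v ?g) \<bullet> (?K \<star> ?Vj) \<bullet> inj j = prj j \<bullet> (trace_coeff r i j \<star> alt v j) \<bullet> inj j"
    unfolding trace_pow_alt[symmetric] by simp
  also have "\<dots> = trace_coeff r i j \<star> \<iota> [W j]"
    using interchange[of "trace_coeff r i j" "\<iota> []" "alt v j \<bullet> inj j" "prj j"]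
      interchange[of "\<iota> []" "trace_coeff r i j" "inj j" "alt v j"]
    by (simp add: alt_inj prj_inj)
  finally show ?thesis .
qed

text \<open>An object and its dual have the same rank, so the same coefficients govern both
  sides.\<close>

lemma swapped_trace: "(e \<bullet> \<tau> [v] [v']) \<bullet> \<tau> [v'] [v] \<bullet> \<tau> [v] [v'] \<bullet> c = r"
  by (simp add: reassoc[OF swp_swp])

text \<open>Undoes the transposition of \<open>pairing_contraction\<close> with a zigzag of
  \<open>W j\<close>.\<close>

lemma contraction_eq:
  "contraction i j = (\<iota> [W j] \<star> pairing (i + j)) \<bullet> (((\<iota> [W j] \<star> mult' j i) \<bullet> (copairing j \<star> \<iota> [W' i])) \<star> \<iota> [W (i + j)])"
proof -
  have 1: "(\<iota> [W j] \<star> \<iota> [W' j] \<star> contraction i j) \<bullet> (copairing j \<star> \<iota> [W' i, W (i + j)]) = (copairing j \<star> \<iota> [W j]) \<bullet> contraction i j"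
    using exchange[of "copairing j" "contraction i j" "[]" "[]" "[]"] by simp
  have "(\<iota> [W j] \<star> pairing (i + j)) \<bullet> (((\<iota> [W j] \<star> mult' j i) \<bullet> (copairing j \<star> \<iota> [W' i])) \<star> \<iota> [W (i + j)])
    = (\<iota> [W j] \<star> (pairing (i + j) \<bullet> (mult' j i \<star> \<iota> [W (i + j)]))) \<bullet> (copairing j \<star> \<iota> [W' i, W (i + j)])"
    by (simp add: whisker idn_tens_idn add.commute)
  also have "\<dots> = (\<iota> [W j] \<star> pairing j) \<bullet> (copairing j \<star> \<iota> [W j]) \<bullet> contraction i j"
    unfolding pairing_contraction[symmetric] using 1 by (simp add: whisker)
  also have "\<dots> = contraction i j"
    using reassoc[OF dual_pairD(7)[OF dual_pair_powers]] by simp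
  finally show ?thesis ..
qed

text \<open>The two one-sided inverses have different origins. The right inverse \<open>q\<close> is
  \<open>comult i j\<close> corrected by \<open>x\<close>. The left inverse \<open>k\<close> follows
  the factorization in \<open>contraction_eq\<close>: \<open>d\<close> undoes the pairing of the top
  powers, and \<open>l\<close>, which is the dual contraction corrected by \<open>y\<close>, undoes
  the dual comultiplication \<open>b\<close>.\<close>

lemma contraction_inverse:
  assumes L: "invertible [W (i + j)]"
    and x: "inverse_arrs (trace_coeff r i j) x" and y: "inverse_arrs (trace_coeff r j i) y"
  shows "\<exists>k. inverse_arrs (contraction i j) k"
proof -
  interpret swapped: exterior_powers arr dm cd \<iota> "(\<bullet>)" "(\<star>)" \<tau> "(\<uplus>)" "(\<rhd>)" v' v "e \<bullet> \<tau> [v] [v']" "\<tau> [v] [v'] \<bullet> c"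
    W' W inj' prj' inj prj
    by (rule swapped_powers)
  let ?L = "\<iota> [W (i + j)]"
  define b where "b = swapped.comult j i"
  have b_eq: "b = (\<iota> [W j] \<star> mult' j i) \<bullet> (copairing j \<star> \<iota> [W' i])"
    by (simp add: b_def swapped.comult_def swapped.mult_def mult'_def copairing_def reassoc[OF swp_swp])
  then have b [simp]: "arr b" "dm b = [W' i]" "cd b = [W j, W' (i + j)]"
    by (simp_all add: add.commute)
  have xs [simp]: "arr x" "dm x = []" "cd x = []" "arr y" "dm y = []" "cd y = []"
    and inv: "trace_coeff r i j \<bullet> x = \<iota> []" "y \<bullet> trace_coeff r j i = \<iota> []"
    using x y by (simp_all add: inverse_arrs_def)
  obtain d where "inverse_arrs (pairing (i + j)) d"
    using invertible_counit[OF L dual_pair_powers] by blast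
  then have d [simp]: "arr d" "dm d = []" "cd d = [W' (i + j), W (i + j)]"
    and dp: "d \<bullet> pairing (i + j) = \<iota> [W' (i + j), W (i + j)]"
    by (simp_all add: inverse_arrs_def)
  define l where "l = (y \<star> \<iota> [W' i]) \<bullet> swapped.contraction j i"
  have l [simp]: "arr l" "dm l = [W j, W' (i + j)]" "cd l = [W' i]"
    by (simp_all add: l_def add.commute)
  have lb: "l \<bullet> b = \<iota> [W' i]"
    using swapped.contraction_comult[of j i, unfolded swapped_trace]
    by (simp add: l_def b_def interchange inv idn_tens_idn)
  define k where "k = (l \<star> ?L) \<bullet> (\<iota> [W j] \<star> d)"
  have k [simp]: "arr k" "dm k = [W j]" "cd k = [W' i, W (i + j)]"
    by (simp_all add: k_def)
  have "k \<bullet> contraction i j = (l \<star> ?L) \<bullet> (\<iota> [W j] \<star> (d \<bullet> pairing (i + j))) \<bullet> (b \<star> ?L)"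
    unfolding k_def contraction_eq b_eq[symmetric] by (simp add: whisker)
  also have "\<dots> = \<iota> [W' i, W (i + j)]"
    by (simp add: dp idn_tens_idn interchange lb)
  finally have left: "k \<bullet> contraction i j = \<iota> [W' i, W (i + j)]" .
  define q where "q = comult i j \<bullet> (x \<star> \<iota> [W j])"
  have q [simp]: "arr q" "dm q = [W j]" "cd q = [W' i, W (i + j)]"
    using swapped.K[of i] by (simp_all add: q_def comult_def)
  have "contraction i j \<bullet> q = (contraction i j \<bullet> comult i j) \<bullet> (x \<star> \<iota> [W j])"
    by (simp add: q_def)
  also have "\<dots> = \<iota> [W j]"
    unfolding contraction_comult by (simp add: interchange inv idn_tens_idn)
  finally have right: "contraction i j \<bullet> q = \<iota> [W j]" .
  have "k = k \<bullet> contraction i j \<bullet> q"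
    by (simp add: right)
  also have "\<dots> = q"
    using reassoc[OF left] by simp
  finally show ?thesis
    using left right by (intro exI[of _ k]) (simp add: inverse_arrs_def)
qed

lemma invertible_dual_power:
  assumes "invertible [W n]"
  shows "invertible [W' n]"
proof -
  obtain x where "inverse_arrs (copairing n) x"
    using invertible_unit[OF assms dual_pair_powers] by blast
  then have "inverse_arrs (x \<bullet> \<tau> [W' n] [W n]) (\<tau> [W n] [W' n] \<bullet> copairing n)"
    by (intro invertible_commute) (auto simp: inverse_arrs_def)
  then show ?thesis
    unfolding invertible_def by (intro exI conjI) (assumption, auto simp: inverse_arrs_def)
qed

lemma universal_contraction:
  assumes "invertible [W (i + j)]"
    and "inverse_arrs (trace_coeff r i j) x" and "inverse_arrs (trace_coeff r j i) y"
  shows "universal (contraction i j) [W' i] [W (i + j)] [W j]"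
  using contraction_inverse[OF assms] universal_inverse[OF assms(1)] by auto

text \<open>The multiplication is the transpose of the contraction of \<open>W j\<close> with
  \<open>W' (i + j)\<close>, which lands in \<open>W' i\<close>. That contraction is an isomorphism
  because the invertibility hypotheses are symmetric under passing to the dual.\<close>

lemma universal_mult:
  assumes L: "invertible [W (i + j)]"
    and x: "inverse_arrs (trace_coeff r i j) x" and y: "inverse_arrs (trace_coeff r j i) y"
  shows "universal (mult i j) [W i] [W j] [W (i + j)]"
proof -
  interpret swapped: exterior_powers arr dm cd \<iota> "(\<bullet>)" "(\<star>)" \<tau> "(\<uplus>)" "(\<rhd>)" v' v "e \<bullet> \<tau> [v] [v']" "\<tau> [v] [v'] \<bullet> c"
    W' W inj' prj' inj prj
    by (rule swapped_powers)
  have L': "invertible [W' (i + j)]"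
    by (rule invertible_dual_power[OF L])
  obtain k where k: "inverse_arrs (swapped.contraction j i) k"
    using swapped.contraction_inverse[of j i y x] L' x y by (auto simp: reassoc[OF swp_swp] add.commute)
  obtain d where d: "inverse_arrs (swapped.pairing (i + j)) d"
    using invertible_counit[OF L' swapped.dual_pair_powers] by blast
  have eq: "swapped.pairing i \<bullet> (\<iota> [W i] \<star> swapped.contraction j i) = swapped.pairing (i + j) \<bullet> (mult i j \<star> \<iota> [W' (i + j)])"
    using swapped.pairing_contraction[of i j] by (simp add: add.commute swapped.mult'_def mult_def)
  have e: "universal (swapped.pairing i) [W i] [W' i] []"
    using universal_dual_pair[OF swapped.dual_pair_powers, of "[]" i] by simp
  show ?thesis
    by (rule universal_transpose[OF _ _ _ e k _ _ d _ _ L' eq]) (simp_all add: add.commute)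
qed

lemma words_inj: "w \<in> words v n \<Longrightarrow> \<exists>\<epsilon>\<in>{1, -1}. w \<bullet> inj n = \<epsilon> \<rhd> inj n"
  using words_sign[of w v n "inj n"] adj_inj by simp

lemma words_inj': "w \<in> words v' n \<Longrightarrow> \<exists>\<epsilon>\<in>{1, -1}. w \<bullet> inj' n = \<epsilon> \<rhd> inj' n"
  using exterior_powers.words_inj[OF swapped_powers] .

text \<open>The factorwise pairing is the nested one up to sign on exterior powers; the inverse sign
  goes into the copairing.\<close>

lemma dual_pair_parallel: "\<exists>d. dual_pair [W n] [W' n] (parallel_pow v v' e n \<bullet> (inj' n \<star> inj n)) d"
proof -
  obtain w where w: "w \<in> words v' n" "parallel_pow v v' e n = E n \<bullet> (w \<star> \<iota> (replicate n v))"
    using parallel_pow by blast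
  obtain \<epsilon> where \<epsilon>: "\<epsilon> \<in> {1, -1}" "w \<bullet> inj' n = \<epsilon> \<rhd> inj' n"
    using words_inj'[OF w(1)] by blast
  have "parallel_pow v v' e n \<bullet> (inj' n \<star> inj n) = \<epsilon> \<rhd> pairing n"
    using w(2) \<epsilon>(2) words_arr[OF w(1)] by (simp add: pairing_def interchange)
  then show ?thesis
    using dual_pair_scl[OF dual_pair_powers, of \<epsilon> n] \<epsilon>(1) by auto
qed

lemma universal_parallel_contraction:
  assumes "invertible [W (i + j)]"
    and "inverse_arrs (trace_coeff r i j) x" and "inverse_arrs (trace_coeff r j i) y"
  shows "universal (prj j \<bullet> (parallel_pow v v' e i \<star> \<iota> (replicate j v)) \<bullet> (inj' i \<star> inj (i + j))) [W' i] [W (i + j)] [W j]"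
proof -
  let ?V = "\<iota> (replicate j v)"
  obtain w where w: "w \<in> words v' i" "parallel_pow v v' e i = E i \<bullet> (w \<star> \<iota> (replicate i v))"
    using parallel_pow by blast
  note [simp] = words_arr[OF w(1)]
  obtain \<epsilon> where \<epsilon>: "\<epsilon> \<in> {1, -1}" "w \<bullet> inj' i = \<epsilon> \<rhd> inj' i"
    using words_inj'[OF w(1)] by blast
  have "(parallel_pow v v' e i \<star> ?V) \<bullet> (inj' i \<star> inj (i + j)) = (E i \<star> ?V) \<bullet> (w \<star> \<iota> (replicate (i + j) v)) \<bullet> (inj' i \<star> inj (i + j))"
    by (simp add: w(2) whisker idn_tens_idn replicate_add)
  also have "\<dots> = \<epsilon> \<rhd> ((E i \<star> ?V) \<bullet> (inj' i \<star> inj (i + j)))"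
    using \<epsilon>(2) by (simp add: interchange)
  finally have "prj j \<bullet> (parallel_pow v v' e i \<star> ?V) \<bullet> (inj' i \<star> inj (i + j)) = \<epsilon> \<rhd> contraction i j"
    by (simp add: contraction_def)
  then show ?thesis
    using universal_scl[OF universal_contraction[OF assms], of \<epsilon>] \<epsilon>(1) by auto
qed

text \<open>In contrast to \<open>universal_parallel_contraction\<close>, the permutation relating
  the two powers now meets the first \<open>i\<close> factors of \<open>inj' (i + j)\<close>, which
  is why its word is extended by identities before its sign is taken.\<close>

lemma universal_parallel_contraction':
  assumes L: "invertible [W (i + j)]"
    and x: "inverse_arrs (trace_coeff r i j) x" and y: "inverse_arrs (trace_coeff r j i) y"
  shows "universal (prj' j \<bullet> ((parallel_pow v v' e i \<bullet> \<tau> (replicate i v) (replicate i v')) \<star> \<iota> (replicate j v'))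
    \<bullet> (inj i \<star> inj' (i + j))) [W i] [W' (i + j)] [W' j]"
proof -
  interpret swapped: exterior_powers arr dm cd \<iota> "(\<bullet>)" "(\<star>)" \<tau> "(\<uplus>)" "(\<rhd>)" v' v "e \<bullet> \<tau> [v] [v']" "\<tau> [v] [v'] \<bullet> c"
    W' W inj' prj' inj prj
    by (rule swapped_powers)
  let ?V = "\<iota> (replicate i v)" and ?V' = "\<iota> (replicate j v')" and ?g = "i + j"
  obtain w where w: "w \<in> words v' i" "parallel_pow v v' e i = E i \<bullet> (w \<star> \<iota> (replicate i v))"
    using parallel_pow by blast
  note [simp] = words_arr[OF w(1)]
  obtain \<epsilon> where \<epsilon>: "\<epsilon> \<in> {1, -1}" "(w \<star> ?V') \<bullet> inj' ?g = \<epsilon> \<rhd> inj' ?g"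
    using words_inj'[OF words_tens_idn[OF w(1), of j]] by blast
  have "parallel_pow v v' e i \<bullet> \<tau> (replicate i v) (replicate i v') = (E i \<bullet> \<tau> (replicate i v) (replicate i v')) \<bullet> (?V \<star> w)"
    using swp_natural'[of ?V "replicate i v" w "replicate i v'"] by (simp add: w(2))
  also have "\<dots> = swapped.E i \<bullet> (?V \<star> w)"
    unfolding E_swap ..
  finally have "((parallel_pow v v' e i \<bullet> \<tau> (replicate i v) (replicate i v')) \<star> ?V') \<bullet> (inj i \<star> inj' ?g)
    = (swapped.E i \<star> ?V') \<bullet> (?V \<star> (w \<star> ?V')) \<bullet> (inj i \<star> inj' ?g)"
    by (simp add: whisker)
  also have "\<dots> = \<epsilon> \<rhd> ((swapped.E i \<star> ?V') \<bullet> (inj i \<star> inj' ?g))"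
    using \<epsilon>(2) interchange[of "inj i" ?V "inj' ?g" "w \<star> ?V'"] by (simp add: replicate_add)
  finally have "prj' j \<bullet> ((parallel_pow v v' e i \<bullet> \<tau> (replicate i v) (replicate i v')) \<star> ?V') \<bullet> (inj i \<star> inj' ?g)
    = \<epsilon> \<rhd> swapped.contraction i j"
    by (simp add: swapped.contraction_def)
  moreover have "universal (swapped.contraction i j) [W i] [W' ?g] [W' j]"
    using swapped.universal_contraction[OF invertible_dual_power[OF L], unfolded swapped_trace, OF x y] .
  ultimately show ?thesis
    using universal_scl[of "swapped.contraction i j" "[W i]" "[W' ?g]" "[W' j]" \<epsilon>] \<epsilon>(1) by auto
qed

lemma universal_mult':
  assumes L: "invertible [W (i + j)]"
    and x: "inverse_arrs (trace_coeff r i j) x" and y: "inverse_arrs (trace_coeff r j i) y"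
  shows "universal (mult' i j) [W' i] [W' j] [W' (i + j)]"
proof -
  interpret swapped: exterior_powers arr dm cd \<iota> "(\<bullet>)" "(\<star>)" \<tau> "(\<uplus>)" "(\<rhd>)" v' v "e \<bullet> \<tau> [v] [v']" "\<tau> [v] [v'] \<bullet> c"
    W' W inj' prj' inj prj
    by (rule swapped_powers)
  show ?thesis
    using swapped.universal_mult[OF invertible_dual_power[OF L], unfolded swapped_trace, OF x y]
    by (simp add: swapped.mult_def mult'_def)
qed

end

subsection \<open>Words in the adjacent transpositions\<close>

lemma word_perm_simps [simp]:
  "word_perm [] = id" "word_perm (k # ks) = transpose k (Suc k) \<circ> word_perm ks"
  by (simp_all add: word_perm_def)

lemma word_perm_append: "word_perm (ks @ ls) = word_perm ks \<circ> word_perm ls"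
  by (induction ks) auto

lemma word_perm_rev: "word_perm (rev ks) \<circ> word_perm ks = id"
proof (induction ks)
  case (Cons k ks)
  then show ?case
    by (simp add: word_perm_append fun_eq_iff)
qed simp

lemma word_perm_rev': "word_perm ks \<circ> word_perm (rev ks) = id"
  using word_perm_rev[of "rev ks"] by simp

lemma word_perm_permutes:
  "\<forall>k\<in>set ks. m \<le> k \<and> Suc k < n \<Longrightarrow> word_perm ks permutes {m..<n}"
proof (induction ks)
  case Nil
  then show ?case
    by (simp only: word_perm_simps permutes_id)
next
  case (Cons k ks)
  then show ?case
    unfolding word_perm_simps by (intro permutes_compose permutes_swap_id) auto
qed

lemma sign_word_perm: "sign (word_perm ks) = (-1) ^ length ks"
proof (induction ks)
  case (Cons k ks)
  have "permutation (word_perm ks)"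
    unfolding permutation_permutes
    \<comment> \<open>A bound above all letters. For empty \<open>ks\<close> the value of
      \<open>Max\<close> is arbitrary and the condition is vacuous.\<close>
    using word_perm_permutes[of ks 0 "Suc (Suc (Max (set ks)))"] Max_ge[of "set ks"]
    by (auto simp: less_Suc_eq_le intro!: exI[of _ "{0..<Suc (Suc (Max (set ks)))}"])
  then show ?case
    by (simp only: word_perm_simps sign_compose permutation_swap_id Cons) (simp add: sign_swap_id)
qed simp

text \<open>The letters from \<open>j - 1\<close> down to \<open>m\<close>. Their product sends
  \<open>m\<close> to \<open>j\<close>: a coset representative modulo the permutations fixing
  \<open>m\<close>.\<close>

abbreviation descent :: "nat \<Rightarrow> nat \<Rightarrow> nat list" where
  "descent m j \<equiv> rev [m..<j]"

lemma word_perm_descent: "m \<le> j \<Longrightarrow> word_perm (descent m j) m = j"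
  by (induction j rule: dec_induct) simp_all

text \<open>The Coxeter relations of the symmetric group, read as rewriting steps towards a normal
  form. Two words are compared by rewriting both.\<close>

inductive braid_eq :: "nat \<Rightarrow> nat list \<Rightarrow> nat list \<Rightarrow> bool" for n where
  be_refl: "braid_eq n ks ks"
| be_trans: "\<lbrakk>braid_eq n ks ls; braid_eq n ls ms\<rbrakk> \<Longrightarrow> braid_eq n ks ms"
| be_Cons: "braid_eq n ks ls \<Longrightarrow> braid_eq n (k # ks) (k # ls)"
| be_cancel: "Suc k < n \<Longrightarrow> braid_eq n (k # k # ks) ks"
| be_commute: "\<lbrakk>Suc k < l; Suc l < n\<rbrakk> \<Longrightarrow> braid_eq n (k # l # ks) (l # k # ks)"
| be_commute': "\<lbrakk>Suc k < l; Suc l < n\<rbrakk> \<Longrightarrow> braid_eq n (l # k # ks) (k # l # ks)"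
| be_braid: "Suc (Suc k) < n \<Longrightarrow> braid_eq n (k # Suc k # k # ks) (Suc k # k # Suc k # ks)"

lemma braid_eq_word_perm: "braid_eq n ks ls \<Longrightarrow> word_perm ks = word_perm ls"
proof (induction rule: braid_eq.induct)
  case (be_commute k l ks)
  then show ?case
    by (auto simp: fun_eq_iff transpose_def)
next
  case (be_commute' k l ks)
  then show ?case
    by (auto simp: fun_eq_iff transpose_def)
next
  case (be_braid k ks)
  then show ?case
    by (auto simp: fun_eq_iff transpose_def)
next
  case (be_cancel k ks)
  then show ?case
    by (auto simp: fun_eq_iff)
qed auto

lemma braid_eq_commute_list:
  "\<lbrakk>\<forall>l\<in>set ls. Suc l < n \<and> (Suc l < k \<or> Suc k < l); Suc k < n\<rbrakk> \<Longrightarrow> braid_eq n (k # ls @ ks) (ls @ k # ks)"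
proof (induction ls)
  case (Cons l ls)
  then have "braid_eq n (k # l # ls @ ks) (l # k # ls @ ks)"
    by (auto intro: braid_eq.be_commute braid_eq.be_commute')
  moreover have "braid_eq n (l # k # ls @ ks) (l # ls @ k # ks)"
    using Cons by (intro braid_eq.be_Cons) simp
  ultimately show ?case
    by (auto intro: braid_eq.be_trans)
qed (simp add: braid_eq.be_refl)

lemma braid_eq_append: "braid_eq n ks ls \<Longrightarrow> braid_eq n (xs @ ks) (xs @ ls)"
  by (induction xs) (auto intro: braid_eq.be_Cons)

lemma descent_split: "\<lbrakk>m \<le> k; Suc k < j\<rbrakk> \<Longrightarrow> descent m j = descent (Suc (Suc k)) j @ Suc k # k # descent m k"
proof -
  assume "m \<le> k" "Suc k < j"
  then have "[m..<j] = [m..<k] @ [k, Suc k] @ [Suc (Suc k)..<j]"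
    by (metis append_Cons append_Nil le_add1 le_Suc_ex less_eq_Suc_le less_imp_le upt_add_eq_append upt_conv_Cons Suc_lessD)
  then show ?thesis
    by simp
qed

text \<open>The index \<open>j\<close> is the image of \<open>m\<close> and \<open>ls\<close> fixes \<open>m\<close>, so the normal form is determined by the
  permutation.\<close>
lemma braid_eq_normal_form:
  assumes "\<forall>k\<in>set ks. m \<le> k \<and> Suc k < n" "m < n"
  shows "\<exists>j ls. m \<le> j \<and> j < n \<and> (\<forall>k\<in>set ls. Suc m \<le> k \<and> Suc k < n) \<and> braid_eq n ks (descent m j @ ls)"
  using assms(1)
proof (induction ks)
  case Nil
  then show ?case
    using assms(2) by (intro exI[of _ m] exI[of _ "[]"]) (simp add: braid_eq.be_refl)
next
  case (Cons k ks)
  then obtain j ls where j: "m \<le> j" "j < n" and ls: "\<forall>k\<in>set ls. Suc m \<le> k \<and> Suc k < n"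
    and eq: "braid_eq n ks (descent m j @ ls)"
    by auto
  have k: "m \<le> k" "Suc k < n"
    using Cons.prems by auto
  have eq': "braid_eq n (k # ks) (k # descent m j @ ls)"
    by (rule braid_eq.be_Cons[OF eq])
  consider "k = j" | "Suc k = j" | "j < k" | "Suc k < j"
    by linarith
  then show ?case
  proof cases
    case 1
    have "braid_eq n (k # ks) (descent m (Suc j) @ ls)"
      using eq' j 1 by simp
    then show ?thesis
      using k j ls 1 by (intro exI[of _ "Suc j"] exI[of _ ls]) auto
  next
    case 2
    then have "braid_eq n (k # descent m j @ ls) (descent m k @ ls)"
      using k j by (auto intro!: braid_eq.be_cancel simp flip: 2)
    then show ?thesis
      using k j ls 2 by (intro exI[of _ k] exI[of _ ls]) (auto intro: braid_eq.be_trans[OF eq'])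
  next
    case 3
    then have "braid_eq n (k # descent m j @ ls) (descent m j @ k # ls)"
      using k by (intro braid_eq_commute_list) auto
    then show ?thesis
      using k j ls 3 by (intro exI[of _ j] exI[of _ "k # ls"]) (auto intro: braid_eq.be_trans[OF eq'])
  next
    case 4
    let ?hi = "descent (Suc (Suc k)) j" and ?lo = "descent m k"
    note split = descent_split[OF k(1) 4]
    \<comment> \<open>The letter \<open>k\<close> commutes with the letters above
      \<open>k + 1\<close>, the braid relation then turns \<open>k, k + 1, k\<close> into
      \<open>k + 1, k, k + 1\<close>, and the last \<open>k + 1\<close> commutes with the letters
      below \<open>k\<close>. The letter emerges on the right raised by one, hence above
      \<open>m\<close>.\<close>
    have "braid_eq n (k # ?hi @ Suc k # k # ?lo @ ls) (?hi @ k # Suc k # k # ?lo @ ls)"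
      using k j by (intro braid_eq_commute_list) auto
    moreover have "braid_eq n (?hi @ k # Suc k # k # ?lo @ ls) (?hi @ Suc k # k # Suc k # ?lo @ ls)"
      using 4 j by (intro braid_eq_append braid_eq.be_braid) auto
    moreover have "braid_eq n (?hi @ Suc k # k # Suc k # ?lo @ ls) (?hi @ Suc k # k # ?lo @ Suc k # ls)"
      using 4 j by (intro braid_eq_append braid_eq.be_Cons braid_eq_commute_list) auto
    ultimately have "braid_eq n (k # descent m j @ ls) (descent m j @ Suc k # ls)"
      unfolding split by (auto intro: braid_eq.be_trans)
    then show ?thesis
      using k j ls 4 by (intro exI[of _ j] exI[of _ "Suc k # ls"]) (auto intro: braid_eq.be_trans[OF eq'])
  qed
qed

lemma permutes_word:
  "\<sigma> permutes {m..<n} \<Longrightarrow> \<exists>ks. (\<forall>k\<in>set ks. m \<le> k \<and> Suc k < n) \<and> word_perm ks = \<sigma>"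
proof (induction "n - m" arbitrary: m \<sigma>)
  case 0
  then have "\<sigma> = id"
    by simp
  then show ?case
    by (intro exI[of _ "[]"]) simp
next
  case (Suc d)
  then have m: "m < n"
    by simp
  define j where "j = \<sigma> m"
  have j: "m \<le> j" "j < n"
    using permutes_in_image[OF Suc.prems, of m] m by (simp_all add: j_def)
  have d: "\<forall>k\<in>set (descent m j). m \<le> k \<and> Suc k < n"
    using j by auto
  \<comment> \<open>\<open>[m..<j]\<close> is the reverse of the descent and so acts as its inverse:
    it sends \<open>j\<close> back to \<open>m\<close>, and \<open>?\<rho>\<close> fixes
    \<open>m\<close>.\<close>
  let ?\<rho> = "word_perm [m..<j] \<circ> \<sigma>"
  have p: "?\<rho> permutes {m..<n}"
    using j by (intro permutes_compose[OF Suc.prems] word_perm_permutes) auto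
  have rm: "?\<rho> m = m"
    using fun_cong[OF word_perm_rev'[of "[m..<j]"], of m] word_perm_descent[OF j(1)]
    by (simp add: j_def)
  have "?\<rho> permutes {Suc m..<n}"
  proof (rule permutes_superset[OF p])
    fix x assume "x \<in> {m..<n} - {Suc m..<n}"
    then have "x = m"
      by auto
    then show "?\<rho> x = x"
      using rm by simp
  qed
  then have "\<exists>ks. (\<forall>k\<in>set ks. Suc m \<le> k \<and> Suc k < n) \<and> word_perm ks = ?\<rho>"
    using Suc.hyps by (intro Suc.hyps(1)) simp_all
  then obtain ks where ks: "\<forall>k\<in>set ks. Suc m \<le> k \<and> Suc k < n" "word_perm ks = ?\<rho>"
    by blast
  have "word_perm (descent m j @ ks) = \<sigma>"
    unfolding word_perm_append ks(2) by (simp add: o_assoc word_perm_rev)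
  then show ?case
    using ks(1) d by (intro exI[of _ "descent m j @ ks"]) auto
qed

context strict_tensor_category
begin

definition wact :: "'o \<Rightarrow> nat \<Rightarrow> nat list \<Rightarrow> 'a" where
  "wact v n ks = foldr (\<lambda>k f. adj v n k \<bullet> f) ks (\<iota> (replicate n v))"

lemma wact_simps [simp]: "wact v n [] = \<iota> (replicate n v)" "wact v n (k # ks) = adj v n k \<bullet> wact v n ks"
  by (simp_all add: wact_def)

lemma wact [simp]:
  assumes "\<forall>k\<in>set ks. Suc k < n"
  shows "arr (wact v n ks)" "dm (wact v n ks) = replicate n v" "cd (wact v n ks) = replicate n v"
  using assms by (induction ks) auto

lemma wact_append:
  "\<forall>k\<in>set ls. Suc k < n \<Longrightarrow> wact v n (ks @ ls) = wact v n ks \<bullet> wact v n ls"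
  by (induction ks) auto

lemma braid_eq_wact:
  "braid_eq n ks ls \<Longrightarrow> \<forall>k\<in>set ks. Suc k < n \<Longrightarrow> (\<forall>k\<in>set ls. Suc k < n) \<and> wact v n ks = wact v n ls"
proof (induction rule: braid_eq.induct)
  case (be_cancel k ks)
  then show ?case
    by (simp add: reassoc[OF adj_adj])
next
  case (be_commute k l ks)
  then show ?case
    using reassoc[OF adj_commute[of k l n v]] by simp
next
  case (be_commute' k l ks)
  then show ?case
    using reassoc[OF adj_commute[of k l n v]] by simp
next
  case (be_braid k ks)
  then show ?case
    using reassoc[OF adj_braid[of k n v], of "wact v n ks"] by simp
qed auto

text \<open>The action of a word depends only on its permutation. The descent in the normal form is
  read off from the image of \<open>m\<close>, so the two words have the same one; after cancelling
  it, words in the letters above \<open>m\<close> with equal permutations remain.\<close>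

lemma wact_cong:
  assumes "\<forall>k\<in>set ks. m \<le> k \<and> Suc k < n" "\<forall>k\<in>set ls. m \<le> k \<and> Suc k < n"
    and "word_perm ks = word_perm ls"
  shows "wact v n ks = wact v n ls"
  using assms
proof (induction "n - m" arbitrary: m ks ls)
  case 0
  then have "ks = []" "ls = []"
    by (cases ks; force) (use 0 in \<open>cases ls; force\<close>)
  then show ?case
    by simp
next
  case (Suc d)
  then have m: "m < n"
    by simp
  have nf: "\<exists>xs. (\<forall>k\<in>set xs. Suc m \<le> k \<and> Suc k < n) \<and> word_perm us m < n \<and> m \<le> word_perm us m
      \<and> wact v n us = wact v n (descent m (word_perm us m)) \<bullet> wact v n xs
      \<and> word_perm us = word_perm (descent m (word_perm us m)) \<circ> word_perm xs"
    if us: "\<forall>k\<in>set us. m \<le> k \<and> Suc k < n" for us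
  proof -
    obtain j xs where j: "m \<le> j" "j < n" and xs: "\<forall>k\<in>set xs. Suc m \<le> k \<and> Suc k < n"
      and eq: "braid_eq n us (descent m j @ xs)"
      using braid_eq_normal_form[OF us m] by blast
    have "word_perm xs m = m"
      using word_perm_permutes[OF xs] by (simp add: permutes_def)
    then have "word_perm us m = j"
      using braid_eq_word_perm[OF eq] word_perm_descent[OF j(1)] by (simp add: word_perm_append)
    then show ?thesis
      using j xs braid_eq_word_perm[OF eq] braid_eq_wact[OF eq, of v] us
      by (intro exI[of _ xs]) (auto simp: word_perm_append wact_append)
  qed
  obtain xs where xs: "\<forall>k\<in>set xs. Suc m \<le> k \<and> Suc k < n"
    "wact v n ks = wact v n (descent m (word_perm ks m)) \<bullet> wact v n xs"
    "word_perm ks = word_perm (descent m (word_perm ks m)) \<circ> word_perm xs"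
    using nf[OF Suc.prems(1)] by blast
  obtain ys where ys: "\<forall>k\<in>set ys. Suc m \<le> k \<and> Suc k < n"
    "wact v n ls = wact v n (descent m (word_perm ls m)) \<bullet> wact v n ys"
    "word_perm ls = word_perm (descent m (word_perm ls m)) \<circ> word_perm ys"
    using nf[OF Suc.prems(2)] by blast
  let ?d = "descent m (word_perm ks m)"
  have "word_perm xs = word_perm (rev ?d) \<circ> word_perm ks"
    by (subst xs(3)) (simp add: o_assoc word_perm_rev del: rev_rev_ident)
  also have "\<dots> = word_perm (rev ?d) \<circ> word_perm ls"
    by (simp only: Suc.prems(3))
  also have "\<dots> = word_perm ys"
    by (subst ys(3)) (simp add: o_assoc word_perm_rev Suc.prems(3) del: rev_rev_ident)
  finally have "wact v n xs = wact v n ys"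
    using Suc.hyps(1)[of "Suc m" xs ys] Suc.hyps(2) xs(1) ys(1) by simp
  then show ?case
    unfolding xs(2) ys(2) Suc.prems(3) by simp
qed

lemma wact_alt: "\<forall>k\<in>set ks. Suc k < n \<Longrightarrow> wact v n ks \<bullet> alt v n = of_int (sign (word_perm ks)) \<rhd> alt v n"
  by (induction ks) (simp_all add: scl_one adj_alt sign_word_perm del: word_perm_simps)

end

subsection \<open>Arithmetic in rational tensor categories\<close>

context rational_additive_category
begin

lemma mem_Hom [simp]: "f \<in> Hom C X Y \<longleftrightarrow> Dom C f = X \<and> Cod C f = Y"
  by (simp add: Hom_def)

lemma Idt_dc [simp]: "Dom C (Idt C X) = X" "Cod C (Idt C X) = X"
  using Idt_in_Hom[of X] by simp_all

lemma Comp_dc [simp]: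
  assumes "Cod C f = Dom C g"
  shows "Dom C (g \<cdot> f) = Dom C f" "Cod C (g \<cdot> f) = Cod C g"
  using Comp_in_Hom[of f "Dom C f" "Dom C g" g "Cod C g"] assms by simp_all

lemma Comp_Idt [simp]: "Cod C f = X \<Longrightarrow> Idt C X \<cdot> f = f" "Dom C f = X \<Longrightarrow> f \<cdot> Idt C X = f"
  using Comp_Idt_left[of f "Dom C f" X] Comp_Idt_right[of f X "Cod C f"] by simp_all

lemma Comp_assoc' [simp]: "\<lbrakk>Cod C f = Dom C g; Cod C g = Dom C h\<rbrakk> \<Longrightarrow> (h \<cdot> g) \<cdot> f = h \<cdot> g \<cdot> f"
  using Comp_assoc[of f "Dom C f" "Dom C g" g "Dom C h" h "Cod C h"] by simp

lemma Comp_reassoc: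
  "\<lbrakk>g \<cdot> f = h; Cod C k = Dom C f; Cod C f = Dom C g\<rbrakk> \<Longrightarrow> g \<cdot> f \<cdot> k = h \<cdot> k"
  by (metis Comp_assoc')

lemma arr_iso_inv:
  assumes "arr_iso C f X Y"
  shows "Dom C f = X" "Cod C f = Y" "Dom C (inv_arr C f) = Y" "Cod C (inv_arr C f) = X"
    "inv_arr C f \<cdot> f = Idt C X" "f \<cdot> inv_arr C f = Idt C Y"
proof -
  obtain g where g: "Dom C f = X" "Cod C f = Y" "Dom C g = Y" "Cod C g = X" "g \<cdot> f = Idt C X" "f \<cdot> g = Idt C Y"
    using assms by (auto simp: arr_iso_def)
  have "inv_arr C f = g"
    unfolding inv_arr_def
  proof (rule the_equality)
    fix h assume h: "h \<in> Hom C (Cod C f) (Dom C f) \<and> h \<cdot> f = Idt C (Dom C f) \<and> f \<cdot> h = Idt C (Cod C f)"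
    then have "h = h \<cdot> (f \<cdot> g)"
      using g by simp
    also have "\<dots> = (h \<cdot> f) \<cdot> g"
      using g h by (subst Comp_assoc') simp_all
    also have "\<dots> = g"
      using g h by simp
    finally show "h = g" .
  qed (use g in simp)
  with g show "Dom C f = X" "Cod C f = Y" "Dom C (inv_arr C f) = Y" "Cod C (inv_arr C f) = X"
    "inv_arr C f \<cdot> f = Idt C X" "f \<cdot> inv_arr C f = Idt C Y"
    by simp_all
qed

lemma arr_isoI:
  "\<lbrakk>Dom C f = X; Cod C f = Y; Dom C g = Y; Cod C g = X; g \<cdot> f = Idt C X; f \<cdot> g = Idt C Y\<rbrakk> \<Longrightarrow> arr_iso C f X Y"
  by (auto simp: arr_iso_def)

lemma arr_iso_inv_arr: "arr_iso C f X Y \<Longrightarrow> arr_iso C (inv_arr C f) Y X"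
  by (intro arr_isoI[where g = f]) (simp_all add: arr_iso_inv)

lemma arr_iso_Idt: "arr_iso C (Idt C X) X X"
  by (intro arr_isoI[where g = "Idt C X"]) simp_all

lemma arr_iso_Comp:
  assumes "arr_iso C f X Y" "arr_iso C g Y Z"
  shows "arr_iso C (g \<cdot> f) X Z"
  using arr_iso_inv[OF assms(1)] arr_iso_inv[OF assms(2)]
  by (intro arr_isoI[where g = "inv_arr C f \<cdot> inv_arr C g"])
    (simp_all add: Comp_reassoc[of "inv_arr C g" g] Comp_reassoc[of f "inv_arr C f"])

lemma iso_cancel_left:
  "\<lbrakk>arr_iso C h Y Z; h \<cdot> f = h \<cdot> g; Cod C f = Y; Cod C g = Y\<rbrakk> \<Longrightarrow> f = g"
  using arr_iso_inv[of h Y Z] by (metis Comp_Idt(1) Comp_assoc')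

lemma iso_cancel_right:
  "\<lbrakk>arr_iso C h X Y; f \<cdot> h = g \<cdot> h; Dom C f = Y; Dom C g = Y\<rbrakk> \<Longrightarrow> f = g"
  using arr_iso_inv[of h X Y] by (metis Comp_Idt(2) Comp_assoc')

lemma Hom_add [simp]:
  assumes "Dom C f = Dom C g" "Cod C f = Cod C g"
  shows "Dom C (f \<boxplus> g) = Dom C g" "Cod C (f \<boxplus> g) = Cod C g"
proof -
  interpret M: module rat_ring "Hom_mod C (Dom C g) (Cod C g)" by (rule Hom_module)
  show "Dom C (f \<boxplus> g) = Dom C g" "Cod C (f \<boxplus> g) = Cod C g"
    using M.a_closed[of f g] assms by (simp_all add: Hom_mod_def)
qed

lemma Hom_scale [simp]: "Dom C (ScaleArr C q f) = Dom C f" "Cod C (ScaleArr C q f) = Cod C f"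
proof -
  interpret M: module rat_ring "Hom_mod C (Dom C f) (Cod C f)" by (rule Hom_module)
  show "Dom C (ScaleArr C q f) = Dom C f" "Cod C (ScaleArr C q f) = Cod C f"
    using M.smult_closed[of q f] by (simp_all add: Hom_mod_def rat_ring_def)
qed

lemma add_commute:
  assumes "Dom C f = Dom C g" "Cod C f = Cod C g"
  shows "f \<boxplus> g = g \<boxplus> f"
proof -
  interpret M: module rat_ring "Hom_mod C (Dom C g) (Cod C g)" by (rule Hom_module)
  show ?thesis
    using M.a_comm[of f g] assms by (simp add: Hom_mod_def)
qed

lemma add_assoc:
  assumes "Dom C f = Dom C g" "Cod C f = Cod C g" "Dom C g = Dom C h" "Cod C g = Cod C h"
  shows "(f \<boxplus> g) \<boxplus> h = f \<boxplus> (g \<boxplus> h)"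
proof -
  interpret M: module rat_ring "Hom_mod C (Dom C h) (Cod C h)" by (rule Hom_module)
  show ?thesis
    using M.a_assoc[of f g h] assms by (simp add: Hom_mod_def)
qed

lemma scale_add_right:
  assumes "Dom C f = Dom C g" "Cod C f = Cod C g"
  shows "ScaleArr C q (f \<boxplus> g) = ScaleArr C q f \<boxplus> ScaleArr C q g"
proof -
  interpret M: module rat_ring "Hom_mod C (Dom C g) (Cod C g)" by (rule Hom_module)
  show ?thesis
    using M.smult_r_distr[of q f g] assms by (simp add: Hom_mod_def rat_ring_def)
qed

lemma scale_simps:
  "ScaleArr C (p + q) f = ScaleArr C p f \<boxplus> ScaleArr C q f"
  "ScaleArr C p (ScaleArr C q f) = ScaleArr C (p * q) f"
  "ScaleArr C 1 f = f"
  "ScaleArr C 0 f = ZeroArr C (Dom C f) (Cod C f)"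
proof -
  interpret M: module rat_ring "Hom_mod C (Dom C f) (Cod C f)" by (rule Hom_module)
  show "ScaleArr C (p + q) f = ScaleArr C p f \<boxplus> ScaleArr C q f"
    using M.smult_l_distr[of p q f] by (simp add: Hom_mod_def rat_ring_def)
  show "ScaleArr C p (ScaleArr C q f) = ScaleArr C (p * q) f"
    using M.smult_assoc1[of p q f] by (simp add: Hom_mod_def rat_ring_def)
  show "ScaleArr C 1 f = f"
    using M.smult_one[of f] by (simp add: Hom_mod_def rat_ring_def)
  show "ScaleArr C 0 f = ZeroArr C (Dom C f) (Cod C f)"
    using M.smult_l_null[of f] by (simp add: Hom_mod_def rat_ring_def)
qed

lemma add_scale_zero:
  assumes "Dom C f = Dom C g" "Cod C f = Cod C g"
  shows "f \<boxplus> ScaleArr C 0 g = f"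
proof -
  have "ScaleArr C 0 g = ScaleArr C 0 f"
    using assms by (simp add: scale_simps(4))
  then show ?thesis
    using scale_simps(1)[of 1 0 f] by (simp add: scale_simps(3))
qed

lemma Comp_add:
  "\<lbrakk>Dom C g = Dom C h; Cod C g = Cod C h; Cod C f = Dom C g\<rbrakk> \<Longrightarrow> (g \<boxplus> h) \<cdot> f = (g \<cdot> f) \<boxplus> (h \<cdot> f)"
  "\<lbrakk>Dom C g = Dom C h; Cod C g = Cod C h; Cod C g = Dom C f\<rbrakk> \<Longrightarrow> f \<cdot> (g \<boxplus> h) = (f \<cdot> g) \<boxplus> (f \<cdot> h)"
  using Comp_add_left[of f "Dom C f" "Dom C g" g "Cod C g" h]
    Comp_add_right[of g "Dom C g" "Cod C g" h f "Cod C f"] by simp_all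

lemma Comp_scale:
  "Cod C f = Dom C g \<Longrightarrow> ScaleArr C q g \<cdot> f = ScaleArr C q (g \<cdot> f)"
  "Cod C f = Dom C g \<Longrightarrow> g \<cdot> ScaleArr C q f = ScaleArr C q (g \<cdot> f)"
  using Comp_scale_left[of f "Dom C f" "Dom C g" g "Cod C g" q]
    Comp_scale_right[of f "Dom C f" "Cod C f" g "Cod C g" q] by simp_all

text \<open>The tensor product of arrows is only required to be biadditive; this makes it bilinear.\<close>
lemma additive_scale:
  assumes hom: "\<And>f. Dom C f = X \<Longrightarrow> Cod C f = Y \<Longrightarrow> Dom C (\<phi> f) = P \<and> Cod C (\<phi> f) = Q"
    and add: "\<And>f g. \<lbrakk>Dom C f = X; Cod C f = Y; Dom C g = X; Cod C g = Y\<rbrakk> \<Longrightarrow> \<phi> (f \<boxplus> g) = \<phi> f \<boxplus> \<phi> g"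
    and f: "Dom C f = X" "Cod C f = Y"
  shows "\<phi> (ScaleArr C q f) = ScaleArr C q (\<phi> f)"
proof -
  note [simp] = hom f
  let ?z = "\<phi> (ScaleArr C 0 f)"
  have "?z = ?z \<boxplus> ?z"
    using add[of "ScaleArr C 0 f" "ScaleArr C 0 f"] by (simp flip: scale_simps(1))
  then have "ScaleArr C (-1) ?z \<boxplus> ?z = (ScaleArr C (-1) ?z \<boxplus> ?z) \<boxplus> ?z"
    by (simp add: add_assoc)
  then have "ScaleArr C 0 ?z = ?z"
    using scale_simps(1)[of "-1" 1 ?z] scale_simps(1)[of 0 1 ?z] by (simp add: scale_simps(3))
  then have zero: "?z = ScaleArr C 0 (\<phi> f)"
    by (metis scale_simps(4) Hom_scale hom f)
  have nat: "\<phi> (ScaleArr C (of_nat n) g) = ScaleArr C (of_nat n) (\<phi> g)"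
    if "Dom C g = X" "Cod C g = Y" "\<phi> (ScaleArr C 0 g) = ScaleArr C 0 (\<phi> g)" for n g
  proof (induction n)
    case (Suc n)
    have "\<phi> (ScaleArr C (of_nat (Suc n)) g) = \<phi> (ScaleArr C 1 g \<boxplus> ScaleArr C (of_nat n) g)"
      by (simp flip: scale_simps(1))
    then show ?case
      using that Suc by (simp add: add scale_simps(1,3))
  qed (use that in simp)
  have zero': "\<phi> (ScaleArr C 0 g) = ScaleArr C 0 (\<phi> g)" if "Dom C g = X" "Cod C g = Y" for g
    using zero that by (simp add: scale_simps(4))
  have neg: "\<phi> (ScaleArr C (-1) g) = ScaleArr C (-1) (\<phi> g)" if g: "Dom C g = X" "Cod C g = Y" for g
  proof -
    have "ScaleArr C (-1) (\<phi> g) \<boxplus> (\<phi> g \<boxplus> \<phi> (ScaleArr C (-1) g)) = ScaleArr C (-1) (\<phi> g) \<boxplus> \<phi> (ScaleArr C 1 g \<boxplus> ScaleArr C (-1) g)"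
      using g by (simp add: add scale_simps(3))
    also have "\<dots> = ScaleArr C (-1) (\<phi> g)"
      using g zero' by (simp add: add_scale_zero flip: scale_simps(1))
    finally have *: "(ScaleArr C (-1) (\<phi> g) \<boxplus> ScaleArr C 1 (\<phi> g)) \<boxplus> \<phi> (ScaleArr C (-1) g) = ScaleArr C (-1) (\<phi> g)"
      using g by (simp add: add_assoc scale_simps(3))
    have "ScaleArr C 0 (\<phi> g) \<boxplus> \<phi> (ScaleArr C (-1) g) = \<phi> (ScaleArr C (-1) g) \<boxplus> ScaleArr C 0 (\<phi> g)"
      using g by (intro add_commute) simp_all
    then show ?thesis
      using * g by (simp add: add_scale_zero flip: scale_simps(1))
  qed
  have int: "\<phi> (ScaleArr C (of_int a) g) = ScaleArr C (of_int a) (\<phi> g)" if "Dom C g = X" "Cod C g = Y" for a g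
  proof (cases a rule: int_cases2)
    case (nonneg n)
    then show ?thesis
      using nat[OF that zero'[OF that]] by simp
  next
    case (nonpos n)
    then have "ScaleArr C (of_int a) g = ScaleArr C (-1) (ScaleArr C (of_nat n) g)"
      by (simp add: scale_simps(2))
    then show ?thesis
      using nat[OF that zero'[OF that]] neg[of "ScaleArr C (of_nat n) g"] that nonpos
      by (simp add: scale_simps(2))
  qed
  \<comment> \<open>Additivity has given compatibility with integers. Multiplying by the denominator
    reduces to that case, and the denominator can be divided out in the target.\<close>
  obtain a b where q: "q = of_int a / of_int b" "b > 0"
    by (metis quotient_of_denom_pos quotient_of_div surj_pair)
  have "ScaleArr C (of_int b) (\<phi> (ScaleArr C q f)) = ScaleArr C (of_int a) (\<phi> f)"
    using int[of "ScaleArr C q f" b] int[of f a] q by (simp add: scale_simps(2))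
  from arg_cong[OF this, of "ScaleArr C (1 / of_int b)"] show ?thesis
    using q by (simp add: scale_simps(2,3))
qed

end

context rational_ACU_tensor_category
begin

lemma Tensor_dc [simp]: "Dom C (f \<boxtimes> g) = Dom C f \<boxdot> Dom C g" "Cod C (f \<boxtimes> g) = Cod C f \<boxdot> Cod C g"
  using Tensor_in_Hom[of f "Dom C f" "Cod C f" g "Dom C g" "Cod C g"] by simp_all

lemma structure_dc [simp]:
  "Dom C (Assoc C X Y Z) = (X \<boxdot> Y) \<boxdot> Z" "Cod C (Assoc C X Y Z) = X \<boxdot> (Y \<boxdot> Z)"
  "Dom C (LUnit C X) = \<I> \<boxdot> X" "Cod C (LUnit C X) = X"
  "Dom C (RUnit C X) = X \<boxdot> \<I>" "Cod C (RUnit C X) = X"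
  "Dom C (Sym C X Y) = X \<boxdot> Y" "Cod C (Sym C X Y) = Y \<boxdot> X"
  using arr_iso_inv[OF Assoc_iso] arr_iso_inv[OF LUnit_iso] arr_iso_inv[OF RUnit_iso] Sym_in_Hom by simp_all

lemma Tensor_Comp': "\<lbrakk>Cod C f = Dom C g; Cod C f' = Dom C g'\<rbrakk> \<Longrightarrow> (g \<boxtimes> g') \<cdot> (f \<boxtimes> f') = (g \<cdot> f) \<boxtimes> (g' \<cdot> f')"
  using Tensor_Comp[of f "Dom C f" "Dom C g" g "Cod C g" f' "Dom C f'" "Dom C g'" g' "Cod C g'"] by simp

lemma arr_iso_Tensor:
  assumes "arr_iso C f X Y" "arr_iso C g X' Y'"
  shows "arr_iso C (f \<boxtimes> g) (X \<boxdot> X') (Y \<boxdot> Y')"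
  using arr_iso_inv[OF assms(1)] arr_iso_inv[OF assms(2)]
  by (intro arr_isoI[where g = "inv_arr C f \<boxtimes> inv_arr C g"]) (simp_all add: Tensor_Comp' Tensor_Idt)

lemma Tensor_add:
  "\<lbrakk>Dom C f = Dom C g; Cod C f = Cod C g\<rbrakk> \<Longrightarrow> (f \<boxplus> g) \<boxtimes> h = (f \<boxtimes> h) \<boxplus> (g \<boxtimes> h)"
  "\<lbrakk>Dom C f = Dom C g; Cod C f = Cod C g\<rbrakk> \<Longrightarrow> h \<boxtimes> (f \<boxplus> g) = (h \<boxtimes> f) \<boxplus> (h \<boxtimes> g)"
  using Tensor_add_left[of f "Dom C g" "Cod C g" g h "Dom C h" "Cod C h"]
    Tensor_add_right[of h "Dom C h" "Cod C h" f "Dom C g" "Cod C g" g] by simp_all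

lemma Tensor_scale:
  "ScaleArr C q f \<boxtimes> g = ScaleArr C q (f \<boxtimes> g)" "g \<boxtimes> ScaleArr C q f = ScaleArr C q (g \<boxtimes> f)"
proof -
  show "ScaleArr C q f \<boxtimes> g = ScaleArr C q (f \<boxtimes> g)"
    by (rule additive_scale[of "Dom C f" "Cod C f" "\<lambda>f. f \<boxtimes> g"])
      (simp_all add: Tensor_add)
  show "g \<boxtimes> ScaleArr C q f = ScaleArr C q (g \<boxtimes> f)"
    by (rule additive_scale[of "Dom C f" "Cod C f" "\<lambda>f. g \<boxtimes> f"])
      (simp_all add: Tensor_add)
qed

text \<open>Allows an identity to be proved after tensoring with the unit, where pentagon and
  triangle apply.\<close>

lemma unit_Tensor_faithful:
  assumes "Idt C \<I> \<boxtimes> f = Idt C \<I> \<boxtimes> g" "Dom C f = Dom C g" "Cod C f = Cod C g"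
  shows "f = g"
  using LUnit_natural[of f "Dom C f" "Cod C f"] LUnit_natural[of g "Dom C g" "Cod C g"] assms
  by - (rule iso_cancel_right[OF LUnit_iso[of "Dom C g"]]; simp)

lemma Tensor_unit_faithful:
  assumes "f \<boxtimes> Idt C \<I> = g \<boxtimes> Idt C \<I>" "Dom C f = Dom C g" "Cod C f = Cod C g"
  shows "f = g"
  using RUnit_natural[of f "Dom C f" "Cod C f"] RUnit_natural[of g "Dom C g" "Cod C g"] assms
  by - (rule iso_cancel_right[OF RUnit_iso[of "Dom C g"]]; simp)

lemma Assoc_natural':
  "\<lbrakk>Cod C f = X; Cod C g = Y; Cod C h = Z\<rbrakk> \<Longrightarrow>
    Assoc C X Y Z \<cdot> ((f \<boxtimes> g) \<boxtimes> h) = (f \<boxtimes> (g \<boxtimes> h)) \<cdot> Assoc C (Dom C f) (Dom C g) (Dom C h)"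
  using Assoc_natural[of f "Dom C f" X g "Dom C g" Y h "Dom C h" Z] by simp

text \<open>The three compatibilities of the unit constraints which follow from the pentagon and the triangle
  axioms (Kelly).\<close>
lemma LUnit_Tensor: "LUnit C (X \<boxdot> Y) \<cdot> Assoc C \<I> X Y = LUnit C X \<boxtimes> Idt C Y"
proof (rule unit_Tensor_faithful)
  \<comment> \<open>Two edges of the pentagon for unit, unit, \<open>X\<close>, \<open>Y\<close>.
    Composed with the third edge they may be exchanged for the other path, on which the triangle
    axiom applies.\<close>
  let ?h = "Assoc C \<I> (\<I> \<boxdot> X) Y \<cdot> (Assoc C \<I> \<I> X \<boxtimes> Idt C Y)"
  have iso: "arr_iso C ?h (((\<I> \<boxdot> \<I>) \<boxdot> X) \<boxdot> Y) (\<I> \<boxdot> ((\<I> \<boxdot> X) \<boxdot> Y))"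
    by (intro arr_iso_Comp[OF arr_iso_Tensor[OF Assoc_iso arr_iso_Idt] Assoc_iso])
  have "(Idt C \<I> \<boxtimes> (LUnit C (X \<boxdot> Y) \<cdot> Assoc C \<I> X Y)) \<cdot> ?h
    = (Idt C \<I> \<boxtimes> LUnit C (X \<boxdot> Y)) \<cdot> (Idt C \<I> \<boxtimes> Assoc C \<I> X Y) \<cdot> ?h"
    using Comp_reassoc[OF Tensor_Comp'[of "Idt C \<I>" "Idt C \<I>" "Assoc C \<I> X Y" "LUnit C (X \<boxdot> Y)"]]
    by simp
  also have "\<dots> = ((Idt C \<I> \<boxtimes> LUnit C (X \<boxdot> Y)) \<cdot> Assoc C \<I> \<I> (X \<boxdot> Y)) \<cdot> Assoc C (\<I> \<boxdot> \<I>) X Y"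
    using pentagon[of \<I> \<I> X Y] by simp
  also have "\<dots> = Assoc C \<I> X Y \<cdot> ((RUnit C \<I> \<boxtimes> Idt C X) \<boxtimes> Idt C Y)"
    unfolding triangle by (simp add: Assoc_natural' Tensor_Idt)
  also have "\<dots> = Assoc C \<I> X Y \<cdot> ((Idt C \<I> \<boxtimes> LUnit C X) \<boxtimes> Idt C Y) \<cdot> (Assoc C \<I> \<I> X \<boxtimes> Idt C Y)"
    unfolding triangle[symmetric] by (simp add: Tensor_Comp')
  also have "\<dots> = (Idt C \<I> \<boxtimes> (LUnit C X \<boxtimes> Idt C Y)) \<cdot> ?h"
    using Comp_reassoc[OF Assoc_natural'[of "Idt C \<I>" \<I> "LUnit C X" X "Idt C Y" Y]] by simp
  finally show "Idt C \<I> \<boxtimes> (LUnit C (X \<boxdot> Y) \<cdot> Assoc C \<I> X Y) = Idt C \<I> \<boxtimes> (LUnit C X \<boxtimes> Idt C Y)"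
    by (rule iso_cancel_right[OF iso]) simp_all
qed simp_all

lemma RUnit_Tensor: "(Idt C X \<boxtimes> RUnit C Y) \<cdot> Assoc C X Y \<I> = RUnit C (X \<boxdot> Y)"
proof (rule Tensor_unit_faithful)
  let ?A = "Assoc C X Y \<I>"
  have "?A \<cdot> (RUnit C (X \<boxdot> Y) \<boxtimes> Idt C \<I>)
    = (?A \<cdot> ((Idt C X \<boxtimes> Idt C Y) \<boxtimes> LUnit C \<I>)) \<cdot> Assoc C (X \<boxdot> Y) \<I> \<I>"
    unfolding triangle[symmetric] by (simp add: Tensor_Idt)
  also have "\<dots> = (Idt C X \<boxtimes> (Idt C Y \<boxtimes> LUnit C \<I>)) \<cdot> Assoc C X Y (\<I> \<boxdot> \<I>) \<cdot> Assoc C (X \<boxdot> Y) \<I> \<I>"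
    by (simp add: Assoc_natural')
  also have "\<dots> = ((Idt C X \<boxtimes> (Idt C Y \<boxtimes> LUnit C \<I>)) \<cdot> (Idt C X \<boxtimes> Assoc C Y \<I> \<I>))
      \<cdot> Assoc C X (Y \<boxdot> \<I>) \<I> \<cdot> (?A \<boxtimes> Idt C \<I>)"
    unfolding pentagon by simp
  also have "\<dots> = (Idt C X \<boxtimes> (RUnit C Y \<boxtimes> Idt C \<I>)) \<cdot> Assoc C X (Y \<boxdot> \<I>) \<I> \<cdot> (?A \<boxtimes> Idt C \<I>)"
    unfolding triangle[symmetric] by (simp add: Tensor_Comp')
  also have "\<dots> = ?A \<cdot> (((Idt C X \<boxtimes> RUnit C Y) \<cdot> ?A) \<boxtimes> Idt C \<I>)"
    using Comp_reassoc[OF Assoc_natural'[of "Idt C X" X "RUnit C Y" Y "Idt C \<I>" \<I>], of "?A \<boxtimes> Idt C \<I>"]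
      Tensor_Comp'[of ?A "Idt C X \<boxtimes> RUnit C Y" "Idt C \<I>" "Idt C \<I>"]
    by simp
  finally show "((Idt C X \<boxtimes> RUnit C Y) \<cdot> ?A) \<boxtimes> Idt C \<I> = RUnit C (X \<boxdot> Y) \<boxtimes> Idt C \<I>"
    by - (rule iso_cancel_left[OF Assoc_iso[of X Y \<I>]]; simp)
qed simp_all

lemma LUnit_unit: "LUnit C \<I> = RUnit C \<I>"
proof (rule Tensor_unit_faithful)
  have "LUnit C \<I> \<cdot> LUnit C (\<I> \<boxdot> \<I>) = LUnit C \<I> \<cdot> (Idt C \<I> \<boxtimes> LUnit C \<I>)"
    using LUnit_natural[of "LUnit C \<I>" "\<I> \<boxdot> \<I>" \<I>] by simp
  then have "LUnit C (\<I> \<boxdot> \<I>) = Idt C \<I> \<boxtimes> LUnit C \<I>"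
    by (rule iso_cancel_left[OF LUnit_iso]) simp_all
  then show "LUnit C \<I> \<boxtimes> Idt C \<I> = RUnit C \<I> \<boxtimes> Idt C \<I>"
    using LUnit_Tensor[of \<I> \<I>] triangle[of \<I> \<I>] by simp
qed simp_all

subsection \<open>Strictification\<close>

text \<open>Tensor products of lists of objects are bracketed like the tensor powers of the statement: they
  are associated to the right and end with the unit object.\<close>
primrec lob :: "'a list \<Rightarrow> 'a" where
  "lob [] = \<I>"
| "lob (X # Xs) = X \<boxdot> lob Xs"

primrec join :: "'a list \<Rightarrow> 'a list \<Rightarrow> 'b" where
  "join [] Ys = LUnit C (lob Ys)"
| "join (X # Xs) Ys = (Idt C X \<boxtimes> join Xs Ys) \<cdot> Assoc C X (lob Xs) (lob Ys)"

lemma join_iso: "arr_iso C (join Xs Ys) (lob Xs \<boxdot> lob Ys) (lob (Xs @ Ys))"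
proof (induction Xs)
  case Nil
  then show ?case
    by (simp add: LUnit_iso)
next
  case (Cons X Xs)
  show ?case
    using arr_iso_Comp[OF Assoc_iso arr_iso_Tensor[OF arr_iso_Idt Cons]] by simp
qed

abbreviation "unjoin Xs Ys \<equiv> inv_arr C (join Xs Ys)"

lemmas join_dc [simp] = arr_iso_inv[OF join_iso]

text \<open>The coherence behind strict associativity of \<open>stens\<close>. For the empty list it
  is \<open>LUnit_Tensor\<close>; prepending an object is the pentagon.\<close>

lemma join_assoc:
  "join (Xs @ Ys) Zs \<cdot> (join Xs Ys \<boxtimes> Idt C (lob Zs))
  = join Xs (Ys @ Zs) \<cdot> (Idt C (lob Xs) \<boxtimes> join Ys Zs) \<cdot> Assoc C (lob Xs) (lob Ys) (lob Zs)"
proof (induction Xs)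
  case Nil
  have "LUnit C (lob (Ys @ Zs)) \<cdot> (Idt C \<I> \<boxtimes> join Ys Zs) = join Ys Zs \<cdot> LUnit C (lob Ys \<boxdot> lob Zs)"
    using LUnit_natural[of "join Ys Zs" "lob Ys \<boxdot> lob Zs" "lob (Ys @ Zs)"] by simp
  from Comp_reassoc[OF this, of "Assoc C \<I> (lob Ys) (lob Zs)"] show ?case
    by (simp add: LUnit_Tensor)
next
  case (Cons X Xs)
  let ?X = "lob Xs" and ?Y = "lob Ys" and ?Z = "lob Zs" and ?I = "Idt C X"
  have "join ((X # Xs) @ Ys) Zs \<cdot> (join (X # Xs) Ys \<boxtimes> Idt C ?Z)
    = (?I \<boxtimes> join (Xs @ Ys) Zs) \<cdot> (Assoc C X (lob (Xs @ Ys)) ?Z \<cdot> ((?I \<boxtimes> join Xs Ys) \<boxtimes> Idt C ?Z))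
        \<cdot> (Assoc C X ?X ?Y \<boxtimes> Idt C ?Z)"
    using Tensor_Comp'[of "Assoc C X ?X ?Y" "?I \<boxtimes> join Xs Ys" "Idt C ?Z" "Idt C ?Z"] by simp
  also have "\<dots> = ((?I \<boxtimes> join (Xs @ Ys) Zs) \<cdot> (?I \<boxtimes> (join Xs Ys \<boxtimes> Idt C ?Z)))
        \<cdot> Assoc C X (?X \<boxdot> ?Y) ?Z \<cdot> (Assoc C X ?X ?Y \<boxtimes> Idt C ?Z)"
    by (simp add: Assoc_natural')
  also have "(?I \<boxtimes> join (Xs @ Ys) Zs) \<cdot> (?I \<boxtimes> (join Xs Ys \<boxtimes> Idt C ?Z))
     = ?I \<boxtimes> (join Xs (Ys @ Zs) \<cdot> (Idt C ?X \<boxtimes> join Ys Zs) \<cdot> Assoc C ?X ?Y ?Z)"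
    using Cons by (simp add: Tensor_Comp')
  also have "\<dots> = (?I \<boxtimes> join Xs (Ys @ Zs)) \<cdot> (?I \<boxtimes> (Idt C ?X \<boxtimes> join Ys Zs)) \<cdot> (?I \<boxtimes> Assoc C ?X ?Y ?Z)"
    by (simp add: Tensor_Comp')
  also have "((?I \<boxtimes> join Xs (Ys @ Zs)) \<cdot> (?I \<boxtimes> (Idt C ?X \<boxtimes> join Ys Zs)) \<cdot> (?I \<boxtimes> Assoc C ?X ?Y ?Z))
      \<cdot> Assoc C X (?X \<boxdot> ?Y) ?Z \<cdot> (Assoc C X ?X ?Y \<boxtimes> Idt C ?Z)
    = (?I \<boxtimes> join Xs (Ys @ Zs)) \<cdot> ((?I \<boxtimes> (Idt C ?X \<boxtimes> join Ys Zs)) \<cdot> Assoc C X ?X (?Y \<boxdot> ?Z))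
      \<cdot> Assoc C (X \<boxdot> ?X) ?Y ?Z"
    using pentagon[of X ?X ?Y ?Z] by simp
  also have "(?I \<boxtimes> (Idt C ?X \<boxtimes> join Ys Zs)) \<cdot> Assoc C X ?X (?Y \<boxdot> ?Z)
    = Assoc C X ?X (lob (Ys @ Zs)) \<cdot> ((?I \<boxtimes> Idt C ?X) \<boxtimes> join Ys Zs)"
    by (simp add: Assoc_natural')
  finally show ?case
    by (simp add: Tensor_Idt)
qed

lemma join_nil: "join Xs [] = RUnit C (lob Xs)"
proof (induction Xs)
  case (Cons X Xs)
  then show ?case
    using RUnit_Tensor[of X "lob Xs"] by simp
qed (simp add: LUnit_unit)

text \<open>The middle component of an ill-typed composition is \<^term>\<open>None\<close>.\<close>
definition sdom :: "'a list \<times> 'b option \<times> 'a list \<Rightarrow> 'a list" where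
  "sdom = fst"

definition scod :: "'a list \<times> 'b option \<times> 'a list \<Rightarrow> 'a list" where
  "scod F = snd (snd F)"

definition und :: "'a list \<times> 'b option \<times> 'a list \<Rightarrow> 'b" where
  "und F = the (fst (snd F))"

definition sarr :: "'a list \<times> 'b option \<times> 'a list \<Rightarrow> bool" where
  "sarr F \<longleftrightarrow> fst (snd F) \<noteq> None \<and> Dom C (und F) = lob (sdom F) \<and> Cod C (und F) = lob (scod F)"

definition mk :: "'a list \<Rightarrow> 'a list \<Rightarrow> bool \<Rightarrow> 'b \<Rightarrow> 'a list \<times> 'b option \<times> 'a list" where
  "mk Xs Ys b f = (Xs, if b then Some f else None, Ys)"

lemma mk [simp]:
  "sdom (mk Xs Ys b f) = Xs" "scod (mk Xs Ys b f) = Ys" "b \<Longrightarrow> und (mk Xs Ys b f) = f"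
  "sarr (mk Xs Ys b f) \<longleftrightarrow> b \<and> Dom C f = lob Xs \<and> Cod C f = lob Ys"
  by (auto simp: mk_def sdom_def scod_def und_def sarr_def)

lemma mk_eqI: "\<lbrakk>Xs = Xs'; Ys = Ys'; b = b'; b \<Longrightarrow> f = f'\<rbrakk> \<Longrightarrow> mk Xs Ys b f = mk Xs' Ys' b' f'"
  by (auto simp: mk_def)

lemma sarrD [simp]: "sarr F \<Longrightarrow> Dom C (und F) = lob (sdom F)" "sarr F \<Longrightarrow> Cod C (und F) = lob (scod F)"
  by (simp_all add: sarr_def)

lemma mk_und: "sarr F \<Longrightarrow> mk (sdom F) (scod F) True (und F) = F"
  by (auto simp: sarr_def mk_def sdom_def scod_def und_def prod_eq_iff)

lemma sarr_eqI: "\<lbrakk>sarr F; sarr G; sdom F = sdom G; scod F = scod G; und F = und G\<rbrakk> \<Longrightarrow> F = G"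
  by (metis mk_und)

definition sidn :: "'a list \<Rightarrow> 'a list \<times> 'b option \<times> 'a list" where
  "sidn Xs = mk Xs Xs True (Idt C (lob Xs))"

definition scmp where
  "scmp G F = mk (sdom F) (scod G) (sarr F \<and> sarr G \<and> scod F = sdom G) (und G \<cdot> und F)"

definition stens where
  "stens F G = mk (sdom F @ sdom G) (scod F @ scod G) (sarr F \<and> sarr G)
     (join (scod F) (scod G) \<cdot> (und F \<boxtimes> und G) \<cdot> unjoin (sdom F) (sdom G))"

definition sswp :: "'a list \<Rightarrow> 'a list \<Rightarrow> 'a list \<times> 'b option \<times> 'a list" where
  "sswp Xs Ys = mk (Xs @ Ys) (Ys @ Xs) True (join Ys Xs \<cdot> Sym C (lob Xs) (lob Ys) \<cdot> unjoin Xs Ys)"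

definition splus where
  "splus F G = mk (sdom F) (scod F) (sarr F \<and> sarr G \<and> sdom F = sdom G \<and> scod F = scod G) (und F \<boxplus> und G)"

definition sscl where
  "sscl q F = mk (sdom F) (scod F) (sarr F) (ScaleArr C q (und F))"

lemma stens_join:
  "\<lbrakk>sarr F; sarr G; sdom F = Xs; sdom G = Ys\<rbrakk> \<Longrightarrow>
    und (stens F G) \<cdot> join Xs Ys = join (scod F) (scod G) \<cdot> (und F \<boxtimes> und G)"
  by (simp add: stens_def)

lemma sswp_join: "und (sswp Xs Ys) \<cdot> join Xs Ys = join Ys Xs \<cdot> Sym C (lob Xs) (lob Ys)"
  by (simp add: sswp_def)

lemma s_simps [simp]:
  "sdom (sidn Xs) = Xs" "scod (sidn Xs) = Xs" "sarr (sidn Xs)"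
  "sdom (scmp G F) = sdom F" "scod (scmp G F) = scod G" "sarr (scmp G F) \<longleftrightarrow> sarr F \<and> sarr G \<and> scod F = sdom G"
  "sdom (stens F G) = sdom F @ sdom G" "scod (stens F G) = scod F @ scod G" "sarr (stens F G) \<longleftrightarrow> sarr F \<and> sarr G"
  "sdom (sswp Xs Ys) = Xs @ Ys" "scod (sswp Xs Ys) = Ys @ Xs" "sarr (sswp Xs Ys)"
  "sdom (splus F G) = sdom F" "scod (splus F G) = scod F"
  "sarr (splus F G) \<longleftrightarrow> sarr F \<and> sarr G \<and> sdom F = sdom G \<and> scod F = scod G"
  "sdom (sscl q F) = sdom F" "scod (sscl q F) = scod F" "sarr (sscl q F) \<longleftrightarrow> sarr F"
  by (auto simp: sidn_def scmp_def stens_def sswp_def splus_def sscl_def)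

lemma und_simps [simp]:
  "und (sidn Xs) = Idt C (lob Xs)"
  "\<lbrakk>sarr F; sarr G; scod F = sdom G\<rbrakk> \<Longrightarrow> und (scmp G F) = und G \<cdot> und F"
  "\<lbrakk>sarr F; sarr G; sdom F = sdom G; scod F = scod G\<rbrakk> \<Longrightarrow> und (splus F G) = und F \<boxplus> und G"
  "sarr F \<Longrightarrow> und (sscl q F) = ScaleArr C q (und F)"
  by (simp_all add: sidn_def scmp_def splus_def sscl_def)

lemma und_stens:
  "\<lbrakk>sarr F; sarr G\<rbrakk> \<Longrightarrow> und (stens F G) = join (scod F) (scod G) \<cdot> (und F \<boxtimes> und G) \<cdot> unjoin (sdom F) (sdom G)"
  by (simp add: stens_def)

lemma join2_iso:
  "arr_iso C (join (Xs @ Ys) Zs \<cdot> (join Xs Ys \<boxtimes> Idt C (lob Zs))) ((lob Xs \<boxdot> lob Ys) \<boxdot> lob Zs) (lob (Xs @ Ys @ Zs))"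
  using arr_iso_Comp[OF arr_iso_Tensor[OF join_iso arr_iso_Idt] join_iso] by simp

lemma stens_eqI:
  assumes "sarr F" "sarr G" "sdom F = Xs @ Ys" "sdom G = Xs @ Ys" "scod F = scod G"
    and "und F \<cdot> join Xs Ys = und G \<cdot> join Xs Ys"
  shows "F = G"
  using assms iso_cancel_right[OF join_iso assms(6)] by (intro sarr_eqI) simp_all

text \<open>Both sides are compared after precomposition with the canonical isomorphism
  \<open>?J\<close> from the left-bracketed product. Naturality carries it to the codomain, and
  \<open>join_assoc\<close> relates the two bracketings.\<close>

lemma stens_assoc: "stens (stens F G) H = stens F (stens G H)"
proof (cases "sarr F \<and> sarr G \<and> sarr H")
  case True
  then have [simp]: "sarr F" "sarr G" "sarr H"
    by auto
  let ?X = "sdom F" and ?Y = "sdom G" and ?Z = "sdom H" and ?X' = "scod F" and ?Y' = "scod G" and ?Z' = "scod H"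
  let ?J = "join (?X @ ?Y) ?Z \<cdot> (join ?X ?Y \<boxtimes> Idt C (lob ?Z))"
  have "und (stens (stens F G) H) \<cdot> ?J = (und (stens (stens F G) H) \<cdot> join (?X @ ?Y) ?Z) \<cdot> (join ?X ?Y \<boxtimes> Idt C (lob ?Z))"
    by simp
  also have "\<dots> = join (?X' @ ?Y') ?Z' \<cdot> (und (stens F G) \<boxtimes> und H) \<cdot> (join ?X ?Y \<boxtimes> Idt C (lob ?Z))"
    by (simp add: stens_join)
  also have "(und (stens F G) \<boxtimes> und H) \<cdot> (join ?X ?Y \<boxtimes> Idt C (lob ?Z)) = (join ?X' ?Y' \<boxtimes> Idt C (lob ?Z')) \<cdot> ((und F \<boxtimes> und G) \<boxtimes> und H)"
    by (simp add: Tensor_Comp' stens_join)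
  also have "join (?X' @ ?Y') ?Z' \<cdot> (join ?X' ?Y' \<boxtimes> Idt C (lob ?Z')) \<cdot> ((und F \<boxtimes> und G) \<boxtimes> und H)
    = join ?X' (?Y' @ ?Z') \<cdot> (Idt C (lob ?X') \<boxtimes> join ?Y' ?Z') \<cdot> Assoc C (lob ?X') (lob ?Y') (lob ?Z') \<cdot> ((und F \<boxtimes> und G) \<boxtimes> und H)"
    using Comp_reassoc[OF join_assoc[of ?X' ?Y' ?Z'], of "(und F \<boxtimes> und G) \<boxtimes> und H"] by simp
  also have "\<dots> = join ?X' (?Y' @ ?Z') \<cdot> ((Idt C (lob ?X') \<boxtimes> join ?Y' ?Z') \<cdot> (und F \<boxtimes> (und G \<boxtimes> und H))) \<cdot> Assoc C (lob ?X) (lob ?Y) (lob ?Z)"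
    by (simp add: Assoc_natural')
  also have "(Idt C (lob ?X') \<boxtimes> join ?Y' ?Z') \<cdot> (und F \<boxtimes> (und G \<boxtimes> und H)) = (und F \<boxtimes> und (stens G H)) \<cdot> (Idt C (lob ?X) \<boxtimes> join ?Y ?Z)"
    by (simp add: Tensor_Comp' stens_join)
  also have "join ?X' (?Y' @ ?Z') \<cdot> ((und F \<boxtimes> und (stens G H)) \<cdot> (Idt C (lob ?X) \<boxtimes> join ?Y ?Z)) \<cdot> Assoc C (lob ?X) (lob ?Y) (lob ?Z)
    = (und (stens F (stens G H)) \<cdot> join ?X (?Y @ ?Z)) \<cdot> (Idt C (lob ?X) \<boxtimes> join ?Y ?Z) \<cdot> Assoc C (lob ?X) (lob ?Y) (lob ?Z)"
    by (simp add: stens_join)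
  also have "\<dots> = und (stens F (stens G H)) \<cdot> ?J"
    by (simp add: join_assoc)
  finally have "und (stens (stens F G) H) = und (stens F (stens G H))"
    by (rule iso_cancel_right[OF join2_iso]) simp_all
  then show ?thesis
    by (intro sarr_eqI) simp_all
qed (auto simp: stens_def intro!: mk_eqI)

text \<open>The hexagon conjugated by canonical isomorphisms; \<open>join_assoc\<close> enters once
  for each of the three orders of the lists that occur.\<close>

lemma sswp_append_right:
  "sswp Xs (Ys @ Zs) = scmp (stens (sidn Ys) (sswp Xs Zs)) (stens (sswp Xs Ys) (sidn Zs))"
proof -
  let ?X = "lob Xs" and ?Y = "lob Ys" and ?Z = "lob Zs"
  let ?J = "join (Xs @ Ys) Zs \<cdot> (join Xs Ys \<boxtimes> Idt C ?Z)"
  let ?T = "stens (sidn Ys) (sswp Xs Zs)" and ?S = "stens (sswp Xs Ys) (sidn Zs)"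
  have "und ?S \<cdot> ?J = (und ?S \<cdot> join (Xs @ Ys) Zs) \<cdot> (join Xs Ys \<boxtimes> Idt C ?Z)"
    by simp
  also have "\<dots> = join (Ys @ Xs) Zs \<cdot> ((und (sswp Xs Ys) \<cdot> join Xs Ys) \<boxtimes> Idt C ?Z)"
    by (simp add: stens_join Tensor_Comp')
  also have "\<dots> = (join (Ys @ Xs) Zs \<cdot> (join Ys Xs \<boxtimes> Idt C ?Z)) \<cdot> (Sym C ?X ?Y \<boxtimes> Idt C ?Z)"
    unfolding sswp_join by (simp add: Tensor_Comp')
  also have "\<dots> = join Ys (Xs @ Zs) \<cdot> (Idt C ?Y \<boxtimes> join Xs Zs) \<cdot> Assoc C ?Y ?X ?Z \<cdot> (Sym C ?X ?Y \<boxtimes> Idt C ?Z)"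
    unfolding join_assoc by simp
  finally have "und ?T \<cdot> und ?S \<cdot> ?J
    = (und ?T \<cdot> join Ys (Xs @ Zs)) \<cdot> (Idt C ?Y \<boxtimes> join Xs Zs) \<cdot> Assoc C ?Y ?X ?Z \<cdot> (Sym C ?X ?Y \<boxtimes> Idt C ?Z)"
    by simp
  also have "und ?T \<cdot> join Ys (Xs @ Zs) = join Ys (Zs @ Xs) \<cdot> (Idt C ?Y \<boxtimes> und (sswp Xs Zs))"
    using stens_join[of "sidn Ys" "sswp Xs Zs" Ys "Xs @ Zs"] by simp
  also have "(join Ys (Zs @ Xs) \<cdot> (Idt C ?Y \<boxtimes> und (sswp Xs Zs))) \<cdot> (Idt C ?Y \<boxtimes> join Xs Zs) \<cdot> Assoc C ?Y ?X ?Z \<cdot> (Sym C ?X ?Y \<boxtimes> Idt C ?Z)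
    = join Ys (Zs @ Xs) \<cdot> ((Idt C ?Y \<boxtimes> und (sswp Xs Zs)) \<cdot> (Idt C ?Y \<boxtimes> join Xs Zs)) \<cdot> Assoc C ?Y ?X ?Z \<cdot> (Sym C ?X ?Y \<boxtimes> Idt C ?Z)"
    by simp
  also have "(Idt C ?Y \<boxtimes> und (sswp Xs Zs)) \<cdot> (Idt C ?Y \<boxtimes> join Xs Zs) = (Idt C ?Y \<boxtimes> join Zs Xs) \<cdot> (Idt C ?Y \<boxtimes> Sym C ?X ?Z)"
    by (simp add: Tensor_Comp' sswp_join)
  also have "join Ys (Zs @ Xs) \<cdot> ((Idt C ?Y \<boxtimes> join Zs Xs) \<cdot> (Idt C ?Y \<boxtimes> Sym C ?X ?Z)) \<cdot> Assoc C ?Y ?X ?Z \<cdot> (Sym C ?X ?Y \<boxtimes> Idt C ?Z)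
    = join Ys (Zs @ Xs) \<cdot> (Idt C ?Y \<boxtimes> join Zs Xs) \<cdot> ((Idt C ?Y \<boxtimes> Sym C ?X ?Z) \<cdot> Assoc C ?Y ?X ?Z \<cdot> (Sym C ?X ?Y \<boxtimes> Idt C ?Z))"
    by simp
  also have "\<dots> = (join Ys (Zs @ Xs) \<cdot> (Idt C ?Y \<boxtimes> join Zs Xs) \<cdot> Assoc C ?Y ?Z ?X) \<cdot> Sym C ?X (?Y \<boxdot> ?Z) \<cdot> Assoc C ?X ?Y ?Z"
    unfolding hexagon[symmetric] by simp
  also have "\<dots> = join (Ys @ Zs) Xs \<cdot> ((join Ys Zs \<boxtimes> Idt C ?X) \<cdot> Sym C ?X (?Y \<boxdot> ?Z)) \<cdot> Assoc C ?X ?Y ?Z"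
    unfolding join_assoc[symmetric] by simp
  also have "(join Ys Zs \<boxtimes> Idt C ?X) \<cdot> Sym C ?X (?Y \<boxdot> ?Z) = Sym C ?X (lob (Ys @ Zs)) \<cdot> (Idt C ?X \<boxtimes> join Ys Zs)"
    using Sym_natural[of "Idt C ?X" ?X ?X "join Ys Zs" "?Y \<boxdot> ?Z" "lob (Ys @ Zs)"] by simp
  also have "join (Ys @ Zs) Xs \<cdot> (Sym C ?X (lob (Ys @ Zs)) \<cdot> (Idt C ?X \<boxtimes> join Ys Zs)) \<cdot> Assoc C ?X ?Y ?Z
    = (und (sswp Xs (Ys @ Zs)) \<cdot> join Xs (Ys @ Zs)) \<cdot> (Idt C ?X \<boxtimes> join Ys Zs) \<cdot> Assoc C ?X ?Y ?Z"
    unfolding sswp_join by simp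
  also have "\<dots> = und (sswp Xs (Ys @ Zs)) \<cdot> ?J"
    unfolding join_assoc by simp
  finally have "(und ?T \<cdot> und ?S) \<cdot> ?J = und (sswp Xs (Ys @ Zs)) \<cdot> ?J"
    by simp
  then have "und (scmp ?T ?S) = und (sswp Xs (Ys @ Zs))"
    by - (rule iso_cancel_right[OF join2_iso[of Xs Ys Zs]]; simp)
  then show ?thesis
    by (intro sarr_eqI) simp_all
qed

lemma stens_scmp:
  assumes "scod F = sdom G" "scod F' = sdom G'"
  shows "scmp (stens G G') (stens F F') = stens (scmp G F) (scmp G' F')"
  unfolding scmp_def[of "stens G G'"] stens_def[of "scmp G F"]
proof (rule mk_eqI)
  assume "sarr (stens F F') \<and> sarr (stens G G') \<and> scod (stens F F') = sdom (stens G G')"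
  then have [simp]: "sarr F" "sarr F'" "sarr G" "sarr G'"
    by simp_all
  show "und (stens G G') \<cdot> und (stens F F') = join (scod (scmp G F)) (scod (scmp G' F'))
    \<cdot> (und (scmp G F) \<boxtimes> und (scmp G' F')) \<cdot> unjoin (sdom (scmp G F)) (sdom (scmp G' F'))"
    using assms by (simp add: und_stens Comp_reassoc[of "unjoin _ _" "join _ _"] flip: Tensor_Comp')
qed (use assms in auto)

lemma sswp_natural: "scmp (sswp (scod F) (scod G)) (stens F G) = scmp (stens G F) (sswp (sdom F) (sdom G))"
proof (cases "sarr F \<and> sarr G")
  case True
  let ?X = "sdom F" and ?Y = "sdom G"
  have "(und (sswp (scod F) (scod G)) \<cdot> und (stens F G)) \<cdot> join ?X ?Y
    = (und (sswp (scod F) (scod G)) \<cdot> join (scod F) (scod G)) \<cdot> (und F \<boxtimes> und G)"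
    using True by (simp add: stens_join)
  also have "\<dots> = join (scod G) (scod F) \<cdot> (und G \<boxtimes> und F) \<cdot> Sym C (lob ?X) (lob ?Y)"
    using True Sym_natural[of "und F" "lob ?X" "lob (scod F)" "und G" "lob ?Y" "lob (scod G)"]
    by (simp add: sswp_join)
  also have "\<dots> = und (stens G F) \<cdot> und (sswp ?X ?Y) \<cdot> join ?X ?Y"
    unfolding sswp_join using True Comp_reassoc[OF stens_join[of G F ?Y ?X]] by simp
  finally show ?thesis
    using True by (intro stens_eqI[of _ _ ?X ?Y]) simp_all
qed (auto simp: scmp_def intro!: mk_eqI)

lemma sswp_sswp: "scmp (sswp Ys Xs) (sswp Xs Ys) = sidn (Xs @ Ys)"
proof (rule stens_eqI[of _ _ Xs Ys])
  have "(und (sswp Ys Xs) \<cdot> und (sswp Xs Ys)) \<cdot> join Xs Ys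
    = (und (sswp Ys Xs) \<cdot> join Ys Xs) \<cdot> Sym C (lob Xs) (lob Ys)"
    using sswp_join[of Xs Ys] by simp
  also have "\<dots> = join Xs Ys"
    unfolding sswp_join by (simp add: Sym_Sym)
  finally show "und (scmp (sswp Ys Xs) (sswp Xs Ys)) \<cdot> join Xs Ys = und (sidn (Xs @ Ys)) \<cdot> join Xs Ys"
    by simp
qed simp_all

lemma splus_stens:
  "stens (splus F G) H = splus (stens F H) (stens G H)"
  "stens H (splus F G) = splus (stens H F) (stens H G)"
proof -
  have 1: "und (stens (splus F G) H) = und (splus (stens F H) (stens G H))"
    "und (stens H (splus F G)) = und (splus (stens H F) (stens H G))"
    if [simp]: "sarr F" "sarr G" "sarr H" and [simp]: "sdom F = sdom G" "scod F = scod G"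
  proof -
    show "und (stens (splus F G) H) = und (splus (stens F H) (stens G H))"
      by (simp add: und_stens Tensor_add Comp_add)
    show "und (stens H (splus F G)) = und (splus (stens H F) (stens H G))"
      by (simp add: und_stens Tensor_add Comp_add)
  qed
  show "stens (splus F G) H = splus (stens F H) (stens G H)"
    by (cases "sarr F \<and> sarr G \<and> sarr H \<and> sdom F = sdom G \<and> scod F = scod G")
      (use 1(1) in \<open>auto simp: stens_def[of "splus F G"] splus_def[of "stens F H"] intro!: mk_eqI intro: sarr_eqI\<close>)
  show "stens H (splus F G) = splus (stens H F) (stens H G)"
    by (cases "sarr F \<and> sarr G \<and> sarr H \<and> sdom F = sdom G \<and> scod F = scod G")
      (use 1(2) in \<open>auto simp: stens_def[of H "splus F G"] splus_def[of "stens H F"] intro!: mk_eqI intro: sarr_eqI\<close>)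
qed

text \<open>The laws without typing conditions hold for ill-typed factors because both sides then
  have \<open>None\<close> in the middle and the same ends; \<open>mk_eqI\<close> separates this
  from the equation of arrows.\<close>

sublocale strict: strict_tensor_category sarr sdom scod sidn scmp stens sswp splus sscl
proof unfold_locales
  fix F G H F' G' and Xs Ys Zs :: "'a list" and p q :: rat
  show "scmp (scmp H G) F = scmp H (scmp G F)"
    unfolding scmp_def[of "scmp H G"] scmp_def[of H "scmp G F"] by (rule mk_eqI) auto
  show "sarr F \<Longrightarrow> scmp (sidn (scod F)) F = F" "sarr F \<Longrightarrow> scmp F (sidn (sdom F)) = F"
    by (auto intro: sarr_eqI)
  show "stens (stens F G) H = stens F (stens G H)"
    by (rule stens_assoc)
  show "stens (sidn Xs) (sidn Ys) = sidn (Xs @ Ys)"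
    by (rule sarr_eqI) (simp_all add: und_stens Tensor_Idt)
  show "sarr F \<Longrightarrow> stens (sidn []) F = F"
    using LUnit_natural[of "und F" "lob (sdom F)" "lob (scod F)"] stens_join[of "sidn []" F "[]" "sdom F"]
    by (intro stens_eqI[of _ _ "[]" "sdom F"]) simp_all
  show "sarr F \<Longrightarrow> stens F (sidn []) = F"
    using RUnit_natural[of "und F" "lob (sdom F)" "lob (scod F)"] stens_join[of F "sidn []" "sdom F" "[]"]
    by (intro stens_eqI[of _ _ "sdom F" "[]"]) (simp_all add: join_nil)
  show "scod F = sdom G \<Longrightarrow> scod F' = sdom G' \<Longrightarrow> scmp (stens G G') (stens F F') = stens (scmp G F) (scmp G' F')"
    by (rule stens_scmp)
  show "scmp (sswp (scod F) (scod G)) (stens F G) = scmp (stens G F) (sswp (sdom F) (sdom G))"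
    by (rule sswp_natural)
  show "scmp (sswp Ys Xs) (sswp Xs Ys) = sidn (Xs @ Ys)"
    by (rule sswp_sswp)
  show "sswp Xs (Ys @ Zs) = scmp (stens (sidn Ys) (sswp Xs Zs)) (stens (sswp Xs Ys) (sidn Zs))"
    by (rule sswp_append_right)
  show "sdom F = sdom G \<Longrightarrow> scod F = scod G \<Longrightarrow> splus F G = splus G F"
    unfolding splus_def by (rule mk_eqI) (auto intro: add_commute)
  show "splus (splus F G) H = splus F (splus G H)"
    unfolding splus_def[of "splus F G"] splus_def[of F "splus G H"] by (rule mk_eqI) (auto simp: add_assoc)
  show "sscl q (splus F G) = splus (sscl q F) (sscl q G)"
    unfolding sscl_def[of q "splus F G"] splus_def[of "sscl q F"] by (rule mk_eqI) (auto intro: scale_add_right)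
  show "sscl (p + q) F = splus (sscl p F) (sscl q F)"
    unfolding sscl_def[of "p + q"] splus_def by (rule mk_eqI) (auto simp: scale_simps)
  show "sscl p (sscl q F) = sscl (p * q) F"
    unfolding sscl_def[of p] sscl_def[of "p * q"] by (rule mk_eqI) (auto simp: scale_simps)
  show "sarr F \<Longrightarrow> sscl 1 F = F"
    by (rule sarr_eqI) (simp_all add: scale_simps)
  show "\<lbrakk>sarr F; sarr G; sdom F = sdom G; scod F = scod G\<rbrakk> \<Longrightarrow> splus F (sscl 0 G) = F"
    by (rule sarr_eqI) (simp_all add: add_scale_zero)
  show "scmp (splus F G) H = splus (scmp F H) (scmp G H)"
    unfolding scmp_def[of "splus F G"] splus_def[of "scmp F H"]
    by (rule mk_eqI) (auto simp: Comp_add)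
  show "scmp H (splus F G) = splus (scmp H F) (scmp H G)"
    unfolding scmp_def[of H "splus F G"] splus_def[of "scmp H F"]
    by (rule mk_eqI) (auto simp: Comp_add)
  show "scmp (sscl q F) H = sscl q (scmp F H)"
    unfolding scmp_def[of "sscl q F"] sscl_def[of q "scmp F H"]
    by (rule mk_eqI) (auto simp: Comp_scale)
  show "scmp H (sscl q F) = sscl q (scmp H F)"
    unfolding scmp_def[of H "sscl q F"] sscl_def[of q "scmp H F"]
    by (rule mk_eqI) (auto simp: Comp_scale)
  show "stens (splus F G) H = splus (stens F H) (stens G H)" "stens H (splus F G) = splus (stens H F) (stens H G)"
    by (rule splus_stens)+
  show "stens (sscl q F) H = sscl q (stens F H)"
    unfolding stens_def[of "sscl q F"] sscl_def[of q "stens F H"]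
    by (rule mk_eqI)
      (auto simp: und_stens Tensor_scale Comp_scale)
  show "stens H (sscl q F) = sscl q (stens H F)"
    unfolding stens_def[of H "sscl q F"] sscl_def[of q "stens H F"]
    by (rule mk_eqI)
      (auto simp: und_stens Tensor_scale Comp_scale)
qed auto

end

subsection \<open>Translation of arrows\<close>

text \<open>Trees record how an object is built from atoms and from objects of the form \<open>lob Xs\<close>.\<close>
datatype 'o tree = At 'o | Ob "'o list" | Tn "'o tree" "'o tree"

primrec fringe :: "'o tree \<Rightarrow> 'o list" where
  "fringe (At X) = [X]"
| "fringe (Ob Xs) = Xs"
| "fringe (Tn s t) = fringe s @ fringe t"

context rational_ACU_tensor_category
begin

notation scmp (infixr "\<bullet>" 70)
notation stens (infixr "\<star>" 80)
notation splus (infixl "\<uplus>" 65)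
notation sscl (infixr "\<rhd>" 75)
notation sidn ("\<iota>")
notation sswp ("\<tau>")

primrec tob :: "'a tree \<Rightarrow> 'a" where
  "tob (At X) = X"
| "tob (Ob Xs) = lob Xs"
| "tob (Tn s t) = tob s \<boxdot> tob t"

text \<open>The canonical isomorphism onto the normal bracketing. A single object \<open>X\<close>
  is normalized to \<open>X \<boxdot> \<I>\<close>, hence the inverse of the right unit
  constraint.\<close>

primrec flat :: "'a tree \<Rightarrow> 'b" where
  "flat (At X) = inv_arr C (RUnit C X)"
| "flat (Ob Xs) = Idt C (lob Xs)"
| "flat (Tn s t) = join (fringe s) (fringe t) \<cdot> (flat s \<boxtimes> flat t)"

lemma flat_iso: "arr_iso C (flat t) (tob t) (lob (fringe t))"
proof (induction t)
  case (At X)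
  then show ?case
    using arr_iso_inv_arr[OF RUnit_iso] by simp
next
  case (Ob Xs)
  then show ?case
    by (simp add: arr_iso_Idt)
next
  case (Tn s t)
  then show ?case
    using arr_iso_Comp[OF arr_iso_Tensor[OF Tn] join_iso] by simp
qed

lemmas flat_dc [simp] = arr_iso_inv[OF flat_iso]

text \<open>Conjugation by the canonical isomorphisms. The trees have to be supplied because an
  object does not determine how it is bracketed or where its atoms are.\<close>

definition str :: "'a tree \<Rightarrow> 'a tree \<Rightarrow> 'b \<Rightarrow> 'a list \<times> 'b option \<times> 'a list" where
  "str s t f = mk (fringe s) (fringe t) True (flat t \<cdot> f \<cdot> inv_arr C (flat s))"

lemma str [simp]:
  "sdom (str s t f) = fringe s" "scod (str s t f) = fringe t"
  "\<lbrakk>Dom C f = tob s; Cod C f = tob t\<rbrakk> \<Longrightarrow> sarr (str s t f)"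
  by (simp_all add: str_def)

lemma und_str: "\<lbrakk>Dom C f = tob s; Cod C f = tob t\<rbrakk> \<Longrightarrow> und (str s t f) \<cdot> flat s = flat t \<cdot> f"
  by (simp add: str_def)

lemma str_eqI:
  assumes "sarr F" "sdom F = fringe s" "scod F = fringe t" "Dom C f = tob s" "Cod C f = tob t"
    "flat t \<cdot> f = und F \<cdot> flat s"
  shows "str s t f = F"
proof (rule sarr_eqI)
  show "und (str s t f) = und F"
    using assms by - (rule iso_cancel_right[OF flat_iso[of s]]; simp add: und_str)
qed (use assms in simp_all)

lemma str_inj:
  assumes "str s t f = str s t g" "Dom C f = tob s" "Cod C f = tob t" "Dom C g = tob s" "Cod C g = tob t"
  shows "f = g"
proof (rule iso_cancel_left[OF flat_iso[of t]])
  show "flat t \<cdot> f = flat t \<cdot> g"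
    using assms by (simp flip: und_str)
qed (use assms in simp_all)

lemma str_surj:
  assumes "sarr F" "sdom F = fringe s" "scod F = fringe t"
  obtains f where "Dom C f = tob s" "Cod C f = tob t" "str s t f = F"
proof
  let ?f = "inv_arr C (flat t) \<cdot> und F \<cdot> flat s"
  show "Dom C ?f = tob s" "Cod C ?f = tob t"
    using assms by simp_all
  show "str s t ?f = F"
    using assms by (intro str_eqI) (simp_all add: Comp_reassoc[of "flat t" "inv_arr C (flat t)"])
qed

lemma str_Comp:
  assumes "Dom C f = tob s" "Cod C f = tob t" "Dom C g = tob t" "Cod C g = tob u"
  shows "str s u (g \<cdot> f) = str t u g \<bullet> str s t f"
  using assms Comp_reassoc[OF und_str[of g t u], of f] by (intro str_eqI) (simp_all add: und_str)

lemma str_Tensor: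
  assumes "Dom C f = tob s" "Cod C f = tob t" "Dom C g = tob s'" "Cod C g = tob t'"
  shows "str (Tn s s') (Tn t t') (f \<boxtimes> g) = str s t f \<star> str s' t' g"
proof (rule str_eqI)
  have "und (str s t f \<star> str s' t' g) \<cdot> flat (Tn s s')
    = (und (str s t f \<star> str s' t' g) \<cdot> join (fringe s) (fringe s')) \<cdot> (flat s \<boxtimes> flat s')"
    using assms by simp
  also have "\<dots> = join (fringe t) (fringe t') \<cdot> ((und (str s t f) \<cdot> flat s) \<boxtimes> (und (str s' t' g) \<cdot> flat s'))"
    using assms by (subst stens_join) (simp_all add: Tensor_Comp')
  also have "\<dots> = flat (Tn t t') \<cdot> (f \<boxtimes> g)"
    using assms by (simp add: und_str Tensor_Comp')
  finally show "flat (Tn t t') \<cdot> (f \<boxtimes> g) = und (str s t f \<star> str s' t' g) \<cdot> flat (Tn s s')" ..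
qed (use assms in simp_all)

text \<open>The form in which coherence is used: the associativity and unit constraints translate to
  identities.\<close>

lemma str_idn:
  "\<lbrakk>Dom C f = tob s; Cod C f = tob t; fringe s = fringe t; flat t \<cdot> f = flat s\<rbrakk> \<Longrightarrow> str s t f = \<iota> (fringe s)"
  by (rule str_eqI) simp_all

lemma str_Idt: "tob t = X \<Longrightarrow> str t t (Idt C X) = \<iota> (fringe t)"
  by (rule str_idn) simp_all

lemma str_inv:
  assumes "arr_iso C f (tob s) (tob t)"
  shows "strict.inverse_arrs (str s t f) (str t s (inv_arr C f))"
  using assms by (simp add: strict.inverse_arrs_def arr_iso_inv str_Idt flip: str_Comp)

lemma str_inv_idn:
  assumes "arr_iso C f (tob s) (tob t)" "str s t f = \<iota> (fringe s)" "fringe s = fringe t"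
  shows "str t s (inv_arr C f) = \<iota> (fringe s)"
  using str_inv[OF assms(1)] assms(2,3) arr_iso_inv[OF assms(1)] by (simp add: strict.inverse_arrs_def)

lemma str_Assoc: "str (Tn (Tn s t) u) (Tn s (Tn t u)) (Assoc C (tob s) (tob t) (tob u)) = \<iota> (fringe s @ fringe t @ fringe u)"
proof -
  let ?s = "lob (fringe s)" and ?t = "lob (fringe t)" and ?u = "lob (fringe u)"
  have "flat (Tn s (Tn t u)) = join (fringe s) (fringe t @ fringe u) \<cdot> (Idt C ?s \<boxtimes> join (fringe t) (fringe u)) \<cdot> (flat s \<boxtimes> (flat t \<boxtimes> flat u))"
    by (simp add: Tensor_Comp')
  then have "flat (Tn s (Tn t u)) \<cdot> Assoc C (tob s) (tob t) (tob u)
    = (join (fringe s) (fringe t @ fringe u) \<cdot> (Idt C ?s \<boxtimes> join (fringe t) (fringe u)) \<cdot> Assoc C ?s ?t ?u) \<cdot> ((flat s \<boxtimes> flat t) \<boxtimes> flat u)"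
    by (simp add: Assoc_natural')
  also have "\<dots> = flat (Tn (Tn s t) u)"
    unfolding join_assoc[symmetric] by (simp add: Tensor_Comp')
  finally show ?thesis
    by (subst str_idn) simp_all
qed

lemma str_LUnit: "str (Tn (Ob []) t) t (LUnit C (tob t)) = \<iota> (fringe t)"
  using LUnit_natural[of "flat t" "tob t" "lob (fringe t)"] by (subst str_idn) simp_all

lemma str_RUnit: "str (Tn t (Ob [])) t (RUnit C (tob t)) = \<iota> (fringe t)"
  using RUnit_natural[of "flat t" "tob t" "lob (fringe t)"] by (subst str_idn) (simp_all add: join_nil)

lemma str_Sym: "str (Tn s t) (Tn t s) (Sym C (tob s) (tob t)) = \<tau> (fringe s) (fringe t)"
proof (rule str_eqI)
  have "und (\<tau> (fringe s) (fringe t)) \<cdot> flat (Tn s t) = (und (\<tau> (fringe s) (fringe t)) \<cdot> join (fringe s) (fringe t)) \<cdot> (flat s \<boxtimes> flat t)"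
    by simp
  also have "\<dots> = join (fringe t) (fringe s) \<cdot> Sym C (lob (fringe s)) (lob (fringe t)) \<cdot> (flat s \<boxtimes> flat t)"
    unfolding sswp_join by simp
  also have "\<dots> = flat (Tn t s) \<cdot> Sym C (tob s) (tob t)"
    using Sym_natural[of "flat s" "tob s" "lob (fringe s)" "flat t" "tob t" "lob (fringe t)"] by simp
  finally show "flat (Tn t s) \<cdot> Sym C (tob s) (tob t) = und (\<tau> (fringe s) (fringe t)) \<cdot> flat (Tn s t)" ..
qed simp_all

lemma str_add:
  "\<lbrakk>Dom C f = tob s; Cod C f = tob t; Dom C g = tob s; Cod C g = tob t\<rbrakk> \<Longrightarrow> str s t (f \<boxplus> g) = str s t f \<uplus> str s t g"
  by (rule str_eqI) (simp_all add: Comp_add und_str)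

lemma str_scale:
  "\<lbrakk>Dom C f = tob s; Cod C f = tob t\<rbrakk> \<Longrightarrow> str s t (ScaleArr C q f) = q \<rhd> str s t f"
  by (rule str_eqI) (simp_all add: Comp_scale und_str)

text \<open>By the triangle axiom, reading \<open>lob (X # Xs)\<close> as one block or as
  \<open>X\<close> followed by a block gives the same translation. This lets the recursions of
  \<open>adj_swap\<close> and \<open>ev_pow\<close> be followed one factor at a time.\<close>

lemma flat_Cons: "flat (Tn (At X) (Ob Xs)) = Idt C (lob (X # Xs))"
proof -
  have "flat (Tn (At X) (Ob Xs)) = (Idt C X \<boxtimes> LUnit C (lob Xs)) \<cdot> Assoc C X \<I> (lob Xs) \<cdot> (inv_arr C (RUnit C X) \<boxtimes> Idt C (lob Xs))"
    using arr_iso_inv[OF RUnit_iso[of X]] by simp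
  also have "\<dots> = (RUnit C X \<boxtimes> Idt C (lob Xs)) \<cdot> (inv_arr C (RUnit C X) \<boxtimes> Idt C (lob Xs))"
    using arr_iso_inv[OF RUnit_iso[of X]] by (intro Comp_reassoc triangle) simp_all
  also have "\<dots> = Idt C (lob (X # Xs))"
    using arr_iso_inv[OF RUnit_iso[of X]] by (simp add: Tensor_Comp' Tensor_Idt)
  finally show ?thesis .
qed

lemma flat_Cons_Cons: "flat (Tn (At X) (Tn (At Y) (Ob Xs))) = Idt C (lob (X # Y # Xs))"
  using flat_Cons[of X "Y # Xs"] flat_Cons[of Y Xs] by simp

lemma str_cong:
  "\<lbrakk>flat s = flat s'; flat t = flat t'; fringe s = fringe s'; fringe t = fringe t'\<rbrakk> \<Longrightarrow> str s t f = str s' t' f"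
  by (simp add: str_def)

lemma inv_dc [simp]:
  "Dom C (inv_arr C (Assoc C X Y Z)) = X \<boxdot> (Y \<boxdot> Z)" "Cod C (inv_arr C (Assoc C X Y Z)) = (X \<boxdot> Y) \<boxdot> Z"
  using arr_iso_inv[OF Assoc_iso] by simp_all

lemma str_inv_Assoc:
  "str (Tn s (Tn t u)) (Tn (Tn s t) u) (inv_arr C (Assoc C (tob s) (tob t) (tob u))) = \<iota> (fringe s @ fringe t @ fringe u)"
  using str_inv_idn[of _ "Tn (Tn s t) u" "Tn s (Tn t u)"] Assoc_iso str_Assoc by simp

lemma middle_swap_dc [simp]:
  "Dom C (middle_swap C W X Y Z) = (W \<boxdot> X) \<boxdot> (Y \<boxdot> Z)" "Cod C (middle_swap C W X Y Z) = (W \<boxdot> Y) \<boxdot> (X \<boxdot> Z)"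
  by (simp_all add: middle_swap_def)

lemma str_middle_swap:
  "str (Tn (Tn s t) (Tn u w)) (Tn (Tn s u) (Tn t w)) (middle_swap C (tob s) (tob t) (tob u) (tob w))
   = \<iota> (fringe s) \<star> \<tau> (fringe t) (fringe u) \<star> \<iota> (fringe w)"
proof -
  let ?A = "Tn (Tn s t) (Tn u w)" and ?B = "Tn s (Tn t (Tn u w))" and ?B1 = "Tn s (Tn (Tn t u) w)"
    and ?B2 = "Tn s (Tn (Tn u t) w)" and ?C = "Tn s (Tn u (Tn t w))"
  let ?m1 = "inv_arr C (Assoc C (tob t) (tob u) (tob w))" and ?m2 = "Sym C (tob t) (tob u) \<boxtimes> Idt C (tob w)"
    and ?m3 = "Assoc C (tob u) (tob t) (tob w)"
  have "str (Tn t (Tn u w)) (Tn u (Tn t w)) (?m3 \<cdot> ?m2 \<cdot> ?m1)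
    = str (Tn (Tn u t) w) (Tn u (Tn t w)) ?m3 \<bullet> str (Tn (Tn t u) w) (Tn (Tn u t) w) ?m2 \<bullet> str (Tn t (Tn u w)) (Tn (Tn t u) w) ?m1"
    by (simp add: str_Comp[where t = "Tn (Tn u t) w"] str_Comp[where t = "Tn (Tn t u) w"])
  also have "\<dots> = \<tau> (fringe t) (fringe u) \<star> \<iota> (fringe w)"
    by (simp add: str_Assoc str_inv_Assoc str_Tensor str_Sym str_Idt)
  finally have m: "str (Tn t (Tn u w)) (Tn u (Tn t w)) (?m3 \<cdot> ?m2 \<cdot> ?m1) = \<tau> (fringe t) (fringe u) \<star> \<iota> (fringe w)" .
  have "str ?A (Tn (Tn s u) (Tn t w)) (middle_swap C (tob s) (tob t) (tob u) (tob w))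
    = str ?C (Tn (Tn s u) (Tn t w)) (inv_arr C (Assoc C (tob s) (tob u) (tob t \<boxdot> tob w)))
      \<bullet> str ?B ?C (Idt C (tob s) \<boxtimes> (?m3 \<cdot> ?m2 \<cdot> ?m1)) \<bullet> str ?A ?B (Assoc C (tob s) (tob t) (tob u \<boxdot> tob w))"
    unfolding middle_swap_def by (simp add: str_Comp[where t = ?C] str_Comp[where t = ?B])
  also have "\<dots> = \<iota> (fringe s) \<star> \<tau> (fringe t) (fringe u) \<star> \<iota> (fringe w)"
    using str_Assoc[of s t "Tn u w"] str_inv_Assoc[of s u "Tn t w"]
    by (simp add: str_Tensor m str_Idt)
  finally show ?thesis .
qed

subsection \<open>Internal homs and universal arrows\<close>

lemma Ev_dc [simp]: "Dom C (Ev C X Y) = IHom C X Y \<boxdot> X" "Cod C (Ev C X Y) = Y"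
  using Ev_in_Hom[of X Y] by simp_all

lemma adjunct:
  assumes "Dom C f = T \<boxdot> X" "Cod C f = Y"
  shows "Dom C (adjunct C T X Y f) = T" "Cod C (adjunct C T X Y f) = IHom C X Y"
    "Ev C X Y \<cdot> (adjunct C T X Y f \<boxtimes> Idt C X) = f"
    "\<lbrakk>Dom C h = T; Cod C h = IHom C X Y; Ev C X Y \<cdot> (h \<boxtimes> Idt C X) = f\<rbrakk> \<Longrightarrow> adjunct C T X Y f = h"
proof -
  have ex1: "\<exists>!h. h \<in> Hom C T (IHom C X Y) \<and> Ev C X Y \<cdot> (h \<boxtimes> Idt C X) = f"
    using assms by (intro Ev_universal) simp
  from theI'[OF ex1] show "Dom C (adjunct C T X Y f) = T" "Cod C (adjunct C T X Y f) = IHom C X Y"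
    "Ev C X Y \<cdot> (adjunct C T X Y f \<boxtimes> Idt C X) = f"
    unfolding adjunct_def by simp_all
  show "\<lbrakk>Dom C h = T; Cod C h = IHom C X Y; Ev C X Y \<cdot> (h \<boxtimes> Idt C X) = f\<rbrakk> \<Longrightarrow> adjunct C T X Y f = h"
    unfolding adjunct_def using ex1 by (intro the1_equality) simp_all
qed

lemma Ev_inj:
  assumes "Dom C h = Dom C k" "Cod C h = IHom C X Y" "Cod C k = IHom C X Y"
    "Ev C X Y \<cdot> (h \<boxtimes> Idt C X) = Ev C X Y \<cdot> (k \<boxtimes> Idt C X)"
  shows "h = k"
proof -
  let ?a = "adjunct C (Dom C k) X Y (Ev C X Y \<cdot> (k \<boxtimes> Idt C X))"
  have "?a = h"
    by (rule adjunct(4)) (simp_all only: assms Tensor_dc Idt_dc Ev_dc Comp_dc)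
  moreover have "?a = k"
    by (rule adjunct(4)) (simp_all add: assms)
  ultimately show ?thesis
    by simp
qed

text \<open>With its converse below, the bridge from adjuncts to strict universal pairings. The
  factorization of an arrow is the inverse of the adjunct of \<open>f\<close> composed with the
  adjunct of that arrow.\<close>

lemma adjunct_iso_imp_universal:
  assumes f: "Dom C f = tob t \<boxdot> tob x" "Cod C f = tob y"
    and iso: "arr_iso C (adjunct C (tob t) (tob x) (tob y) f) (tob t) (IHom C (tob x) (tob y))"
  shows "strict.universal (str (Tn t x) y f) (fringe t) (fringe x) (fringe y)"
  unfolding strict.universal_def
proof (intro conjI allI impI)
  let ?h = "adjunct C (tob t) (tob x) (tob y) f" and ?Ev = "Ev C (tob x) (tob y)"
  note h = adjunct(1-3)[OF f] and inv = arr_iso_inv[OF iso]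
  fix S A assume A: "sarr A \<and> sdom A = S @ fringe x \<and> scod A = fringe y"
  then obtain a where a: "Dom C a = lob S \<boxdot> tob x" "Cod C a = tob y" "str (Tn (Ob S) x) y a = A"
    using str_surj[of A "Tn (Ob S) x" y] by auto
  note k = adjunct(1-3)[OF a(1,2)]
  let ?u = "inv_arr C ?h \<cdot> adjunct C (lob S) (tob x) (tob y) a"
  have u: "Dom C ?u = lob S" "Cod C ?u = tob t"
    using inv k by simp_all
  have eq: "f \<cdot> (w \<boxtimes> Idt C (tob x)) = ?Ev \<cdot> ((?h \<cdot> w) \<boxtimes> Idt C (tob x))" if "Dom C w = lob S" "Cod C w = tob t" for w
    using that h Comp_reassoc[OF h(3), of "w \<boxtimes> Idt C (tob x)"] by (simp add: Tensor_Comp')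
  have "?h \<cdot> ?u = adjunct C (lob S) (tob x) (tob y) a"
    using Comp_reassoc[OF inv(6)] inv k by simp
  then have fu: "f \<cdot> (?u \<boxtimes> Idt C (tob x)) = a"
    using eq[OF u] k by simp
  have str_f: "str (Tn t x) y f \<bullet> (str (Ob S) t w \<star> \<iota> (fringe x)) = str (Tn (Ob S) x) y (f \<cdot> (w \<boxtimes> Idt C (tob x)))"
    if "Dom C w = lob S" "Cod C w = tob t" for w
    using that f by (simp add: str_Comp[where t = "Tn t x"] str_Tensor str_Idt)
  show "\<exists>!u. sarr u \<and> sdom u = S \<and> scod u = fringe t \<and> str (Tn t x) y f \<bullet> (u \<star> \<iota> (fringe x)) = A"
  proof (rule ex1I[of _ "str (Ob S) t ?u"])
    show "sarr (str (Ob S) t ?u) \<and> sdom (str (Ob S) t ?u) = S \<and> scod (str (Ob S) t ?u) = fringe t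
      \<and> str (Tn t x) y f \<bullet> (str (Ob S) t ?u \<star> \<iota> (fringe x)) = A"
      using u fu a str_f[OF u] by (simp del: Comp_assoc')
    fix w assume w: "sarr w \<and> sdom w = S \<and> scod w = fringe t \<and> str (Tn t x) y f \<bullet> (w \<star> \<iota> (fringe x)) = A"
    then obtain w' where w': "Dom C w' = lob S" "Cod C w' = tob t" "str (Ob S) t w' = w"
      using str_surj[of w "Ob S" t] by auto
    have "f \<cdot> (w' \<boxtimes> Idt C (tob x)) = a"
      using w w' a f str_f[OF w'(1,2)] by - (rule str_inj[of "Tn (Ob S) x" y]; simp)
    then have "?h \<cdot> w' = adjunct C (lob S) (tob x) (tob y) a"
      using w' a h k eq[OF w'(1,2)] by - (rule adjunct(4)[symmetric]; simp)
    then have "?u = inv_arr C ?h \<cdot> ?h \<cdot> w'"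
      by simp
    also have "\<dots> = w'"
      using Comp_reassoc[OF inv(5)] inv w' by simp
    finally show "w = str (Ob S) t ?u"
      using w' by simp
  qed
qed (use f in simp_all)

text \<open>\<open>f\<close> and the evaluation are then both universal, so the factorization
  \<open>u\<close> of the evaluation through \<open>f\<close> is inverse to the adjunct.\<close>

lemma universal_imp_adjunct_iso:
  assumes f: "Dom C f = tob t \<boxdot> tob x" "Cod C f = tob y"
    and univ: "strict.universal (str (Tn t x) y f) (fringe t) (fringe x) (fringe y)"
  shows "arr_iso C (adjunct C (tob t) (tob x) (tob y) f) (tob t) (IHom C (tob x) (tob y))"
proof -
  let ?H = "IHom C (tob x) (tob y)" and ?Ev = "Ev C (tob x) (tob y)" and ?I = "Idt C (tob x)"
  let ?h = "adjunct C (tob t) (tob x) (tob y) f"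
  note h = adjunct(1-3)[OF f]
  have str_f: "str (Tn t x) y f \<bullet> (str s t w \<star> \<iota> (fringe x)) = str (Tn s x) y (f \<cdot> (w \<boxtimes> ?I))"
    if "Dom C w = tob s" "Cod C w = tob t" for w s
    using that f by (simp add: str_Comp[where t = "Tn t x"] str_Tensor str_Idt)
  have f_inj: "w = w'" if "Dom C w = tob s" "Cod C w = tob t" "Dom C w' = tob s" "Cod C w' = tob t"
    "f \<cdot> (w \<boxtimes> ?I) = f \<cdot> (w' \<boxtimes> ?I)" for w w' s
  proof (rule str_inj[of s t])
    show "str s t w = str s t w'"
      using that str_f[of w s] str_f[of w' s] by - (rule strict.universalD(5)[OF univ]; simp)
  qed (use that in simp_all)
  obtain U where U: "sarr U" "sdom U = [?H]" "scod U = fringe t"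
    "str (Tn t x) y f \<bullet> (U \<star> \<iota> (fringe x)) = str (Tn (At ?H) x) y ?Ev"
    using strict.universalD(4)[OF univ, of "str (Tn (At ?H) x) y ?Ev" "[?H]"] by auto
  obtain u where u: "Dom C u = ?H" "Cod C u = tob t" "str (At ?H) t u = U"
    using str_surj[of U "At ?H" t] U by auto
  have fu: "f \<cdot> (u \<boxtimes> ?I) = ?Ev"
    using U u f str_f[of u "At ?H"] by - (rule str_inj[of "Tn (At ?H) x" y]; simp)
  have "?Ev \<cdot> ((?h \<cdot> u) \<boxtimes> ?I) = ?Ev \<cdot> (Idt C ?H \<boxtimes> ?I)"
    using fu h u Comp_reassoc[OF h(3), of "u \<boxtimes> ?I"] by (simp add: Tensor_Comp' Tensor_Idt)
  then have 1: "?h \<cdot> u = Idt C ?H"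
    using h u by - (rule Ev_inj[of "?h \<cdot> u" "Idt C ?H" "tob x" "tob y"]; simp)
  have "f \<cdot> ((u \<cdot> ?h) \<boxtimes> ?I) = f \<cdot> (Idt C (tob t) \<boxtimes> ?I)"
    using h u f Comp_reassoc[OF fu, of "?h \<boxtimes> ?I"] by (simp add: Tensor_Comp' Tensor_Idt)
  then have 2: "u \<cdot> ?h = Idt C (tob t)"
    using h u by - (rule f_inj[of _ t]; simp)
  show ?thesis
    using 1 2 h u by (intro arr_isoI[of _ _ _ u]) simp_all
qed

subsection \<open>Duals in rigid categories\<close>

abbreviation evs :: "'a \<Rightarrow> 'a list \<times> 'b option \<times> 'a list" where
  "evs V \<equiv> str (Tn (At (dual C V)) (At V)) (Ob []) (ev C V)"

abbreviation coevs :: "'a \<Rightarrow> 'a list \<times> 'b option \<times> 'a list" where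
  "coevs V \<equiv> str (Ob []) (Tn (At V) (At (dual C V))) (coev C V)"

lemma ev_dc [simp]: "Dom C (ev C V) = dual C V \<boxdot> V" "Cod C (ev C V) = \<I>"
  by (simp_all add: ev_def dual_def)

lemma universal_ev: "strict.universal (evs V) [dual C V] [V] []"
proof -
  have "adjunct C (dual C V) V \<I> (ev C V) = Idt C (dual C V)"
    by (rule adjunct(4)) (simp_all add: dual_def ev_def Tensor_Idt)
  then show ?thesis
    using adjunct_iso_imp_universal[of "ev C V" "At (dual C V)" "At V" "Ob []"] arr_iso_Idt[of "dual C V"]
    by (simp add: dual_def)
qed

text \<open>Rigidity for the pairs (unit, \<open>Y\<close>) and (\<open>X\<close>, unit) says that
  hom(unit, \<open>Y\<close>) tensored with the dual of \<open>X\<close> is an internal hom from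
  \<open>X\<close> to \<open>Y\<close>, up to units. It remains to replace hom(unit,
  \<open>Y\<close>) by \<open>Y\<close>.\<close>

lemma universal_evaluation:
  assumes "rigid C"
  shows "strict.universal (\<iota> [Y] \<star> evs X) [Y, dual C X] [X] [Y]"
proof -
  let ?H = "IHom C \<I> Y" and ?D = "dual C X"
  let ?m = "(Ev C \<I> Y \<boxtimes> Ev C X \<I>) \<cdot> middle_swap C ?H ?D \<I> X"
  let ?\<theta> = "str (Tn (At ?H) (Ob [])) (At Y) (Ev C \<I> Y)"
  have ev: "Ev C X \<I> = ev C X" "IHom C X \<I> = ?D"
    by (simp_all add: ev_def dual_def)
  have "arr_iso C (adjunct C (tob (Tn (At ?H) (At ?D))) (tob (Tn (Ob []) (At X))) (tob (Tn (At Y) (Ob []))) ?m)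
     (tob (Tn (At ?H) (At ?D))) (IHom C (tob (Tn (Ob []) (At X))) (tob (Tn (At Y) (Ob []))))"
    using assms[unfolded rigid_def, THEN conjunct1, rule_format, of \<I> Y X \<I>] by (simp add: IHom_tensor_def ev)
  then have "strict.universal (str (Tn (Tn (At ?H) (At ?D)) (Tn (Ob []) (At X))) (Tn (At Y) (Ob [])) ?m)
      (fringe (Tn (At ?H) (At ?D))) (fringe (Tn (Ob []) (At X))) (fringe (Tn (At Y) (Ob [])))"
    by (intro adjunct_iso_imp_universal) (simp_all add: ev)
  moreover have "str (Tn (Tn (At ?H) (At ?D)) (Tn (Ob []) (At X))) (Tn (At Y) (Ob [])) ?m = ?\<theta> \<star> evs X"
    using str_middle_swap[of "At ?H" "At ?D" "Ob []" "At X"]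
    by (simp add: ev str_Comp[where t = "Tn (Tn (At ?H) (Ob [])) (Tn (At ?D) (At X))"] str_Tensor strict.idn_tens_idn)
  ultimately have univ: "strict.universal (?\<theta> \<star> evs X) [?H, ?D] [X] [Y]"
    by simp
  \<comment> \<open>The canonical arrow from \<open>Y\<close> to hom(unit, \<open>Y\<close>). It is
    an isomorphism because the right unit constraint is universal, being an identity in the strict
    category.\<close>
  let ?h = "adjunct C Y \<I> Y (RUnit C Y)"
  have "strict.universal (\<iota> [Y]) [Y] [] [Y]"
    by (auto simp: strict.universal_def)
  then have h_iso: "arr_iso C ?h Y ?H"
    using universal_imp_adjunct_iso[of "RUnit C Y" "At Y" "Ob []" "At Y"] str_RUnit[of "At Y"] by simp
  note h = adjunct(1-3)[of "RUnit C Y" Y \<I> Y, simplified]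
  have hs: "strict.inverse_arrs (str (At Y) (At ?H) ?h) (str (At ?H) (At Y) (inv_arr C ?h))"
    using str_inv[of ?h "At Y" "At ?H"] h_iso by simp
  have "?\<theta> \<bullet> str (At Y) (At ?H) ?h = str (Tn (At Y) (Ob [])) (At Y) (Ev C \<I> Y \<cdot> (?h \<boxtimes> Idt C \<I>))"
    using h(1,2) by (simp add: str_Comp[where t = "Tn (At ?H) (Ob [])"] str_Tensor str_Idt)
  also have "\<dots> = \<iota> [Y]"
    using h str_RUnit[of "At Y"] by simp
  finally have \<theta>: "?\<theta> \<bullet> str (At Y) (At ?H) ?h = \<iota> [Y]" .
  have "strict.inverse_arrs (str (At Y) (At ?H) ?h \<star> \<iota> [?D]) (str (At ?H) (At Y) (inv_arr C ?h) \<star> \<iota> [?D])"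
    using hs by (simp add: strict.inverse_arrs_def strict.interchange strict.idn_tens_idn)
  from strict.universal_precomp[OF univ this]
  have "strict.universal ((?\<theta> \<star> evs X) \<bullet> ((str (At Y) (At ?H) ?h \<star> \<iota> [?D]) \<star> \<iota> [X])) [Y, ?D] [X] [Y]"
    by simp
  moreover have "(?\<theta> \<star> evs X) \<bullet> ((str (At Y) (At ?H) ?h \<star> \<iota> [?D]) \<star> \<iota> [X]) = \<iota> [Y] \<star> evs X"
    by (simp add: strict.idn_tens_idn strict.interchange \<theta>)
  ultimately show ?thesis
    by simp
qed

lemma str_alpha:
  assumes "Dom C e = tob d \<boxdot> tob x" "Cod C e = \<I>"
  shows "str (Tn (Tn y d) x) y (RUnit C (tob y) \<cdot> (Idt C (tob y) \<boxtimes> e) \<cdot> Assoc C (tob y) (tob d) (tob x))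
    = \<iota> (fringe y) \<star> str (Tn d x) (Ob []) e"
  using assms
  by (simp add: str_Comp[where t = "Tn y (Ob [])"] str_Comp[where t = "Tn y (Tn d x)"] str_Assoc str_RUnit str_Tensor str_Idt)

lemma alpha_via_iso:
  assumes "Dom C e = D \<boxdot> X" "Cod C e = \<I>"
    and "strict.universal (\<iota> [Y] \<star> str (Tn (At D) (At X)) (Ob []) e) [Y, D] [X] [Y]"
  shows "arr_iso C (alpha_via C e D X Y) (Y \<boxdot> D) (IHom C X Y)"
  using universal_imp_adjunct_iso[of "RUnit C Y \<cdot> (Idt C Y \<boxtimes> e) \<cdot> Assoc C Y D X" "Tn (At Y) (At D)" "At X" "At Y"]
    str_alpha[of e "At D" "At X" "At Y"] assms by (simp add: alpha_via_def)

text \<open>Unwinding the inverse of \<open>alpha\<close> yields the first zigzag for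
  \<open>coev\<close>. A copairing satisfying both zigzags exists by universality, and the first
  zigzag alone determines it.\<close>

lemma coev:
  assumes "rigid C"
  shows "Dom C (coev C V) = \<I>" "Cod C (coev C V) = V \<boxdot> dual C V"
    and "strict.dual_pair [V] [dual C V] (evs V) (coevs V)"
proof -
  let ?D = "dual C V" and ?f = "RUnit C V \<cdot> (Idt C V \<boxtimes> ev C V) \<cdot> Assoc C V (dual C V) V"
  have iso: "arr_iso C (alpha C V V) (V \<boxdot> ?D) (IHom C V V)"
    unfolding alpha_def using universal_evaluation[OF assms] by (intro alpha_via_iso) simp_all
  note inv = arr_iso_inv[OF iso]
  note a = adjunct(1-3)[of "LUnit C V" \<I> V V, simplified]
  show c [simp]: "Dom C (coev C V) = \<I>" "Cod C (coev C V) = V \<boxdot> ?D"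
    using inv a by (simp_all add: coev_def)
  have "alpha C V V \<cdot> coev C V = adjunct C \<I> V V (LUnit C V)"
    unfolding coev_def using inv a by (simp add: Comp_reassoc[OF inv(6)])
  then have "Ev C V V \<cdot> ((alpha C V V \<cdot> coev C V) \<boxtimes> Idt C V) = LUnit C V"
    using a by simp
  moreover have "Ev C V V \<cdot> (alpha C V V \<boxtimes> Idt C V) = ?f"
    unfolding alpha_def alpha_via_def by (intro adjunct(3)) simp_all
  from Comp_reassoc[OF this, of "coev C V \<boxtimes> Idt C V"] have "Ev C V V \<cdot> ((alpha C V V \<cdot> coev C V) \<boxtimes> Idt C V) = ?f \<cdot> (coev C V \<boxtimes> Idt C V)"
    using inv by (simp add: Tensor_Comp')
  ultimately have "?f \<cdot> (coev C V \<boxtimes> Idt C V) = LUnit C V"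
    by simp
  then have "str (Tn (Tn (At V) (At ?D)) (At V)) (At V) ?f \<bullet> str (Tn (Ob []) (At V)) (Tn (Tn (At V) (At ?D)) (At V)) (coev C V \<boxtimes> Idt C V)
      = str (Tn (Ob []) (At V)) (At V) (LUnit C V)"
    by (subst str_Comp[symmetric]) simp_all
  then have zz: "(\<iota> [V] \<star> evs V) \<bullet> (coevs V \<star> \<iota> [V]) = \<iota> [V]"
    using str_alpha[of "ev C V" "At ?D" "At V" "At V"] str_LUnit[of "At V"] by (simp add: str_Tensor str_Idt)
  have "\<exists>k. strict.dual_pair [V] [?D] (evs V) k"
    using strict.dual_pair_universal[of "evs V" "[?D]" "[V]"] universal_ev[of V] universal_evaluation[OF assms, of V V]
    by simp
  then obtain k where k: "strict.dual_pair [V] [?D] (evs V) k"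
    by blast
  have "(\<iota> [V] \<star> evs V) \<bullet> (k \<star> \<iota> [V]) = (\<iota> [V] \<star> evs V) \<bullet> (coevs V \<star> \<iota> [V])"
    using strict.dual_pairD(7)[OF k] zz by simp
  then have "k = coevs V"
    by (rule strict.universalD(5)[OF universal_evaluation[OF assms], rotated 5])
      (simp_all add: strict.dual_pairD[OF k])
  then show "strict.dual_pair [V] [?D] (evs V) (coevs V)"
    using k by simp
qed

lemma str_rank:
  assumes "rigid C"
  shows "Dom C (rank C V) = \<I>" "Cod C (rank C V) = \<I>"
    "str (Ob []) (Ob []) (rank C V) = evs V \<bullet> \<tau> [V] [dual C V] \<bullet> coevs V"
proof -
  note [simp] = coev(1,2)[OF assms]
  show "Dom C (rank C V) = \<I>" "Cod C (rank C V) = \<I>"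
    by (simp_all add: rank_def ev_tau_def)
  show "str (Ob []) (Ob []) (rank C V) = evs V \<bullet> \<tau> [V] [dual C V] \<bullet> coevs V"
    using str_Sym[of "At V" "At (dual C V)"]
    by (simp add: rank_def ev_tau_def str_Comp[where t = "Tn (At V) (At (dual C V))"]
      str_Comp[where t = "Tn (At (dual C V)) (At V)"])
qed

subsection \<open>The symmetric group action and the antisymmetrizer\<close>

lemma tpow_eq: "tpow C V n = lob (replicate n V)"
  by (induction n) simp_all

lemma tjoin_eq: "tjoin C V m n = join (replicate m V) (replicate n V)"
  by (induction m) (simp_all add: tpow_eq)

abbreviation Pw :: "'a \<Rightarrow> nat \<Rightarrow> 'a tree" where
  "Pw V n \<equiv> Ob (replicate n V)"

lemma adj_swap:
  assumes "Suc k < n"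
  shows "Dom C (adj_swap C V n k) = lob (replicate n V) \<and> Cod C (adj_swap C V n k) = lob (replicate n V)
    \<and> str (Pw V n) (Pw V n) (adj_swap C V n k) = strict.adj V n k"
  using assms
proof (induction V n k rule: adj_swap.induct)
  case (1 V n)
  let ?S = "Tn (At V) (Tn (At V) (Pw V n))" and ?T = "Tn (Tn (At V) (At V)) (Pw V n)"
  let ?f = "adj_swap C V (Suc (Suc n)) 0"
  have d: "Dom C ?f = tob ?S" "Cod C ?f = tob ?S"
    by (simp_all add: tpow_eq)
  have "str ?S ?S ?f = \<tau> [V] [V] \<star> \<iota> (replicate n V)"
    using str_Assoc[of "At V" "At V" "Pw V n"] str_inv_Assoc[of "At V" "At V" "Pw V n"] str_Sym[of "At V" "At V"]
    by (simp add: tpow_eq str_Comp[where t = ?T] str_Tensor str_Idt)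
  moreover have "str ?S ?S ?f = str (Pw V (Suc (Suc n))) (Pw V (Suc (Suc n))) ?f"
    by (rule str_cong) (simp_all add: flat_Cons_Cons del: flat.simps(3))
  ultimately show ?case
    using d by (simp add: strict.adj_def)
next
  case (2 V n k)
  let ?S = "Tn (At V) (Pw V n)" and ?f = "adj_swap C V (Suc n) (Suc k)"
  have IH: "Dom C (adj_swap C V n k) = lob (replicate n V)" "Cod C (adj_swap C V n k) = lob (replicate n V)"
    "str (Pw V n) (Pw V n) (adj_swap C V n k) = strict.adj V n k"
    using 2 by simp_all
  have "str ?S ?S ?f = \<iota> [V] \<star> strict.adj V n k"
    using IH by (simp add: str_Tensor str_Idt)
  moreover have "str ?S ?S ?f = str (Pw V (Suc n)) (Pw V (Suc n)) ?f"
    by (rule str_cong) (simp_all add: flat_Cons del: flat.simps(3))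
  ultimately show ?case
    using IH by (simp add: strict.adj_Suc)
qed simp_all

lemma word_act:
  assumes "\<forall>k\<in>set ks. Suc k < n"
  shows "Dom C (word_act C V n ks) = lob (replicate n V) \<and> Cod C (word_act C V n ks) = lob (replicate n V)
    \<and> str (Pw V n) (Pw V n) (word_act C V n ks) = strict.wact V n ks"
  using assms
proof (induction ks)
  case Nil
  then show ?case
    by (simp add: word_act_def tpow_eq str_Idt)
next
  case (Cons k ks)
  then show ?case
    using adj_swap[of k n V] by (simp add: word_act_def str_Comp[where t = "Pw V n"])
qed

text \<open>By \<open>wact_cong\<close> the word chosen in \<open>perm_act\<close> may be replaced
  by any other word for the permutation.\<close>

lemma perm_act:
  assumes "\<sigma> permutes {..<n}"
  shows "Dom C (perm_act C V n \<sigma>) = lob (replicate n V)" "Cod C (perm_act C V n \<sigma>) = lob (replicate n V)"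
    "\<lbrakk>\<forall>k\<in>set ks. Suc k < n; word_perm ks = \<sigma>\<rbrakk> \<Longrightarrow> str (Pw V n) (Pw V n) (perm_act C V n \<sigma>) = strict.wact V n ks"
proof -
  define ls where "ls = (SOME ks. (\<forall>k\<in>set ks. Suc k < n) \<and> word_perm ks = \<sigma>)"
  have "\<exists>ks. (\<forall>k\<in>set ks. Suc k < n) \<and> word_perm ks = \<sigma>"
    using permutes_word[of \<sigma> 0 n] assms by (simp add: atLeast0LessThan)
  from someI_ex[OF this] have ls: "\<forall>k\<in>set ls. Suc k < n" "word_perm ls = \<sigma>"
    by (simp_all add: ls_def)
  have p: "perm_act C V n \<sigma> = word_act C V n ls"
    by (simp add: perm_act_def ls_def)
  show "Dom C (perm_act C V n \<sigma>) = lob (replicate n V)" "Cod C (perm_act C V n \<sigma>) = lob (replicate n V)"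
    using word_act[OF ls(1)] by (simp_all add: p)
  show "str (Pw V n) (Pw V n) (perm_act C V n \<sigma>) = strict.wact V n ks"
    if "\<forall>k\<in>set ks. Suc k < n" "word_perm ks = \<sigma>"
    using word_act[OF ls(1), of V] strict.wact_cong[of ls 0 n ks V] that ls by (simp add: p)
qed

lemma zero_Hom_mod: "\<zero>\<^bsub>Hom_mod C X Y\<^esub> = ZeroArr C X Y"
  by (simp add: Hom_mod_def)

lemma finsum_in_Hom:
  assumes "\<And>s. s \<in> S \<Longrightarrow> Dom C (t s) = X \<and> Cod C (t s) = Y"
  shows "Dom C (finsum (Hom_mod C X Y) t S) = X" "Cod C (finsum (Hom_mod C X Y) t S) = Y"
proof -
  interpret M: module rat_ring "Hom_mod C X Y" by (rule Hom_module)
  have "finsum (Hom_mod C X Y) t S \<in> carrier (Hom_mod C X Y)"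
    using assms by (intro M.finsum_closed) (auto simp: Hom_mod_def)
  then show "Dom C (finsum (Hom_mod C X Y) t S) = X" "Cod C (finsum (Hom_mod C X Y) t S) = Y"
    by (simp_all add: Hom_mod_def)
qed

lemma finsum_additive:
  assumes hom: "\<And>f. Dom C f = X \<Longrightarrow> Cod C f = Y \<Longrightarrow> Dom C (\<phi> f) = P \<and> Cod C (\<phi> f) = Q"
    and add: "\<And>f g. \<lbrakk>Dom C f = X; Cod C f = Y; Dom C g = X; Cod C g = Y\<rbrakk> \<Longrightarrow> \<phi> (f \<boxplus> g) = \<phi> f \<boxplus> \<phi> g"
    and "finite S" and t: "\<And>s. s \<in> S \<Longrightarrow> Dom C (t s) = X \<and> Cod C (t s) = Y"
  shows "\<phi> (finsum (Hom_mod C X Y) t S) = finsum (Hom_mod C P Q) (\<lambda>s. \<phi> (t s)) S"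
  using assms(3,4)
proof (induction S)
  case empty
  interpret M: module rat_ring "Hom_mod C X Y" by (rule Hom_module)
  interpret N: module rat_ring "Hom_mod C P Q" by (rule Hom_module)
  have z: "Dom C (ZeroArr C X Y) = X" "Cod C (ZeroArr C X Y) = Y"
    using M.zero_closed by (simp_all add: Hom_mod_def)
  have "\<phi> (ScaleArr C 0 (ZeroArr C X Y)) = ScaleArr C 0 (\<phi> (ZeroArr C X Y))"
    by (rule additive_scale[OF hom add z])
  also have "ScaleArr C 0 (ZeroArr C X Y) = ZeroArr C X Y"
    using z by (simp add: scale_simps(4))
  also have "ScaleArr C 0 (\<phi> (ZeroArr C X Y)) = ZeroArr C P Q"
    using hom[OF z] by (simp add: scale_simps(4))
  finally show ?case
    by (simp add: zero_Hom_mod)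
next
  case (insert s S)
  interpret M: module rat_ring "Hom_mod C X Y" by (rule Hom_module)
  interpret N: module rat_ring "Hom_mod C P Q" by (rule Hom_module)
  have "finsum (Hom_mod C X Y) t (insert s S) = t s \<boxplus> finsum (Hom_mod C X Y) t S"
    using insert by (subst M.finsum_insert) (auto simp: Hom_mod_def)
  moreover have "finsum (Hom_mod C P Q) (\<lambda>s. \<phi> (t s)) (insert s S) = \<phi> (t s) \<boxplus> finsum (Hom_mod C P Q) (\<lambda>s. \<phi> (t s)) S"
    using insert hom by (subst N.finsum_insert) (auto simp: Hom_mod_def)
  ultimately show ?case
    using insert add finsum_in_Hom[of S t X Y] by simp
qed

lemma finsum_const:
  assumes "finite S" "Dom C f = X" "Cod C f = Y"
  shows "finsum (Hom_mod C X Y) (\<lambda>s. f) S = ScaleArr C (of_nat (card S)) f"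
  using assms(1)
proof (induction S)
  case empty
  interpret M: module rat_ring "Hom_mod C X Y" by (rule Hom_module)
  show ?case
    using assms by (simp add: scale_simps(4) zero_Hom_mod)
next
  case (insert s S)
  interpret M: module rat_ring "Hom_mod C X Y" by (rule Hom_module)
  have "finsum (Hom_mod C X Y) (\<lambda>s. f) (insert s S) = f \<boxplus> finsum (Hom_mod C X Y) (\<lambda>s. f) S"
    using insert assms by (subst M.finsum_insert) (auto simp: Hom_mod_def)
  then show ?case
    using insert by (simp add: scale_simps(1,3))
qed

text \<open>Let \<open>B\<close> be the signed average. Every signed permutation fixes
  \<open>alt\<close>, so \<open>B\<close> composed with \<open>alt\<close> is \<open>alt\<close>.
  Reindexing the sum shows that \<open>B\<close> is antisymmetric, so it absorbs \<open>alt\<close>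
  and the same composite is \<open>B\<close>.\<close>

lemma antisym:
  "Dom C (antisym C V n) = lob (replicate n V)" "Cod C (antisym C V n) = lob (replicate n V)"
  "str (Pw V n) (Pw V n) (antisym C V n) = strict.alt V n"
proof -
  let ?X = "lob (replicate n V)" and ?P = "Pw V n"
  let ?M = "Hom_mod C ?X ?X" and ?S = "{\<sigma>. \<sigma> permutes {..<n}}"
  define t where "t = (\<lambda>\<sigma>. ScaleArr C (of_int (sign \<sigma>)) (perm_act C V n \<sigma>))"
  interpret M: module rat_ring ?M by (rule Hom_module)
  have fin: "finite ?S"
    by (simp add: finite_permutations)
  have t: "Dom C (t \<sigma>) = ?X" "Cod C (t \<sigma>) = ?X" if "\<sigma> permutes {..<n}" for \<sigma>
    using perm_act[OF that] by (simp_all add: t_def)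
  have anti: "antisym C V n = ScaleArr C (1 / fact n) (finsum ?M t ?S)"
    by (simp add: antisym_def t_def tpow_eq)
  note sum = finsum_in_Hom[of ?S t ?X ?X]
  show d: "Dom C (antisym C V n) = ?X" "Cod C (antisym C V n) = ?X"
    using sum t by (simp_all add: anti)
  have word: "\<exists>ks. (\<forall>k\<in>set ks. Suc k < n) \<and> word_perm ks = \<sigma>" if "\<sigma> permutes {..<n}" for \<sigma>
    using permutes_word[of \<sigma> 0 n] that by (simp add: atLeast0LessThan)
  \<comment> \<open>Composition with a transposition permutes the summands through the involution
    \<open>?h\<close> and reverses every sign.\<close>
  have swap: "antisym C V n \<cdot> a = ScaleArr C (-1) (antisym C V n)" if k: "Suc k < n" and a: "a = adj_swap C V n k" for k a
  proof -
    let ?h = "\<lambda>\<sigma>. \<sigma> \<circ> transpose k (Suc k)"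
    have a' [simp]: "Dom C a = ?X" "Cod C a = ?X"
      using adj_swap[OF k, of V] a by simp_all
    have tr: "transpose k (Suc k) permutes {..<n}"
      using k by (intro permutes_swap_id) auto
    have ta: "t \<sigma> \<cdot> a = ScaleArr C (-1) (t (?h \<sigma>))" if \<sigma>: "\<sigma> permutes {..<n}" for \<sigma>
    proof (rule str_inj[of ?P ?P])
      have h\<sigma>: "?h \<sigma> permutes {..<n}"
        by (rule permutes_compose[OF tr \<sigma>])
      obtain ks where ks: "\<forall>k\<in>set ks. Suc k < n" "word_perm ks = \<sigma>"
        using word[OF \<sigma>] by blast
      have ks': "\<forall>k\<in>set (ks @ [k]). Suc k < n" "word_perm (ks @ [k]) = ?h \<sigma>"
        using ks k by (auto simp: word_perm_append)
      have sg: "sign (?h \<sigma>) = - sign \<sigma>"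
        using sign_word_perm[of "ks @ [k]"] sign_word_perm[of ks] unfolding ks' ks by simp
      have "str ?P ?P (t \<sigma> \<cdot> a) = str ?P ?P (t \<sigma>) \<bullet> strict.adj V n k"
        using adj_swap[OF k, of V] a t[OF \<sigma>] by (subst str_Comp[where t = ?P]) simp_all
      also have "\<dots> = of_int (sign \<sigma>) \<rhd> strict.wact V n (ks @ [k])"
        using ks k perm_act[OF \<sigma>, where V = V] by (simp add: t_def str_scale strict.wact_append)
      also have "\<dots> = str ?P ?P (ScaleArr C (-1) (t (?h \<sigma>)))"
        using perm_act(1,2)[OF h\<sigma>, where V = V] perm_act(3)[OF h\<sigma> ks', where V = V] sg
        by (simp add: t_def str_scale)
      finally show "str ?P ?P (t \<sigma> \<cdot> a) = str ?P ?P (ScaleArr C (-1) (t (?h \<sigma>)))" .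
      show "Dom C (t \<sigma> \<cdot> a) = tob ?P" "Cod C (t \<sigma> \<cdot> a) = tob ?P"
        "Dom C (ScaleArr C (-1) (t (?h \<sigma>))) = tob ?P" "Cod C (ScaleArr C (-1) (t (?h \<sigma>))) = tob ?P"
        using t[OF \<sigma>] t[OF h\<sigma>] by simp_all
    qed
    have hS: "?h ` ?S = ?S"
    proof
      show "?h ` ?S \<subseteq> ?S"
        using permutes_compose[OF tr] by auto
      show "?S \<subseteq> ?h ` ?S"
      proof
        fix \<sigma> assume "\<sigma> \<in> ?S"
        then have "?h \<sigma> \<in> ?S" "\<sigma> = ?h (?h \<sigma>)"
          using permutes_compose[OF tr] by (auto simp: fun_eq_iff)
        then show "\<sigma> \<in> ?h ` ?S"
          by (metis imageI)
      qed
    qed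
    have inj: "inj_on ?h ?S"
      by (rule inj_on_inverseI[of _ ?h]) (simp add: fun_eq_iff)
    have "finsum ?M t ?S \<cdot> a = finsum ?M (\<lambda>\<sigma>. t \<sigma> \<cdot> a) ?S"
      using fin t by (intro finsum_additive[of ?X ?X "\<lambda>f. f \<cdot> a"]) (simp_all add: Comp_add)
    also have "\<dots> = finsum ?M (\<lambda>\<sigma>. ScaleArr C (-1) (t (?h \<sigma>))) ?S"
      using t ta permutes_compose[OF tr] by (intro M.finsum_cong') (auto simp: Hom_mod_def)
    also have "\<dots> = finsum ?M (\<lambda>\<sigma>. ScaleArr C (-1) (t \<sigma>)) (?h ` ?S)"
    proof (rule M.finsum_reindex[OF _ inj, symmetric])
      show "(\<lambda>\<sigma>. ScaleArr C (-1) (t \<sigma>)) \<in> ?h ` ?S \<rightarrow> carrier ?M"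
        unfolding hS using t by (auto simp: Hom_mod_def)
    qed
    also have "\<dots> = ScaleArr C (-1) (finsum ?M t ?S)"
      unfolding hS using fin t
      by (intro finsum_additive[of ?X ?X "\<lambda>f. ScaleArr C (-1) f", symmetric]) (simp_all add: scale_add_right)
    finally show ?thesis
      using sum t by (simp add: anti Comp_scale scale_simps(2))
  qed
  let ?B = "str ?P ?P (antisym C V n)"
  have B [simp]: "sarr ?B" "sdom ?B = replicate n V" "scod ?B = replicate n V"
    using d by simp_all
  \<comment> \<open>The sum over permutations lives in the hom modules of \<open>C\<close>, so
    \<open>alt\<close> is pulled back to an arrow \<open>a\<close> there.\<close>
  obtain a where a: "Dom C a = ?X" "Cod C a = ?X" "str ?P ?P a = strict.alt V n"
    using str_surj[of "strict.alt V n" ?P ?P] by auto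
  have ta: "t \<sigma> \<cdot> a = a" if \<sigma>: "\<sigma> permutes {..<n}" for \<sigma>
  proof (rule str_inj[of ?P ?P])
    obtain ks where ks: "\<forall>k\<in>set ks. Suc k < n" "word_perm ks = \<sigma>"
      using word[OF \<sigma>] by blast
    have "str ?P ?P (t \<sigma> \<cdot> a) = str ?P ?P (t \<sigma>) \<bullet> strict.alt V n"
      using t[OF \<sigma>] a by (subst str_Comp[where t = ?P]) simp_all
    also have "\<dots> = of_int (sign \<sigma>) \<rhd> (strict.wact V n ks \<bullet> strict.alt V n)"
      using perm_act[OF \<sigma>, where V = V] ks by (simp add: t_def str_scale)
    also have "\<dots> = of_int (sign \<sigma> * sign \<sigma>) \<rhd> strict.alt V n"
      using strict.wact_alt[OF ks(1), of V] ks(2) by (simp flip: of_int_mult)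
    finally show "str ?P ?P (t \<sigma> \<cdot> a) = str ?P ?P a"
      using a by (simp add: strict.scl_one sign_idempotent)
  qed (use t[OF \<sigma>] a in simp_all)
  have "finsum ?M t ?S \<cdot> a = finsum ?M (\<lambda>\<sigma>. t \<sigma> \<cdot> a) ?S"
    using fin t a by (intro finsum_additive[of ?X ?X "\<lambda>f. f \<cdot> a"]) (simp_all add: Comp_add)
  also have "\<dots> = finsum ?M (\<lambda>\<sigma>. a) ?S"
    using ta a by (intro M.finsum_cong') (auto simp: Hom_mod_def)
  also have "\<dots> = ScaleArr C (fact n) a"
    using finsum_const[OF fin a(1,2)] card_permutations[of "{..<n}" n] by simp
  finally have "antisym C V n \<cdot> a = a"
    using sum t a by (simp add: anti Comp_scale scale_simps(2,3))
  then have "?B \<bullet> strict.alt V n = strict.alt V n"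
    using a d str_Comp[of a ?P ?P "antisym C V n" ?P] by simp
  moreover have "?B \<bullet> (\<iota> [] \<star> strict.alt V n \<star> \<iota> []) = ?B"
  proof (rule strict.alt_absorb_right)
    fix k assume k: "Suc k < n"
    have "?B \<bullet> strict.adj V n k = str ?P ?P (antisym C V n \<cdot> adj_swap C V n k)"
      using adj_swap[OF k, of V] d by (subst str_Comp[where t = ?P]) simp_all
    then show "?B \<bullet> (\<iota> [] \<star> strict.adj V n k \<star> \<iota> []) = (-1) \<rhd> ?B"
      using swap[OF k refl] d k by (simp add: str_scale)
  qed simp_all
  ultimately show "?B = strict.alt V n"
    by simp
qed

subsection \<open>Exterior powers of an object\<close>

lemma wedge:
  assumes "pseudo_abelian C"
  shows "Dom C (wedge_inj C V n) = wedge C V n" "Cod C (wedge_inj C V n) = lob (replicate n V)"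
    "Dom C (wedge_proj C V n) = lob (replicate n V)" "Cod C (wedge_proj C V n) = wedge C V n"
    "wedge_proj C V n \<cdot> wedge_inj C V n = Idt C (wedge C V n)"
    "wedge_inj C V n \<cdot> wedge_proj C V n = antisym C V n"
proof -
  let ?A = "antisym C V n"
  have "?A \<cdot> ?A = ?A"
    by (rule str_inj[of "Pw V n" "Pw V n"])
      (simp_all add: antisym str_Comp[where t = "Pw V n"] strict.alt_idem)
  then have "\<exists>W i p. splits C ?A W i p"
    using assms antisym[where V = V and n = n] by (simp add: pseudo_abelian_def)
  then have "\<exists>d. (\<lambda>(W, i, p). splits C ?A W i p) d"
    by auto
  then have "(\<lambda>(W, i, p). splits C ?A W i p) (wedge_data C V n)"
    unfolding wedge_data_def by (rule someI_ex)
  then have "splits C ?A (wedge C V n) (wedge_inj C V n) (wedge_proj C V n)"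
    by (simp add: wedge_def wedge_inj_def wedge_proj_def case_prod_beta)
  then show "Dom C (wedge_inj C V n) = wedge C V n" "Cod C (wedge_inj C V n) = lob (replicate n V)"
    "Dom C (wedge_proj C V n) = lob (replicate n V)" "Cod C (wedge_proj C V n) = wedge C V n"
    "wedge_proj C V n \<cdot> wedge_inj C V n = Idt C (wedge C V n)"
    "wedge_inj C V n \<cdot> wedge_proj C V n = antisym C V n"
    by (simp_all add: splits_def antisym)
qed

abbreviation injs :: "'a \<Rightarrow> nat \<Rightarrow> 'a list \<times> 'b option \<times> 'a list" where
  "injs V n \<equiv> str (At (wedge C V n)) (Pw V n) (wedge_inj C V n)"

abbreviation prjs :: "'a \<Rightarrow> nat \<Rightarrow> 'a list \<times> 'b option \<times> 'a list" where
  "prjs V n \<equiv> str (Pw V n) (At (wedge C V n)) (wedge_proj C V n)"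

lemma exterior_powers:
  assumes "rigid C" "pseudo_abelian C"
  shows "exterior_powers sarr sdom scod sidn scmp stens sswp splus sscl V (dual C V) (evs V) (coevs V)
    (wedge C V) (wedge C (dual C V)) (injs V) (prjs V) (injs (dual C V)) (prjs (dual C V))"
proof -
  note [simp] = wedge[OF assms(2)]
  have "prjs U n \<bullet> injs U n = \<iota> [wedge C U n] \<and> injs U n \<bullet> prjs U n = strict.alt U n" for U n
    by (simp add: str_Idt antisym flip: str_Comp)
  then show ?thesis
    using coev(3)[OF assms(1)] by unfold_locales simp_all
qed

lemma ev_pow:
  "Dom C (ev_pow C V n) = lob (replicate n (dual C V)) \<boxdot> lob (replicate n V) \<and> Cod C (ev_pow C V n) = \<I>
   \<and> str (Tn (Pw (dual C V) n) (Pw V n)) (Ob []) (ev_pow C V n) = strict.parallel_pow V (dual C V) (evs V) n"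
proof (induction n)
  case 0
  then show ?case
    using str_LUnit[of "Ob []"] by simp
next
  case (Suc n)
  let ?D = "dual C V"
  let ?S = "Tn (Tn (At ?D) (Pw ?D n)) (Tn (At V) (Pw V n))" and ?T = "Tn (Tn (At ?D) (At V)) (Tn (Pw ?D n) (Pw V n))"
  let ?f = "ev_pow C V (Suc n)"
  have P: "sarr (strict.parallel_pow V ?D (evs V) n)" "scod (strict.parallel_pow V ?D (evs V) n) = []"
    "sdom (strict.parallel_pow V ?D (evs V) n) = replicate n ?D @ replicate n V"
    using Suc by (metis str(3) tob.simps(2,3) lob.simps(1), metis str(2) fringe.simps(2), metis str(1) fringe.simps(2,3))
  have f: "?f = LUnit C \<I> \<cdot> (ev C V \<boxtimes> ev_pow C V n) \<cdot> middle_swap C ?D (lob (replicate n ?D)) V (lob (replicate n V))"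
    by (simp add: tpow_eq)
  have "str ?S (Ob []) ?f = (evs V \<star> strict.parallel_pow V ?D (evs V) n) \<bullet> (\<iota> [?D] \<star> \<tau> (replicate n ?D) [V] \<star> \<iota> (replicate n V))"
    unfolding f using Suc P str_middle_swap[of "At ?D" "Pw ?D n" "At V" "Pw V n"] str_LUnit[of "Ob []"]
    by (simp add: str_Comp[where t = "Tn (Ob []) (Ob [])"] str_Comp[where t = ?T] str_Tensor)
  moreover have "str ?S (Ob []) ?f = str (Tn (Pw ?D (Suc n)) (Pw V (Suc n))) (Ob []) ?f"
    using flat_Cons[of ?D "replicate n ?D"] flat_Cons[of V "replicate n V"] by (intro str_cong) simp_all
  moreover have "Dom C ?f = lob (replicate (Suc n) ?D) \<boxdot> lob (replicate (Suc n) V)" "Cod C ?f = \<I>"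
    unfolding f using Suc by simp_all
  ultimately show ?case
    by simp
qed

lemmas ev_pow_dc [simp] = ev_pow[THEN conjunct1] ev_pow[THEN conjunct2, THEN conjunct1]
  and str_ev_pow = ev_pow[THEN conjunct2, THEN conjunct2]

lemma ev_pow_tau:
  "Dom C (ev_pow_tau C V n) = lob (replicate n V) \<boxdot> lob (replicate n (dual C V))" "Cod C (ev_pow_tau C V n) = \<I>"
  "str (Tn (Pw V n) (Pw (dual C V) n)) (Ob []) (ev_pow_tau C V n)
   = strict.parallel_pow V (dual C V) (evs V) n \<bullet> \<tau> (replicate n V) (replicate n (dual C V))"
  using str_Sym[of "Pw V n" "Pw (dual C V) n"]
  by (simp_all add: ev_pow_tau_def tpow_eq str_Comp[where t = "Tn (Pw (dual C V) n) (Pw V n)"] str_ev_pow)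

lemma tjoin_iso: "arr_iso C (tjoin C V m n) (lob (replicate m V) \<boxdot> lob (replicate n V)) (lob (replicate (m + n) V))"
  unfolding tjoin_eq replicate_add by (rule join_iso)

lemma str_tjoin: "str (Tn (Pw V m) (Pw V n)) (Pw V (m + n)) (tjoin C V m n) = \<iota> (replicate (m + n) V)"
  using arr_iso_inv[OF tjoin_iso[of V m n]]
  by (subst str_idn) (simp_all add: tjoin_eq Tensor_Idt replicate_add)

text \<open>One translation for both \<open>iota_lower\<close> and \<open>iota_upper\<close>, which
  differ in the pairing \<open>e\<close> and in which of \<open>V\<close> and its dual plays the
  part of \<open>A\<close> and of \<open>B\<close>.\<close>

lemma contraction:
  assumes e: "Dom C e = lob (replicate i A) \<boxdot> lob (replicate i B)" "Cod C e = \<I>"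
    and a: "Dom C a = X" "Cod C a = lob (replicate i A)"
    and b: "Dom C b = Y" "Cod C b = lob (replicate (i + j) B)"
    and p: "Dom C p = lob (replicate j B)" "Cod C p = Z"
    and f: "f = p \<cdot> contract C e (tpow C A i) (tpow C B i) (tpow C B j)
      \<cdot> (Idt C (tpow C A i) \<boxtimes> inv_arr C (tjoin C B i j)) \<cdot> (a \<boxtimes> b)"
  shows "Dom C f = X \<boxdot> Y" "Cod C f = Z"
    "str (Tn (At X) (At Y)) (At Z) f = str (Pw B j) (At Z) p
      \<bullet> (str (Tn (Pw A i) (Pw B i)) (Ob []) e \<star> \<iota> (replicate j B)) \<bullet> (str (At X) (Pw A i) a \<star> str (At Y) (Pw B (i + j)) b)"
proof -
  let ?A = "Pw A i" and ?B = "Pw B i" and ?B' = "Pw B j"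
  note [simp] = arr_iso_inv[OF tjoin_iso[of B i j]] e a b p
  have c: "contract C e (tpow C A i) (tpow C B i) (tpow C B j) =
      LUnit C (tob ?B') \<cdot> (e \<boxtimes> Idt C (tob ?B')) \<cdot> inv_arr C (Assoc C (tob ?A) (tob ?B) (tob ?B'))" (is "_ = ?c")
    by (simp add: contract_def tpow_eq)
  have cd [simp]: "Dom C ?c = tob (Tn ?A (Tn ?B ?B'))" "Cod C ?c = tob ?B'"
    by simp_all
  have f': "f = p \<cdot> ?c \<cdot> (Idt C (tob ?A) \<boxtimes> inv_arr C (tjoin C B i j)) \<cdot> (a \<boxtimes> b)"
    unfolding f c by (simp add: tpow_eq)
  show "Dom C f = X \<boxdot> Y" "Cod C f = Z"
    unfolding f' by simp_all
  have sc: "str (Tn ?A (Tn ?B ?B')) ?B' ?c = str (Tn ?A ?B) (Ob []) e \<star> \<iota> (replicate j B)"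
    using str_inv_Assoc[of ?A ?B ?B'] str_LUnit[of ?B']
    by (simp add: str_Comp[where t = "Tn (Ob []) ?B'"] str_Comp[where t = "Tn (Tn ?A ?B) ?B'"] str_Tensor str_Idt)
  have sj: "str (Pw B (i + j)) (Tn ?B ?B') (inv_arr C (tjoin C B i j)) = \<iota> (replicate (i + j) B)"
    using str_inv_idn[of "tjoin C B i j" "Tn ?B ?B'" "Pw B (i + j)"] tjoin_iso[of B i j] str_tjoin[where V = B and m = i and n = j]
    by (simp add: replicate_add)
  have "str (Tn (At X) (At Y)) (At Z) f = str ?B' (At Z) p \<bullet> str (Tn ?A (Tn ?B ?B')) ?B' ?c
    \<bullet> str (Tn ?A (Pw B (i + j))) (Tn ?A (Tn ?B ?B')) (Idt C (tob ?A) \<boxtimes> inv_arr C (tjoin C B i j))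
    \<bullet> str (Tn (At X) (At Y)) (Tn ?A (Pw B (i + j))) (a \<boxtimes> b)"
    unfolding f' by (simp add: str_Comp[where t = "?B'"] str_Comp[where t = "Tn ?A (Tn ?B ?B')"]
        str_Comp[where t = "Tn ?A (Pw B (i + j))"] del: Comp_assoc' str)
  also have "\<dots> = str ?B' (At Z) p \<bullet> (str (Tn ?A ?B) (Ob []) e \<star> \<iota> (replicate j B)) \<bullet> (str (At X) ?A a \<star> str (At Y) (Pw B (i + j)) b)"
    unfolding sc by (simp add: str_Tensor sj str_Idt strict.idn_tens_idn del: replicate_add)
  finally show "str (Tn (At X) (At Y)) (At Z) f = str (Pw B j) (At Z) p
      \<bullet> (str (Tn (Pw A i) (Pw B i)) (Ob []) e \<star> \<iota> (replicate j B)) \<bullet> (str (At X) (Pw A i) a \<star> str (At Y) (Pw B (i + j)) b)" .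
qed

text \<open>The pairing is half of a dual pair by \<open>dual_pair_parallel\<close>, and any dual
  pair represents internal homs.\<close>

lemma wedge_ev:
  assumes "rigid C" "pseudo_abelian C"
  shows "arr_iso C (alpha_via C (wedge_ev C V n) (wedge C (dual C V) n) (wedge C V n) Y)
    (Y \<boxdot> wedge C (dual C V) n) (IHom C (wedge C V n) Y)"
proof -
  interpret exterior_powers sarr sdom scod sidn scmp stens sswp splus sscl V "dual C V" "evs V" "coevs V"
    "wedge C V" "wedge C (dual C V)" "injs V" "prjs V" "injs (dual C V)" "prjs (dual C V)"
    by (rule exterior_powers[OF assms])
  note [simp] = wedge[OF assms(2)]
  let ?D = "dual C V"
  have "str (Tn (At (wedge C ?D n)) (At (wedge C V n))) (Ob []) (wedge_ev C V n)
    = strict.parallel_pow V ?D (evs V) n \<bullet> (injs ?D n \<star> injs V n)"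
    by (simp add: wedge_ev_def str_Comp[where t = "Tn (Pw ?D n) (Pw V n)"] str_ev_pow str_Tensor)
  moreover obtain d where "strict.dual_pair [wedge C V n] [wedge C ?D n]
    (strict.parallel_pow V ?D (evs V) n \<bullet> (injs ?D n \<star> injs V n)) d"
    using dual_pair_parallel[of n] by blast
  from strict.universal_dual_pair[OF this, of "[Y]"] have
    "strict.universal (\<iota> [Y] \<star> (strict.parallel_pow V ?D (evs V) n \<bullet> (injs ?D n \<star> injs V n))) [Y, wedge C ?D n] [wedge C V n] [Y]"
    by simp
  ultimately show ?thesis
    by (intro alpha_via_iso) (simp_all add: wedge_ev_def)
qed

subsection \<open>Binomial coefficients\<close>

lemma shift_dc [simp]:
  "\<lbrakk>Dom C x = \<I>; Cod C x = \<I>\<rbrakk> \<Longrightarrow> Dom C (shift C x q) = \<I>"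
  "\<lbrakk>Dom C x = \<I>; Cod C x = \<I>\<rbrakk> \<Longrightarrow> Cod C (shift C x q) = \<I>"
  by (simp_all add: shift_def)

lemma falling_dc [simp]:
  assumes "Dom C x = \<I>" "Cod C x = \<I>"
  shows "Dom C (falling C x k) = \<I>" "Cod C (falling C x k) = \<I>"
  using assms by (induction k) simp_all

lemma shift_shift: "\<lbrakk>Dom C x = \<I>; Cod C x = \<I>\<rbrakk> \<Longrightarrow> shift C (shift C x p) q = shift C x (p + q)"
  by (simp add: shift_def add_assoc scale_simps(1))

text \<open>The constant built up by the recursion is \<open>fact j / fact (i + j)\<close>; for
  invertibility only its being nonzero matters.\<close>

lemma trace_coeff_falling:
  assumes r: "Dom C r = \<I>" "Cod C r = \<I>"
  shows "\<exists>q. q \<noteq> 0 \<and> strict.trace_coeff (str (Ob []) (Ob []) r) i j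
    = q \<rhd> str (Ob []) (Ob []) (falling C (shift C r (- of_nat j)) i)"
proof (induction i)
  case 0
  then show ?case
    by (intro exI[of _ 1]) (simp add: str_Idt strict.scl_one)
next
  case (Suc i)
  then obtain q where q: "q \<noteq> 0" "strict.trace_coeff (str (Ob []) (Ob []) r) i j
    = q \<rhd> str (Ob []) (Ob []) (falling C (shift C r (- of_nat j)) i)"
    by blast
  have "str (Ob []) (Ob []) (shift C (shift C r (- of_nat j)) (- of_nat i)) = str (Ob []) (Ob []) r \<uplus> (- of_nat (i + j)) \<rhd> \<iota> []"
    unfolding shift_shift[OF r] using r by (simp add: shift_def str_add str_scale str_Idt add.commute)
  then have "strict.trace_coeff (str (Ob []) (Ob []) r) (Suc i) j
    = (1 / of_nat (Suc (i + j)) * q) \<rhd> str (Ob []) (Ob []) (falling C (shift C r (- of_nat j)) (Suc i))"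
    using q r by (simp add: str_Comp[where t = "Ob []"] del: of_nat_Suc of_nat_add)
  then show ?case
    using q(1) by (intro exI[of _ "1 / of_nat (Suc (i + j)) * q"]) (simp del: of_nat_Suc of_nat_add)
qed

lemma trace_coeff_inverse:
  assumes r: "Dom C r = \<I>" "Cod C r = \<I>"
    and unit: "binom C (shift C r (- of_nat j)) i \<in> Units (Hom_mod C \<I> \<I>)"
  shows "\<exists>x. strict.inverse_arrs (strict.trace_coeff (str (Ob []) (Ob []) r) i j) x"
proof -
  let ?f = "falling C (shift C r (- of_nat j)) i" and ?s = "str (Ob []) (Ob [])"
  obtain y where y: "Dom C y = \<I>" "Cod C y = \<I>" "y \<cdot> binom C (shift C r (- of_nat j)) i = Idt C \<I>"
    "binom C (shift C r (- of_nat j)) i \<cdot> y = Idt C \<I>"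
    using unit by (auto simp: Units_def Hom_mod_def)
  obtain q where q: "q \<noteq> 0" "strict.trace_coeff (?s r) i j = q \<rhd> ?s ?f"
    using trace_coeff_falling[OF r] by blast
  have b: "binom C (shift C r (- of_nat j)) i = ScaleArr C (1 / fact i) ?f"
    by (simp add: binom_def)
  have "?s (y \<cdot> ScaleArr C (1 / fact i) ?f) = \<iota> []" "?s (ScaleArr C (1 / fact i) ?f \<cdot> y) = \<iota> []"
    using y unfolding b by (simp_all add: str_Idt)
  then have 1: "(1 / fact i) \<rhd> (?s y \<bullet> ?s ?f) = \<iota> []" "(1 / fact i) \<rhd> (?s ?f \<bullet> ?s y) = \<iota> []"
    using y r by (simp_all add: str_Comp[where t = "Ob []"] str_scale)
  show ?thesis
    \<comment> \<open>\<open>y\<close> inverts the falling factorial divided by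
      \<open>fact i\<close>, whereas the coefficient is \<open>q\<close> times the falling
      factorial.\<close>
    using q y r 1 by (intro exI[of _ "(1 / (fact i * q)) \<rhd> ?s y"]) (simp add: strict.inverse_arrs_def)
qed

lemma binom_rat: "binom C (ScaleArr C q (Idt C \<I>)) k = ScaleArr C (q gchoose k) (Idt C \<I>)"
proof -
  have "falling C (ScaleArr C q (Idt C \<I>)) k = ScaleArr C (\<Prod>i = 0..<k. q - of_nat i) (Idt C \<I>)"
  proof (induction k)
    case (Suc k)
    then show ?case
      by (simp add: shift_def Comp_scale scale_simps(2) mult.commute flip: scale_simps(1))
  qed (simp add: scale_simps(3))
  then show ?thesis
    by (simp add: binom_def scale_simps(2) gbinomial_prod_rev)
qed

text \<open>For rank \<open>g\<close> the arguments become the natural numbers \<open>g - i\<close>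
  and \<open>i\<close>, so both values have the form \<open>n choose n\<close>.\<close>

lemma strong_alternating_rank_binom:
  assumes "rank C V = ScaleArr C (of_nat g) (Idt C \<I>)" "i \<le> g"
  shows "binom C (shift C (rank C V) (- of_nat i)) (g - i) = Idt C \<I>"
    "binom C (shift C (rank C V) (of_nat i - of_nat g)) i = Idt C \<I>"
proof -
  have s: "shift C (rank C V) q = ScaleArr C (of_nat g + q) (Idt C \<I>)" for q
    by (simp add: assms(1) shift_def scale_simps(1))
  have "of_nat g + - of_nat i = (of_nat (g - i) :: rat)" "of_nat g + (of_nat i - of_nat g) = (of_nat i :: rat)"
    using assms(2) by (simp_all add: of_nat_diff)
  then show "binom C (shift C (rank C V) (- of_nat i)) (g - i) = Idt C \<I>"
    "binom C (shift C (rank C V) (of_nat i - of_nat g)) i = Idt C \<I>"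
    by (simp_all only: s binom_rat flip: binomial_gbinomial) (simp_all add: scale_simps(3))
qed

subsection \<open>The duality morphisms\<close>

lemma invertible_obj_str: "invertible_obj C X \<Longrightarrow> strict.invertible [X]"
  unfolding invertible_obj_def isomorphic_obj_def strict.invertible_def
  using str_inv[of _ "Tn (At X) (At _)" "Ob []"] by fastforce

text \<open>Treats one ordered pair \<open>i\<close>, \<open>j\<close> with
  \<open>i + j = g\<close>; the remaining isomorphisms arise from exchanging \<open>i\<close> and
  \<open>j\<close>, under which the two binomial hypotheses are exchanged.\<close>

lemma duality:
  assumes rigid: "rigid C" and pa: "pseudo_abelian C" and g: "g = i + j"
    and L: "invertible_obj C (wedge C V g)"
    and bi: "binom C (shift C (rank C V) (- of_nat j)) i \<in> Units (Hom_mod C \<I> \<I>)"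
    and bj: "binom C (shift C (rank C V) (- of_nat i)) j \<in> Units (Hom_mod C \<I> \<I>)"
  shows "arr_iso C (D_upper C V i g) (wedge C V i) (wedge C (dual C V) j \<boxdot> wedge C (dual C (dual C V)) g)"
    "arr_iso C (D_lower C V i g) (wedge C (dual C V) i) (wedge C V j \<boxdot> wedge C (dual C V) g)"
    "arr_iso C (wedge_mult_adjunct C V i j) (wedge C V i) (IHom C (wedge C V j) (wedge C V g))"
    "arr_iso C (wedge_mult_adjunct C (dual C V) i j) (wedge C (dual C V) i) (IHom C (wedge C (dual C V) j) (wedge C (dual C V) g))"
proof -
  interpret exterior_powers sarr sdom scod sidn scmp stens sswp splus sscl V "dual C V" "evs V" "coevs V"
    "wedge C V" "wedge C (dual C V)" "injs V" "prjs V" "injs (dual C V)" "prjs (dual C V)"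
    by (rule exterior_powers[OF rigid pa])
  let ?D = "dual C V"
  note [simp] = wedge[OF pa] and rk = str_rank[OF rigid, of V]
  have gi: "g - i = j"
    by (simp add: g)
  have L': "strict.invertible [wedge C V (i + j)]"
    using invertible_obj_str[OF L] by (simp add: g)
  obtain x y where x: "strict.inverse_arrs (strict.trace_coeff r i j) x" and y: "strict.inverse_arrs (strict.trace_coeff r j i) y"
    using trace_coeff_inverse[OF rk(1,2) bi] trace_coeff_inverse[OF rk(1,2) bj] unfolding rk(3) by blast
  let ?l = "wedge_proj C V j \<cdot> contract C (ev_pow C V i) (tpow C ?D i) (tpow C V i) (tpow C V j)
      \<cdot> (Idt C (tpow C ?D i) \<boxtimes> inv_arr C (tjoin C V i j)) \<cdot> (wedge_inj C ?D i \<boxtimes> wedge_inj C V g)"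
  have l: "Dom C ?l = wedge C ?D i \<boxdot> wedge C V g" "Cod C ?l = wedge C V j"
    "str (Tn (At (wedge C ?D i)) (At (wedge C V g))) (At (wedge C V j)) ?l
      = prjs V j \<bullet> (strict.parallel_pow V ?D (evs V) i \<star> \<iota> (replicate j V)) \<bullet> (injs ?D i \<star> injs V (i + j))"
    unfolding g by (rule contraction[where e = "ev_pow C V i" and a = "wedge_inj C ?D i" and b = "wedge_inj C V (i + j)"
          and p = "wedge_proj C V j" and i = i and j = j and A = ?D and B = V, unfolded str_ev_pow]; simp)+
  have "arr_iso C (iota_lower C V i g) (wedge C ?D i) (IHom C (wedge C V g) (wedge C V j))"
    using universal_imp_adjunct_iso[of ?l "At (wedge C ?D i)" "At (wedge C V g)" "At (wedge C V j)"]
      universal_parallel_contraction[OF L' x y] l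
    by (simp add: iota_lower_def gi str_ev_pow g)
  from arr_iso_Comp[OF this arr_iso_inv_arr[OF wedge_ev[OF rigid pa]]]
  show "arr_iso C (D_lower C V i g) (wedge C (dual C V) i) (wedge C V j \<boxdot> wedge C (dual C V) g)"
    by (simp add: D_lower_def gi)
  let ?u = "wedge_proj C ?D j \<cdot> contract C (ev_pow_tau C V i) (tpow C V i) (tpow C ?D i) (tpow C ?D j)
      \<cdot> (Idt C (tpow C V i) \<boxtimes> inv_arr C (tjoin C ?D i j)) \<cdot> (wedge_inj C V i \<boxtimes> wedge_inj C ?D g)"
  have u: "Dom C ?u = wedge C V i \<boxdot> wedge C ?D g" "Cod C ?u = wedge C ?D j"
    "str (Tn (At (wedge C V i)) (At (wedge C ?D g))) (At (wedge C ?D j)) ?u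
      = prjs ?D j \<bullet> ((strict.parallel_pow V ?D (evs V) i \<bullet> \<tau> (replicate i V) (replicate i ?D)) \<star> \<iota> (replicate j ?D))
        \<bullet> (injs V i \<star> injs ?D (i + j))"
    unfolding g by (rule contraction[where e = "ev_pow_tau C V i" and a = "wedge_inj C V i" and b = "wedge_inj C ?D (i + j)"
          and p = "wedge_proj C ?D j" and i = i and j = j and A = V and B = ?D, unfolded ev_pow_tau(3)]; simp add: ev_pow_tau)+
  have "arr_iso C (iota_upper C V i g) (wedge C V i) (IHom C (wedge C ?D g) (wedge C ?D j))"
    using universal_imp_adjunct_iso[of ?u "At (wedge C V i)" "At (wedge C ?D g)" "At (wedge C ?D j)"]
      universal_parallel_contraction'[OF L' x y] u
    by (simp add: iota_upper_def gi ev_pow_tau(3) g)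
  from arr_iso_Comp[OF this arr_iso_inv_arr[OF wedge_ev[OF rigid pa]]]
  show "arr_iso C (D_upper C V i g) (wedge C V i) (wedge C (dual C V) j \<boxdot> wedge C (dual C (dual C V)) g)"
    by (simp add: D_upper_def gi)
  have m: "Dom C (wedge_mult C U i j) = wedge C U i \<boxdot> wedge C U j" "Cod C (wedge_mult C U i j) = wedge C U g"
    "str (Tn (At (wedge C U i)) (At (wedge C U j))) (At (wedge C U g)) (wedge_mult C U i j)
      = prjs U (i + j) \<bullet> (injs U i \<star> injs U j)" for U
    using str_tjoin[where V = U and m = i and n = j] arr_iso_inv[OF tjoin_iso[of U i j]]
    by (simp_all add: wedge_mult_def g str_Comp[where t = "Pw U (i + j)"] str_Comp[where t = "Tn (Pw U i) (Pw U j)"] str_Tensor)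
      (simp add: replicate_add)
  show "arr_iso C (wedge_mult_adjunct C V i j) (wedge C V i) (IHom C (wedge C V j) (wedge C V g))"
    using universal_imp_adjunct_iso[of "wedge_mult C V i j" "At (wedge C V i)" "At (wedge C V j)" "At (wedge C V g)"]
      universal_mult[OF L' x y] m[of V] by (simp add: wedge_mult_adjunct_def mult_def g)
  show "arr_iso C (wedge_mult_adjunct C (dual C V) i j) (wedge C (dual C V) i) (IHom C (wedge C (dual C V) j) (wedge C (dual C V) g))"
    using universal_imp_adjunct_iso[of "wedge_mult C ?D i j" "At (wedge C ?D i)" "At (wedge C ?D j)" "At (wedge C ?D g)"]
      universal_mult'[OF L' x y] m[of ?D] by (simp add: wedge_mult_adjunct_def mult'_def g)
qed

end

theorem corollary5p6:
  fixes C :: "('o, 'm) tensor_cat" (structure)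
    and V :: 'o
    and g :: nat
  assumes "rational_ACU_tensor_category C"
    and "rigid C"
    and "pseudo_abelian C"
    and "alternating_rank C V g"
  shows "(\<forall>i\<le>g.
      arr_iso C (D_upper C V i g)
        (wedge C V i)
        (wedge C (dual C V) (g - i) \<boxdot> wedge C (dual C (dual C V)) g) \<and>
      arr_iso C (D_lower C V (g - i) g)
        (wedge C (dual C V) (g - i))
        (wedge C V i \<boxdot> wedge C (dual C V) g) \<and>
      arr_iso C (D_upper C V (g - i) g)
        (wedge C V (g - i))
        (wedge C (dual C V) i \<boxdot> wedge C (dual C (dual C V)) g) \<and>
      arr_iso C (D_lower C V i g)
        (wedge C (dual C V) i)
        (wedge C V (g - i) \<boxdot> wedge C (dual C V) g) \<and>
      arr_iso C (wedge_mult_adjunct C V i (g - i))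
        (wedge C V i) (IHom C (wedge C V (g - i)) (wedge C V g)) \<and>
      arr_iso C (wedge_mult_adjunct C V (g - i) i)
        (wedge C V (g - i)) (IHom C (wedge C V i) (wedge C V g)) \<and>
      arr_iso C (wedge_mult_adjunct C (dual C V) i (g - i))
        (wedge C (dual C V) i) (IHom C (wedge C (dual C V) (g - i)) (wedge C (dual C V) g)) \<and>
      arr_iso C (wedge_mult_adjunct C (dual C V) (g - i) i)
        (wedge C (dual C V) (g - i)) (IHom C (wedge C (dual C V) i) (wedge C (dual C V) g)))
    \<and> (strong_alternating_rank C V g \<longrightarrow>
        (\<forall>i\<le>g. binom C (shift C (rank C V) (- of_nat i)) (g - i) = Idt C \<I> \<and>
               binom C (shift C (rank C V) (of_nat i - of_nat g)) i = Idt C \<I>))"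
proof -
  interpret rational_ACU_tensor_category C by (rule assms(1))
  have L: "invertible_obj C (wedge C V g)"
    and b: "\<And>i. i \<le> g \<Longrightarrow> binom C (shift C (rank C V) (- of_nat i)) (g - i) \<in> Units (Hom_mod C \<I> \<I>)"
    using assms(4) by (simp_all add: alternating_rank_def)
  have duality_i: "arr_iso C (D_upper C V i g) (wedge C V i) (wedge C (dual C V) (g - i) \<boxdot> wedge C (dual C (dual C V)) g) \<and>
      arr_iso C (D_lower C V i g) (wedge C (dual C V) i) (wedge C V (g - i) \<boxdot> wedge C (dual C V) g) \<and>
      arr_iso C (wedge_mult_adjunct C V i (g - i)) (wedge C V i) (IHom C (wedge C V (g - i)) (wedge C V g)) \<and>
      arr_iso C (wedge_mult_adjunct C (dual C V) i (g - i)) (wedge C (dual C V) i)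
        (IHom C (wedge C (dual C V) (g - i)) (wedge C (dual C V) g))"
    if i: "i \<le> g" for i
  proof -
    \<comment> \<open>The condition of \<open>alternating_rank\<close> at index
      \<open>g - i\<close>, where the lower entry \<open>g - (g - i)\<close> is
      \<open>i\<close>.\<close>
    have "g = i + (g - i)" "binom C (shift C (rank C V) (- of_nat (g - i))) i \<in> Units (Hom_mod C \<I> \<I>)"
      using i b[of "g - i"] by simp_all
    from duality[OF assms(2,3) this(1) L this(2) b[OF i]] show ?thesis
      by blast
  qed
  show ?thesis
  proof (rule conjI; intro allI impI)
    fix i assume i: "i \<le> g"
    have "g - (g - i) = i"
      using i by simp
    with duality_i[OF i] duality_i[of "g - i"] show "arr_iso C (D_upper C V i g) (wedge C V i) (wedge C (dual C V) (g - i) \<boxdot> wedge C (dual C (dual C V)) g) \<and>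
      arr_iso C (D_lower C V (g - i) g) (wedge C (dual C V) (g - i)) (wedge C V i \<boxdot> wedge C (dual C V) g) \<and>
      arr_iso C (D_upper C V (g - i) g) (wedge C V (g - i)) (wedge C (dual C V) i \<boxdot> wedge C (dual C (dual C V)) g) \<and>
      arr_iso C (D_lower C V i g) (wedge C (dual C V) i) (wedge C V (g - i) \<boxdot> wedge C (dual C V) g) \<and>
      arr_iso C (wedge_mult_adjunct C V i (g - i)) (wedge C V i) (IHom C (wedge C V (g - i)) (wedge C V g)) \<and>
      arr_iso C (wedge_mult_adjunct C V (g - i) i) (wedge C V (g - i)) (IHom C (wedge C V i) (wedge C V g)) \<and>
      arr_iso C (wedge_mult_adjunct C (dual C V) i (g - i)) (wedge C (dual C V) i)
        (IHom C (wedge C (dual C V) (g - i)) (wedge C (dual C V) g)) \<and>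
      arr_iso C (wedge_mult_adjunct C (dual C V) (g - i) i) (wedge C (dual C V) (g - i))
        (IHom C (wedge C (dual C V) i) (wedge C (dual C V) g))"
      by simp
  next
    fix i assume "strong_alternating_rank C V g" and i: "i \<le> g"
    then have "rank C V = ScaleArr C (of_nat g) (Idt C \<I>)"
      by (simp add: strong_alternating_rank_def)
    from strong_alternating_rank_binom[OF this i] show "binom C (shift C (rank C V) (- of_nat i)) (g - i) = Idt C \<I> \<and>
        binom C (shift C (rank C V) (of_nat i - of_nat g)) i = Idt C \<I>"
      by blast
  qed
qed

end
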